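(* Let $w$ be a non-negative integer. For a given pair $(G,\tau)$, where $G$ is a graph of order $n$ and treewidth at most $w$, and $\tau$ is a threshold function for $G$, an optimal partial incentive of $(G,\tau)$ can be computed in time $n^{O(w)}$.
   Context: All graphs are finite, simple and undirected. A threshold function for a graph $G$ is a function $\tau:V(G)\to\mathbb{Z}$. For $D\subseteq V(G)$, the hull $H_{(G,\tau)}(D)$ is the smallest set $H\subseteq V(G)$ such that $D\subseteq H$ and $u\in H$ for every vertex $u$ with $|H\cap N_G(u)|\geq\tau(u)$. A function $\sigma:V(G)\to\mathbb{N}_0$ is a partial incentive of $(G,\tau)$ if $H_{(G,\tau-\sigma)}(\emptyset)=V(G)$; it is optimal if its weight $\sum_{v\in V(G)}\sigma(v)$ is minimum among all partial incentives of $(G,\tau)$. *)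

theory Defs
  imports Complex_Main "HOL-Library.Landau_Symbols"
begin

type_synonym 'a graph = "'a set \<times> 'a set set"

abbreviation verts :: "'a graph \<Rightarrow> 'a set" where "verts \<equiv> fst"
abbreviation edges :: "'a graph \<Rightarrow> 'a set set" where "edges \<equiv> snd"

definition simple_graph :: "'a graph \<Rightarrow> bool" where
  "simple_graph G \<longleftrightarrow>
     finite (verts G) \<and> (\<forall>e\<in>edges G. e \<subseteq> verts G \<and> card e = 2)"

definition neighbours :: "'a graph \<Rightarrow> 'a \<Rightarrow> 'a set" where
  "neighbours G u = {v \<in> verts G. {u, v} \<in> edges G}"

definition connected_graph :: "'a graph \<Rightarrow> bool" where
  "connected_graph G \<longleftrightarrow>
     (\<forall>u\<in>verts G. \<forall>v\<in>verts G. (u, v) \<in> {(x, y). {x, y} \<in> edges G}\<^sup>*)"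

definition induced :: "'a graph \<Rightarrow> 'a set \<Rightarrow> 'a graph" where
  "induced G S = (verts G \<inter> S, {e \<in> edges G. e \<subseteq> S})"

definition cycle_in :: "'a graph \<Rightarrow> 'a list \<Rightarrow> bool" where
  "cycle_in G p \<longleftrightarrow> 3 \<le> length p \<and> distinct p \<and>
     successively (\<lambda>x y. {x, y} \<in> edges G) p \<and> {last p, hd p} \<in> edges G"

definition tree :: "'a graph \<Rightarrow> bool" where
  "tree T \<longleftrightarrow> simple_graph T \<and> verts T \<noteq> {} \<and> connected_graph T \<and> (\<nexists>p. cycle_in T p)"

definition tree_decomposition ::
    "'a graph \<Rightarrow> 'b graph \<Rightarrow> ('b \<Rightarrow> 'a set) \<Rightarrow> bool" where
  "tree_decomposition G T B \<longleftrightarrow> tree T \<and>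
     (\<Union>t\<in>verts T. B t) = verts G \<and>
     (\<forall>e\<in>edges G. \<exists>t\<in>verts T. e \<subseteq> B t) \<and>
     (\<forall>v\<in>verts G. connected_graph (induced T {t \<in> verts T. v \<in> B t}))"

text \<open>The subtraction truncates, so the graph without vertices gets width 0 instead of -1.\<close>

definition decomposition_width :: "'b graph \<Rightarrow> ('b \<Rightarrow> 'a set) \<Rightarrow> nat" where
  "decomposition_width T B = Max ((\<lambda>t. card (B t)) ` verts T) - 1"

text \<open>The trees of decompositions are finite, so nodes may be taken to be natural numbers.\<close>

definition treewidth :: "'a graph \<Rightarrow> nat" where
  "treewidth G = (LEAST k. \<exists>(T :: nat graph) B.
     tree_decomposition G T B \<and> decomposition_width T B = k)"

text \<open>The family of sets that are intersected below is closed under intersection and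
  contains the vertex set, so the intersection is its least member.\<close>

definition threshold_hull :: "'a graph \<Rightarrow> ('a \<Rightarrow> int) \<Rightarrow> 'a set \<Rightarrow> 'a set" where
  "threshold_hull G \<tau> D = \<Inter>{H. D \<subseteq> H \<and> H \<subseteq> verts G \<and>
     (\<forall>u\<in>verts G. int (card (H \<inter> neighbours G u)) \<ge> \<tau> u \<longrightarrow> u \<in> H)}"

definition partial_incentive :: "'a graph \<Rightarrow> ('a \<Rightarrow> int) \<Rightarrow> ('a \<Rightarrow> nat) \<Rightarrow> bool" where
  "partial_incentive G \<tau> \<sigma> \<longleftrightarrow> threshold_hull G (\<lambda>v. \<tau> v - int (\<sigma> v)) {} = verts G"

definition weight :: "'a graph \<Rightarrow> ('a \<Rightarrow> nat) \<Rightarrow> nat" where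
  "weight G \<sigma> = (\<Sum>v\<in>verts G. \<sigma> v)"

definition optimal_partial_incentive ::
    "'a graph \<Rightarrow> ('a \<Rightarrow> int) \<Rightarrow> ('a \<Rightarrow> nat) \<Rightarrow> bool" where
  "optimal_partial_incentive G \<tau> \<sigma> \<longleftrightarrow> partial_incentive G \<tau> \<sigma> \<and>
     (\<forall>\<sigma>'. partial_incentive G \<tau> \<sigma>' \<longrightarrow> weight G \<sigma> \<le> weight G \<sigma>')"

text \<open>The model of computation is a unit-cost random access machine over the integers, with
  structured control flow. A state consists of named registers (a program mentions only finitely
  many) and an indirectly addressable memory. Addition and subtraction are the only
  arithmetic operations: with a unit-cost multiplication, time would not be polynomially related
  to Turing machine time. Thresholds are unbounded, so a time bound in terms of the order of the
  graph alone presupposes such a unit-cost measure.\<close>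

type_synonym state = "(string \<Rightarrow> int) \<times> (int \<Rightarrow> int)"

datatype aexp =
    Const int
  | Reg string
  | Load aexp
  | Add aexp aexp
  | Sub aexp aexp

datatype bexp =
    Less aexp aexp
  | Equal aexp aexp
  | Neg bexp
  | Conj bexp bexp

datatype com =
    Skip
  | Assign string aexp
  | Store aexp aexp
  | Seq com com
  | If bexp com com
  | While bexp com

fun aval :: "aexp \<Rightarrow> state \<Rightarrow> int" where
  "aval (Const i) s = i"
| "aval (Reg x) s = fst s x"
| "aval (Load a) s = snd s (aval a s)"
| "aval (Add a b) s = aval a s + aval b s"
| "aval (Sub a b) s = aval a s - aval b s"

fun bval :: "bexp \<Rightarrow> state \<Rightarrow> bool" where
  "bval (Less a b) s \<longleftrightarrow> aval a s < aval b s"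
| "bval (Equal a b) s \<longleftrightarrow> aval a s = aval b s"
| "bval (Neg b) s \<longleftrightarrow> \<not> bval b s"
| "bval (Conj b c) s \<longleftrightarrow> bval b s \<and> bval c s"

fun acost :: "aexp \<Rightarrow> nat" where
  "acost (Const i) = 1"
| "acost (Reg x) = 1"
| "acost (Load a) = acost a + 1"
| "acost (Add a b) = acost a + acost b + 1"
| "acost (Sub a b) = acost a + acost b + 1"

fun bcost :: "bexp \<Rightarrow> nat" where
  "bcost (Less a b) = acost a + acost b + 1"
| "bcost (Equal a b) = acost a + acost b + 1"
| "bcost (Neg b) = bcost b + 1"
| "bcost (Conj b c) = bcost b + bcost c + 1"

text \<open>\<open>exec c s t s'\<close>: started in \<open>s\<close>, the program \<open>c\<close> halts in \<open>s'\<close> after \<open>t\<close> time units.\<close>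

inductive exec :: "com \<Rightarrow> state \<Rightarrow> nat \<Rightarrow> state \<Rightarrow> bool" where
  exec_Skip: "exec Skip s 1 s"
| exec_Assign: "exec (Assign x a) s (acost a + 1) ((fst s)(x := aval a s), snd s)"
| exec_Store: "exec (Store a b) s (acost a + acost b + 1)
     (fst s, (snd s)(aval a s := aval b s))"
| exec_Seq: "exec c s t s' \<Longrightarrow> exec d s' u s'' \<Longrightarrow> exec (Seq c d) s (t + u + 1) s''"
| exec_IfT: "bval b s \<Longrightarrow> exec c s t s' \<Longrightarrow> exec (If b c d) s (bcost b + t + 1) s'"
| exec_IfF: "\<not> bval b s \<Longrightarrow> exec d s t s' \<Longrightarrow> exec (If b c d) s (bcost b + t + 1) s'"
| exec_WhileF: "\<not> bval b s \<Longrightarrow> exec (While b c) s (bcost b + 1) s"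
| exec_WhileT: "bval b s \<Longrightarrow> exec c s t s' \<Longrightarrow> exec (While b c) s' u s'' \<Longrightarrow>
     exec (While b c) s (bcost b + t + u + 1) s''"

inductive_cases exec_SkipE: "exec Skip s t s'"
inductive_cases exec_AssignE: "exec (Assign x a) s t s'"
inductive_cases exec_StoreE: "exec (Store a b) s t s'"
inductive_cases exec_SeqE: "exec (Seq c d) s t s'"
inductive_cases exec_IfE: "exec (If b c d) s t s'"
inductive_cases exec_WhileE: "exec (While b c) s t s'"

lemma exec_deterministic:
  "exec c s t s' \<Longrightarrow> exec c s u s'' \<Longrightarrow> u = t \<and> s'' = s'"
proof (induction arbitrary: u s'' rule: exec.induct)
  case (exec_Skip s)
  then show ?case by (rule exec_SkipE) simp
next
  case (exec_Assign x a s)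
  then show ?case by (rule exec_AssignE) simp
next
  case (exec_Store a b s)
  then show ?case by (rule exec_StoreE) simp
next
  case (exec_Seq c s t s' d t' s2)
  from exec_Seq.prems show ?case
    by (rule exec_SeqE) (use exec_Seq.IH in fastforce)
next
  case (exec_IfT b s c t s' d)
  from exec_IfT.prems show ?case
    by (rule exec_IfE) (use exec_IfT.hyps exec_IfT.IH in fastforce)+
next
  case (exec_IfF b s d t s' c)
  from exec_IfF.prems show ?case
    by (rule exec_IfE) (use exec_IfF.hyps exec_IfF.IH in fastforce)+
next
  case (exec_WhileF b s c)
  from exec_WhileF.prems show ?case
    by (rule exec_WhileE) (use exec_WhileF.hyps in simp_all)
next
  case (exec_WhileT b s c t s' t' s2)
  from exec_WhileT.prems show ?case
    by (rule exec_WhileE) (use exec_WhileT.hyps exec_WhileT.IH in fastforce)+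
qed

text \<open>The input is a graph with vertices 0, ..., n - 1: cell 0 holds n, the next n cells hold
  the thresholds, and the next n * n cells hold the adjacency matrix row by row.
  All other cells and all registers are 0. The output is read from the cells that
  held the thresholds.\<close>

definition input_memory :: "nat \<Rightarrow> nat graph \<Rightarrow> (nat \<Rightarrow> int) \<Rightarrow> nat \<Rightarrow> int" where
  "input_memory n G \<tau> a =
     (if a = 0 then int n
      else if a \<le> n then \<tau> (a - 1)
      else if a \<le> n + n * n then
        of_bool ({(a - n - 1) div n, (a - n - 1) mod n} \<in> edges G)
      else 0)"

definition input_state :: "nat \<Rightarrow> nat graph \<Rightarrow> (nat \<Rightarrow> int) \<Rightarrow> state" where
  "input_state n G \<tau> =
     (\<lambda>x. 0, \<lambda>a. if 0 \<le> a then input_memory n G \<tau> (nat a) else 0)"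

definition output_is :: "nat \<Rightarrow> state \<Rightarrow> (nat \<Rightarrow> nat) \<Rightarrow> bool" where
  "output_is n s \<sigma> \<longleftrightarrow> (\<forall>v<n. snd s (int v + 1) = int (\<sigma> v))"

end

theory Submission
  imports Defs
begin

text \<open>A partial incentive of weight at most \<open>k\<close> exists iff the vertices can be labelled by numbers
  \<open>p v \<in> {0..n}\<close> such that the sum of \<open>max 0 (\<tau> v - |{u \<in> N(v). p u < p v}|)\<close> is at most \<open>k\<close>: the
  labels are activation times, and since ties do not count, every labelling is admissible. Such a
  local optimisation problem is solved by dynamic programming. No tree decomposition is computed:
  if the treewidth is at most \<open>w\<close>, then the cops have a monotone strategy on bags of size at most
  \<open>w + 1\<close>, that is, every connected set \<open>C\<close> that arises has a vertex \<open>z\<close> whose addition to the boundary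
  of \<open>C\<close> leaves components of \<open>C - {z}\<close> whose boundaries lie in bags. So it is enough to consider all
  tuples of at most \<open>w + 2\<close> vertices together with their labels, the numbers of their earlier
  neighbours in the part of the graph that is already labelled, and an index up to which the
  components next to the last vertex \<open>z\<close> have been treated. These are \<open>n\<^sup>O\<^sup>(\<^sup>w\<^sup>)\<close> states, numbered by their
  digits in base \<open>n + 1\<close>, and the table is relaxed along all triples of states until it is stable.

  The program is uniform in \<open>w\<close> up to one constant, so that its running time is a fixed polynomial
  in the number of states.\<close>

section \<open>Polynomial time computability on the machine\<close>

text \<open>The two halves of the correctness proof rest on different hypotheses. Soundness holds
  for every graph and every \<open>K\<close>: a filled row stands for a labelling of its area that
  completes any labelling of the rest, whichever bags produced it. The treewidth enters only in the
  other half, where a competing labelling is dismantled along the strategy and every piece turns out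
  to be one of the states.

  Graph search is avoided as well. A filled row is positive exactly on the area of its state, so
  membership in a component is read off the table. This is why rows store the incentives vertex by
  vertex, shifted by 1, and not just their total; the root row then is the output.

  The machine has neither multiplication nor division; both become loops up to the number of states.
  Every loop is bounded by one of four cells, so the time is a polynomial in their contents whose
  degree does not depend on \<open>w\<close>. As \<open>(n + 1) ^ (3 * K + 2)\<close> dominates
  these contents up to a constant factor, the final exponent is linear in \<open>w\<close>.\<close>

definition poly_bounded :: "(nat \<Rightarrow> nat) \<Rightarrow> bool" where
  "poly_bounded T \<longleftrightarrow> (\<exists>C D. \<forall>M. T M \<le> C * (M + 1) ^ D)"

lemma poly_bounded_const: "poly_bounded (\<lambda>M. c)"
  unfolding poly_bounded_def by (rule exI[of _ c], rule exI[of _ 0]) simp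

lemma poly_bounded_id: "poly_bounded (\<lambda>M. M)"
  unfolding poly_bounded_def by (rule exI[of _ 1], rule exI[of _ 1]) simp

lemma poly_bounded_add:
  assumes "poly_bounded S" "poly_bounded T"
  shows "poly_bounded (\<lambda>M. S M + T M)"
proof -
  obtain A B C D where S: "\<And>M. S M \<le> A * (M + 1) ^ B" and T: "\<And>M. T M \<le> C * (M + 1) ^ D"
    using assms unfolding poly_bounded_def by blast
  have "S M + T M \<le> (A + C) * (M + 1) ^ (B + D)" for M
  proof -
    have "A * (M + 1) ^ B \<le> A * (M + 1) ^ (B + D)" "C * (M + 1) ^ D \<le> C * (M + 1) ^ (B + D)"
      by (auto intro!: mult_left_mono power_increasing)
    with S[of M] T[of M] show ?thesis unfolding distrib_right by linarith
  qed
  then show ?thesis unfolding poly_bounded_def by blast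
qed

lemma poly_bounded_mult:
  assumes "poly_bounded S" "poly_bounded T"
  shows "poly_bounded (\<lambda>M. S M * T M)"
proof -
  obtain A B C D where S: "\<And>M. S M \<le> A * (M + 1) ^ B" and T: "\<And>M. T M \<le> C * (M + 1) ^ D"
    using assms unfolding poly_bounded_def by blast
  have "S M * T M \<le> (A * C) * (M + 1) ^ (B + D)" for M
  proof -
    have "S M * T M \<le> (A * (M + 1) ^ B) * (C * (M + 1) ^ D)"
      using S T by (rule mult_le_mono)
    then show ?thesis by (simp add: power_add mult_ac)
  qed
  then show ?thesis unfolding poly_bounded_def by blast
qed

lemmas poly_bounded_intros =
  poly_bounded_const poly_bounded_id poly_bounded_add poly_bounded_mult

section \<open>Commands with an upper bound on their time\<close>

definition runs :: "com \<Rightarrow> state \<Rightarrow> nat \<Rightarrow> state \<Rightarrow> bool" where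
  "runs c s T s' \<longleftrightarrow> (\<exists>t\<le>T. exec c s t s')"

lemma runs_Seq: "runs c s T s' \<Longrightarrow> runs d s' U s'' \<Longrightarrow> runs (Seq c d) s (T + U + 1) s''"
  unfolding runs_def by (meson add_le_mono exec_Seq order_refl)

lemma runs_Assign: "runs (Assign x a) s (acost a + 1) ((fst s)(x := aval a s), snd s)"
  unfolding runs_def using exec_Assign by blast

lemma runs_Store: "runs (Store a b) s (acost a + acost b + 1) (fst s, (snd s)(aval a s := aval b s))"
  unfolding runs_def using exec_Store by blast

lemma runs_If:
  assumes "if bval b s then runs c s T s' else runs d s T s'"
  shows "runs (If b c d) s (bcost b + T + 1) s'"
proof -
  obtain t where "t \<le> T" "if bval b s then exec c s t s' else exec d s t s'"
    using assms unfolding runs_def by (auto split: if_splits)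
  then have "exec (If b c d) s (bcost b + t + 1) s'"
    by (cases "bval b s") (simp_all only: if_True if_False exec_IfT exec_IfF simp_thms)
  then show ?thesis using \<open>t \<le> T\<close> unfolding runs_def by (intro exI[of _ "bcost b + t + 1"]) simp
qed

lemma runs_mono: "runs c s T s' \<Longrightarrow> T \<le> U \<Longrightarrow> runs c s U s'"
  unfolding runs_def by (meson order_trans)

text \<open>The iteration number is an index of the invariant. Since the guard must hold exactly for
  the indices below \<open>h\<close>, termination and the time bound come together.\<close>

lemma runs_While_count:
  assumes step: "\<And>i s. i < h \<Longrightarrow> I i s \<Longrightarrow> \<exists>s'. runs c s T s' \<and> I (Suc i) s'"
    and guard: "\<And>i s. i \<le> h \<Longrightarrow> I i s \<Longrightarrow> bval b s \<longleftrightarrow> i < h"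
    and init: "I 0 s"
  shows "\<exists>s'. runs (While b c) s (h * (T + bcost b + 1) + bcost b + 1) s' \<and> I h s'"
proof -
  have "\<exists>s'. runs (While b c) s (k * (T + bcost b + 1) + bcost b + 1) s' \<and> I h s'"
    if "I i s" "i + k = h" for i k s
    using that
  proof (induction k arbitrary: i s)
    case 0
    then have "\<not> bval b s" using guard[of i s] by simp
    then have "runs (While b c) s (bcost b + 1) s"
      using exec_WhileF[of b s c] unfolding runs_def by blast
    then show ?case using 0 by (intro exI[of _ s]) simp
  next
    case (Suc k)
    then have b: "bval b s" and "i < h" using guard[of i s] by auto
    obtain s' where s': "runs c s T s'" "I (Suc i) s'" using step[OF \<open>i < h\<close> Suc.prems(1)] by blast
    obtain s'' where s'': "runs (While b c) s' (k * (T + bcost b + 1) + bcost b + 1) s''" "I h s''"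
      using Suc.IH[OF s'(2)] Suc.prems(2) by auto
    obtain t u where "t \<le> T" "exec c s t s'" "u \<le> k * (T + bcost b + 1) + bcost b + 1"
      "exec (While b c) s' u s''"
      using s'(1) s''(1) unfolding runs_def by blast
    then have "exec (While b c) s (bcost b + t + u + 1) s''"
      "bcost b + t + u + 1 \<le> Suc k * (T + bcost b + 1) + bcost b + 1"
      using exec_WhileT[OF b] by auto
    then show ?case using s''(2) unfolding runs_def by blast
  qed
  from this[of 0 s h] init show ?thesis by simp
qed

text \<open>Strings of different lengths are different, so register names can be handled like
  numbers.\<close>

definition reg :: "nat \<Rightarrow> string" where
  "reg i = replicate i (CHR ''r'')"

lemma reg_inject [simp]: "reg i = reg j \<longleftrightarrow> i = j"
  unfolding reg_def by (metis length_replicate)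

text \<open>Loops may only be bounded by these cells; the time is measured in terms of their contents.\<close>

abbreviation bound_cells :: "int set" where "bound_cells \<equiv> {-1, -2, -3, -4}"

definition bounded :: "nat \<Rightarrow> (int \<Rightarrow> int) \<Rightarrow> bool" where
  "bounded M m \<longleftrightarrow> (\<forall>a\<in>bound_cells. m a \<le> int M)"

text \<open>A function of an environment and the memory is computable in polynomial time if there are
  programs for it that find variable \<open>i\<close> in register \<open>loc i\<close>, use registers from \<open>k\<close> on as
  scratch space and leave the result in register \<open>k\<close>.\<close>

definition computes ::
    "com \<Rightarrow> nat \<Rightarrow> (nat \<Rightarrow> nat) \<Rightarrow> (nat \<Rightarrow> nat) \<Rightarrow> ((nat \<Rightarrow> int) \<Rightarrow> (int \<Rightarrow> int) \<Rightarrow> int) \<Rightarrow> bool" where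
  "computes c k loc T f \<longleftrightarrow> (\<forall>r m M. bounded M m \<longrightarrow>
     (\<exists>r'. runs c (r, m) (T M) (r', m) \<and> (\<forall>i<k. r' (reg i) = r (reg i)) \<and>
        r' (reg k) = f (\<lambda>i. r (reg (loc i))) m))"

text \<open>The time bound is chosen before \<open>k\<close> and \<open>loc\<close>: a larger
  construct can place a subprogram in any registers without changing its bound.\<close>

definition computable :: "((nat \<Rightarrow> int) \<Rightarrow> (int \<Rightarrow> int) \<Rightarrow> int) \<Rightarrow> bool" where
  "computable f \<longleftrightarrow> (\<exists>T. poly_bounded T \<and> (\<forall>k loc. (\<forall>i. loc i < k) \<longrightarrow> (\<exists>c. computes c k loc T f)))"

definition decidable :: "((nat \<Rightarrow> int) \<Rightarrow> (int \<Rightarrow> int) \<Rightarrow> bool) \<Rightarrow> bool" where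
  "decidable P \<longleftrightarrow> computable (\<lambda>\<rho> m. of_bool (P \<rho> m))"

lemma computableE:
  assumes "computable f"
  obtains T where "poly_bounded T" "\<And>k loc. (\<And>i. loc i < k) \<Longrightarrow> \<exists>c. computes c k loc T f"
  using assms unfolding computable_def by blast

lemma computesD:
  assumes "computes c k loc T f" "bounded M m"
  obtains r' where "runs c (r, m) (T M) (r', m)" "\<And>i. i < k \<Longrightarrow> r' (reg i) = r (reg i)"
    "r' (reg k) = f (\<lambda>i. r (reg (loc i))) m"
  using assms unfolding computes_def by blast

lemma computableI:
  assumes "poly_bounded T" "\<And>k loc. (\<And>i. loc i < k) \<Longrightarrow> \<exists>c. computes c k loc T f"
  shows "computable f"
  using assms unfolding computable_def by blast

lemma computable_const: "computable (\<lambda>\<rho> m. i)"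
proof (rule computableI[OF poly_bounded_const[of 2]])
  fix k and loc :: "nat \<Rightarrow> nat"
  have "runs (Assign (reg k) (Const i)) (r, m) 2 (r(reg k := i), m)" for r m
    using runs_Assign[of "reg k" "Const i" "(r, m)"] by (simp add: numeral_2_eq_2)
  then have "computes (Assign (reg k) (Const i)) k loc (\<lambda>M. 2) (\<lambda>\<rho> m. i)"
    unfolding computes_def by (metis fun_upd_apply less_irrefl reg_inject)
  then show "\<exists>c. computes c k loc (\<lambda>M. 2) (\<lambda>\<rho> m. i)" by blast
qed

lemma computable_var: "computable (\<lambda>\<rho> m. \<rho> i)"
proof (rule computableI[OF poly_bounded_const[of 2]])
  fix k and loc :: "nat \<Rightarrow> nat"
  have "runs (Assign (reg k) (Reg (reg (loc i)))) (r, m) 2 (r(reg k := r (reg (loc i))), m)" for r m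
    using runs_Assign[of "reg k" "Reg (reg (loc i))" "(r, m)"] by (simp add: numeral_2_eq_2)
  then have "computes (Assign (reg k) (Reg (reg (loc i)))) k loc (\<lambda>M. 2) (\<lambda>\<rho> m. \<rho> i)"
    unfolding computes_def by (metis fun_upd_apply less_irrefl reg_inject)
  then show "\<exists>c. computes c k loc (\<lambda>M. 2) (\<lambda>\<rho> m. \<rho> i)" by blast
qed

lemma computable_unop:
  assumes f: "computable f"
    and e: "\<And>k. \<exists>c. \<forall>r m. runs c (r, m) C (r(reg k := h (r (reg k)) m), m)"
  shows "computable (\<lambda>\<rho> m. h (f \<rho> m) m)"
proof -
  obtain T where T: "poly_bounded T" "\<And>k loc. (\<And>i. loc i < k) \<Longrightarrow> \<exists>c. computes c k loc T f"
    using computableE[OF f] by blast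
  show ?thesis
  proof (rule computableI)
    show "poly_bounded (\<lambda>M. T M + C + 1)" by (intro poly_bounded_intros T)
  next
    fix k and loc :: "nat \<Rightarrow> nat" assume "\<And>i. loc i < k"
    then obtain c where c: "computes c k loc T f" using T(2)[of loc k] by blast
    obtain d where d: "\<And>r m. runs d (r, m) C (r(reg k := h (r (reg k)) m), m)"
      using e by blast
    have "computes (Seq c d) k loc (\<lambda>M. T M + C + 1) (\<lambda>\<rho> m. h (f \<rho> m) m)"
      unfolding computes_def
    proof (intro allI impI)
      fix r m M assume "bounded M m"
      from computesD[OF c this, of r] obtain r1 where r1: "runs c (r, m) (T M) (r1, m)"
        "\<And>i. i < k \<Longrightarrow> r1 (reg i) = r (reg i)" "r1 (reg k) = f (\<lambda>i. r (reg (loc i))) m" by metis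
      show "\<exists>r'. runs (Seq c d) (r, m) (T M + C + 1) (r', m) \<and>
          (\<forall>i<k. r' (reg i) = r (reg i)) \<and> r' (reg k) = h (f (\<lambda>i. r (reg (loc i))) m) m"
        using r1 runs_Seq[OF r1(1) d[of r1 m]]
        by (intro exI[of _ "r1(reg k := h (r1 (reg k)) m)"]) auto
    qed
    then show "\<exists>c. computes c k loc (\<lambda>M. T M + C + 1) (\<lambda>\<rho> m. h (f \<rho> m) m)" by blast
  qed
qed

lemma computable_load: "computable f \<Longrightarrow> computable (\<lambda>\<rho> m. m (f \<rho> m))"
proof (erule computable_unop[where h = "\<lambda>i m. m i" and C = 3])
  fix k
  have "runs (Assign (reg k) (Load (Reg (reg k)))) (r, m) 3 (r(reg k := m (r (reg k))), m)" for r m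
    using runs_Assign[of "reg k" "Load (Reg (reg k))" "(r, m)"] by (simp add: eval_nat_numeral)
  then show "\<exists>c. \<forall>r m. runs c (r, m) 3 (r(reg k := m (r (reg k))), m)" by blast
qed

lemma computable_binop:
  assumes f: "computable f" and g: "computable g"
    and op: "\<And>k. \<exists>c. \<forall>r m. runs c (r, m) C (r(reg k := h (r (reg k)) (r (reg (Suc k)))), m)"
  shows "computable (\<lambda>\<rho> m. h (f \<rho> m) (g \<rho> m))"
proof -
  obtain S where S: "poly_bounded S" "\<And>k loc. (\<And>i. loc i < k) \<Longrightarrow> \<exists>c. computes c k loc S f"
    using computableE[OF f] by blast
  obtain T where T: "poly_bounded T" "\<And>k loc. (\<And>i. loc i < k) \<Longrightarrow> \<exists>c. computes c k loc T g"
    using computableE[OF g] by blast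
  show ?thesis
  proof (rule computableI)
    show "poly_bounded (\<lambda>M. S M + (T M + C + 1) + 1)" by (intro poly_bounded_intros S T)
  next
    fix k and loc :: "nat \<Rightarrow> nat" assume loc: "\<And>i. loc i < k"
    then have loc': "\<And>i. loc i < Suc k" using less_Suc_eq by blast
    obtain c where c: "computes c k loc S f" using S(2)[of "loc" "k", OF loc] by blast
    obtain d where d: "computes d (Suc k) loc T g" using T(2)[of "loc" "Suc k", OF loc'] by blast
    obtain c' where c': "\<And>r m. runs c' (r, m) C (r(reg k := h (r (reg k)) (r (reg (Suc k)))), m)"
      using op by blast
    have "computes (Seq c (Seq d c')) k loc (\<lambda>M. S M + (T M + C + 1) + 1) (\<lambda>\<rho> m. h (f \<rho> m) (g \<rho> m))"
      unfolding computes_def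
    proof (intro allI impI)
      fix r m M assume M: "bounded M m"
      from computesD[OF c M, of r] obtain r1 where r1: "runs c (r, m) (S M) (r1, m)"
        "\<And>i. i < k \<Longrightarrow> r1 (reg i) = r (reg i)" "r1 (reg k) = f (\<lambda>i. r (reg (loc i))) m" by metis
      from computesD[OF d M, of r1] obtain r2 where r2: "runs d (r1, m) (T M) (r2, m)"
        "\<And>i. i < Suc k \<Longrightarrow> r2 (reg i) = r1 (reg i)" "r2 (reg (Suc k)) = g (\<lambda>i. r1 (reg (loc i))) m"
        by metis
      show "\<exists>r'. runs (Seq c (Seq d c')) (r, m) (S M + (T M + C + 1) + 1) (r', m) \<and>
          (\<forall>i<k. r' (reg i) = r (reg i)) \<and>
          r' (reg k) = h (f (\<lambda>i. r (reg (loc i))) m) (g (\<lambda>i. r (reg (loc i))) m)"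
        using runs_Seq[OF r1(1) runs_Seq[OF r2(1) c']] r1(2,3) r2(2,3) loc
        by (intro exI[of _ "r2(reg k := h (r2 (reg k)) (r2 (reg (Suc k))))"]) simp
    qed
    then show "\<exists>c. computes c k loc (\<lambda>M. S M + (T M + C + 1) + 1) (\<lambda>\<rho> m. h (f \<rho> m) (g \<rho> m))"
      by blast
  qed
qed

lemma computable_add: "computable f \<Longrightarrow> computable g \<Longrightarrow> computable (\<lambda>\<rho> m. f \<rho> m + g \<rho> m)"
proof (erule (1) computable_binop[where C = 4])
  fix k
  have "runs (Assign (reg k) (Add (Reg (reg k)) (Reg (reg (Suc k))))) (r, m) 4 (r(reg k := r (reg k) + r (reg (Suc k))), m)" for r m
    using runs_Assign[of "reg k" "Add (Reg (reg k)) (Reg (reg (Suc k)))" "(r, m)"] by (simp add: eval_nat_numeral)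
  then show "\<exists>c. \<forall>r m. runs c (r, m) 4 (r(reg k := r (reg k) + r (reg (Suc k))), m)" by blast
qed

lemma computable_diff: "computable f \<Longrightarrow> computable g \<Longrightarrow> computable (\<lambda>\<rho> m. f \<rho> m - g \<rho> m)"
proof (erule (1) computable_binop[where C = 4])
  fix k
  have "runs (Assign (reg k) (Sub (Reg (reg k)) (Reg (reg (Suc k))))) (r, m) 4 (r(reg k := r (reg k) - r (reg (Suc k))), m)" for r m
    using runs_Assign[of "reg k" "Sub (Reg (reg k)) (Reg (reg (Suc k)))" "(r, m)"] by (simp add: eval_nat_numeral)
  then show "\<exists>c. \<forall>r m. runs c (r, m) 4 (r(reg k := r (reg k) - r (reg (Suc k))), m)" by blast
qed

text \<open>Programs reach their variables only through \<open>loc\<close>, so renaming amounts to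
  composing \<open>loc\<close> with \<pi>.\<close>

lemma computable_rename: "computable f \<Longrightarrow> computable (\<lambda>\<rho> m. f (\<lambda>i. \<rho> (\<pi> i)) m)"
proof (erule computableE, erule computableI)
  fix T k and loc :: "nat \<Rightarrow> nat"
  assume T: "\<And>k loc. (\<And>i. loc i < k) \<Longrightarrow> \<exists>c. computes c k loc T f" and loc: "\<And>i. loc i < k"
  have "\<exists>c. computes c k (\<lambda>i. loc (\<pi> i)) T f" by (rule T, rule loc)
  then show "\<exists>c. computes c k loc T (\<lambda>\<rho> m. f (\<lambda>i. \<rho> (\<pi> i)) m)"
    unfolding computes_def by simp
qed

text \<open>Environments are de Bruijn stacks: the value just computed becomes variable 0 and all
  others move up by one. It stays in register \<open>k\<close> while the body works from
  \<open>Suc k\<close> on.\<close>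

lemma computable_let:
  assumes g: "computable g" and f: "computable f"
  shows "computable (\<lambda>\<rho> m. g (case_nat (f \<rho> m) \<rho>) m)"
proof -
  obtain S where S: "poly_bounded S" "\<And>k loc. (\<And>i. loc i < k) \<Longrightarrow> \<exists>c. computes c k loc S f"
    using computableE[OF f] by blast
  obtain T where T: "poly_bounded T" "\<And>k loc. (\<And>i. loc i < k) \<Longrightarrow> \<exists>c. computes c k loc T g"
    using computableE[OF g] by blast
  show ?thesis
  proof (rule computableI)
    show "poly_bounded (\<lambda>M. S M + (T M + 2 + 1) + 1)" by (intro poly_bounded_intros S T)
  next
    fix k and loc :: "nat \<Rightarrow> nat" assume loc: "\<And>i. loc i < k"
    have loc': "case_nat k loc i < Suc k" for i
      using loc less_Suc_eq by (simp split: nat.split)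
    obtain c where c: "computes c k loc S f" using S(2)[of "loc" "k", OF loc] by blast
    obtain d where d: "computes d (Suc k) (case_nat k loc) T g" using T(2)[of "case_nat k loc" "Suc k", OF loc'] by blast
    let ?a = "Assign (reg k) (Reg (reg (Suc k)))"
    have "computes (Seq c (Seq d ?a)) k loc (\<lambda>M. S M + (T M + 2 + 1) + 1)
        (\<lambda>\<rho> m. g (case_nat (f \<rho> m) \<rho>) m)"
      unfolding computes_def
    proof (intro allI impI)
      fix r m M assume M: "bounded M m"
      from computesD[OF c M, of r] obtain r1 where r1: "runs c (r, m) (S M) (r1, m)"
        "\<And>i. i < k \<Longrightarrow> r1 (reg i) = r (reg i)" "r1 (reg k) = f (\<lambda>i. r (reg (loc i))) m" by metis
      from computesD[OF d M, of r1] obtain r2 where r2: "runs d (r1, m) (T M) (r2, m)"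
        "\<And>i. i < Suc k \<Longrightarrow> r2 (reg i) = r1 (reg i)"
        "r2 (reg (Suc k)) = g (\<lambda>i. r1 (reg (case_nat k loc i))) m"
        by metis
      have "runs ?a (r2, m) 2 (r2(reg k := r2 (reg (Suc k))), m)"
        using runs_Assign[of "reg k" "Reg (reg (Suc k))" "(r2, m)"] by (simp add: numeral_2_eq_2)
      note run = runs_Seq[OF r1(1) runs_Seq[OF r2(1) this]]
      have "(\<lambda>i. r1 (reg (case_nat k loc i))) = case_nat (r1 (reg k)) (\<lambda>i. r (reg (loc i)))"
        using r1(2) loc by (auto split: nat.split)
      then show "\<exists>r'. runs (Seq c (Seq d ?a)) (r, m) (S M + (T M + 2 + 1) + 1) (r', m) \<and>
          (\<forall>i<k. r' (reg i) = r (reg i)) \<and>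
          r' (reg k) = g (case_nat (f (\<lambda>i. r (reg (loc i))) m) (\<lambda>i. r (reg (loc i)))) m"
        using run r1(2,3) r2(2,3) by (intro exI[of _ "r2(reg k := r2 (reg (Suc k)))"]) simp
    qed
    then show "\<exists>c. computes c k loc (\<lambda>M. S M + (T M + 2 + 1) + 1)
        (\<lambda>\<rho> m. g (case_nat (f \<rho> m) \<rho>) m)" by blast
  qed
qed

lemma computable_app2:
  assumes F: "computable (\<lambda>\<rho> m. F (\<rho> 0) (\<rho> 1) m)" and f: "computable f" and g: "computable g"
  shows "computable (\<lambda>\<rho> m. F (f \<rho> m) (g \<rho> m) m)"
proof -
  \<comment> \<open>\<open>1 - i\<close> swaps the variables 0 and 1. The swap is needed because the
    second argument is bound last and therefore becomes variable 0.\<close>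
  have "computable (\<lambda>\<rho> m. F (\<rho> 1) (\<rho> 0) m)"
    using computable_rename[OF F, of "\<lambda>i. 1 - i"] by simp
  from computable_let[OF this computable_rename[OF g, of Suc]]
  have "computable (\<lambda>\<rho> m. F (\<rho> 0) (g (\<lambda>i. \<rho> (Suc i)) m) m)" by simp
  from computable_let[OF this f] show ?thesis by simp
qed

lemma decidable_If:
  assumes P: "decidable P" and f: "computable f" and g: "computable g"
  shows "computable (\<lambda>\<rho> m. if P \<rho> m then f \<rho> m else g \<rho> m)"
proof -
  obtain S where S: "poly_bounded S"
    "\<And>k loc. (\<And>i. loc i < k) \<Longrightarrow> \<exists>c. computes c k loc S (\<lambda>\<rho> m. of_bool (P \<rho> m))"
    using computableE[OF P[unfolded decidable_def]] by blast
  obtain T where T: "poly_bounded T" "\<And>k loc. (\<And>i. loc i < k) \<Longrightarrow> \<exists>c. computes c k loc T f"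
    using computableE[OF f] by blast
  obtain U where U: "poly_bounded U" "\<And>k loc. (\<And>i. loc i < k) \<Longrightarrow> \<exists>c. computes c k loc U g"
    using computableE[OF g] by blast
  show ?thesis
  proof (rule computableI)
    show "poly_bounded (\<lambda>M. S M + (3 + (T M + U M) + 1) + 1)" by (intro poly_bounded_intros S T U)
  next
    fix k and loc :: "nat \<Rightarrow> nat" assume loc: "\<And>i. loc i < k"
    obtain b where b: "computes b k loc S (\<lambda>\<rho> m. of_bool (P \<rho> m))" using S(2)[of "loc" "k", OF loc] by blast
    obtain c where c: "computes c k loc T f" using T(2)[of "loc" "k", OF loc] by blast
    obtain d where d: "computes d k loc U g" using U(2)[of "loc" "k", OF loc] by blast
    have "computes (Seq b (If (Equal (Reg (reg k)) (Const 1)) c d)) k loc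
        (\<lambda>M. S M + (3 + (T M + U M) + 1) + 1) (\<lambda>\<rho> m. if P \<rho> m then f \<rho> m else g \<rho> m)"
      unfolding computes_def
    proof (intro allI impI)
      fix r m M assume M: "bounded M m"
      from computesD[OF b M, of r] obtain r1 where r1: "runs b (r, m) (S M) (r1, m)"
        "\<And>i. i < k \<Longrightarrow> r1 (reg i) = r (reg i)"
        "r1 (reg k) = of_bool (P (\<lambda>i. r (reg (loc i))) m)" by metis
      have eq: "(\<lambda>i. r1 (reg (loc i))) = (\<lambda>i. r (reg (loc i)))" using r1(2) loc by auto
      let ?h = "if P (\<lambda>i. r (reg (loc i))) m then f else g"
      let ?b = "Equal (Reg (reg k)) (Const 1)"
      obtain r2 where r2: "if bval ?b (r1, m) then runs c (r1, m) (T M + U M) (r2, m)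
           else runs d (r1, m) (T M + U M) (r2, m)"
        "\<And>i. i < k \<Longrightarrow> r2 (reg i) = r1 (reg i)" "r2 (reg k) = ?h (\<lambda>i. r1 (reg (loc i))) m"
      proof (cases "P (\<lambda>i. r (reg (loc i))) m")
        case True
        from computesD[OF c M, of r1] obtain r2 where "runs c (r1, m) (T M) (r2, m)"
          "\<And>i. i < k \<Longrightarrow> r2 (reg i) = r1 (reg i)" "r2 (reg k) = f (\<lambda>i. r1 (reg (loc i))) m" by metis
        then show ?thesis using True that[of r2] r1(3) runs_mono[of c "(r1, m)" "T M" "(r2, m)"] by simp
      next
        case False
        from computesD[OF d M, of r1] obtain r2 where "runs d (r1, m) (U M) (r2, m)"
          "\<And>i. i < k \<Longrightarrow> r2 (reg i) = r1 (reg i)" "r2 (reg k) = g (\<lambda>i. r1 (reg (loc i))) m" by metis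
        then show ?thesis using False that[of r2] r1(3) runs_mono[of d "(r1, m)" "U M" "(r2, m)"] by simp
      qed
      have "runs (Seq b (If ?b c d)) (r, m) (S M + (3 + (T M + U M) + 1) + 1) (r2, m)"
        using runs_Seq[OF r1(1) runs_If[OF r2(1)]] by (simp add: eval_nat_numeral)
      then show "\<exists>r'. runs (Seq b (If ?b c d)) (r, m) (S M + (3 + (T M + U M) + 1) + 1) (r', m) \<and>
          (\<forall>i<k. r' (reg i) = r (reg i)) \<and> r' (reg k) =
          (if P (\<lambda>i. r (reg (loc i))) m then f (\<lambda>i. r (reg (loc i))) m else g (\<lambda>i. r (reg (loc i))) m)"
        using r1(2) r2(2,3) eq by (intro exI[of _ r2]) auto
    qed
    then show "\<exists>c. computes c k loc (\<lambda>M. S M + (3 + (T M + U M) + 1) + 1)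
        (\<lambda>\<rho> m. if P \<rho> m then f \<rho> m else g \<rho> m)" by blast
  qed
qed

lemma decidable_less: "computable f \<Longrightarrow> computable g \<Longrightarrow> decidable (\<lambda>\<rho> m. f \<rho> m < g \<rho> m)"
  unfolding decidable_def
proof (erule (1) computable_binop[where C = 6])
  fix k
  let ?b = "Less (Reg (reg k)) (Reg (reg (Suc k)))"
  have "runs (If ?b (Assign (reg k) (Const 1)) (Assign (reg k) (Const 0))) (r, m) (bcost ?b + 2 + 1)
      (r(reg k := of_bool (r (reg k) < r (reg (Suc k)))), m)" for r m
    using runs_Assign[of "reg k" "Const 1" "(r, m)"] runs_Assign[of "reg k" "Const 0" "(r, m)"]
    by (intro runs_If) (simp add: numeral_2_eq_2)
  moreover have "bcost ?b + 2 + 1 = 6" by simp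
  ultimately show "\<exists>c. \<forall>r m. runs c (r, m) 6 (r(reg k := of_bool (r (reg k) < r (reg (Suc k)))), m)"
    by metis
qed

lemma decidable_not: 
  assumes "decidable P"
  shows "decidable (\<lambda>\<rho> m. \<not> P \<rho> m)"
proof -
  have "computable (\<lambda>\<rho> m. if P \<rho> m then 0 else 1)"
    by (intro decidable_If assms computable_const)
  also have "(\<lambda>\<rho> m. if P \<rho> m then 0 else 1) = (\<lambda>\<rho> m. of_bool (\<not> P \<rho> m))"
    by (intro ext) simp
  finally show ?thesis unfolding decidable_def .
qed

lemma decidable_conj:
  assumes "decidable P" "decidable Q"
  shows "decidable (\<lambda>\<rho> m. P \<rho> m \<and> Q \<rho> m)"
proof -
  have "computable (\<lambda>\<rho> m. if P \<rho> m then of_bool (Q \<rho> m) else 0)"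
    using assms(2) unfolding decidable_def by (intro decidable_If assms(1) computable_const)
  also have "(\<lambda>\<rho> m. if P \<rho> m then of_bool (Q \<rho> m) else 0) = (\<lambda>\<rho> m. of_bool (P \<rho> m \<and> Q \<rho> m))"
    by (intro ext) simp
  finally show ?thesis unfolding decidable_def .
qed

lemma decidable_disj:
  assumes "decidable P" "decidable Q"
  shows "decidable (\<lambda>\<rho> m. P \<rho> m \<or> Q \<rho> m)"
proof -
  have "decidable (\<lambda>\<rho> m. \<not> (\<not> P \<rho> m \<and> \<not> Q \<rho> m))"
    by (intro decidable_not decidable_conj assms)
  also have "(\<lambda>\<rho> m. \<not> (\<not> P \<rho> m \<and> \<not> Q \<rho> m)) = (\<lambda>\<rho> m. P \<rho> m \<or> Q \<rho> m)"
    by (intro ext) blast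
  finally show ?thesis .
qed

lemma decidable_imp:
  assumes "decidable P" "decidable Q"
  shows "decidable (\<lambda>\<rho> m. P \<rho> m \<longrightarrow> Q \<rho> m)"
proof -
  have "decidable (\<lambda>\<rho> m. \<not> P \<rho> m \<or> Q \<rho> m)"
    by (intro decidable_not decidable_disj assms)
  also have "(\<lambda>\<rho> m. \<not> P \<rho> m \<or> Q \<rho> m) = (\<lambda>\<rho> m. P \<rho> m \<longrightarrow> Q \<rho> m)"
    by (intro ext) blast
  finally show ?thesis .
qed

lemma decidable_le:
  assumes "computable f" "computable g"
  shows "decidable (\<lambda>\<rho> m. f \<rho> m \<le> g \<rho> m)"
proof -
  have "decidable (\<lambda>\<rho> m. \<not> g \<rho> m < f \<rho> m)"
    by (intro decidable_not decidable_less assms)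
  also have "(\<lambda>\<rho> m. \<not> g \<rho> m < f \<rho> m) = (\<lambda>\<rho> m. f \<rho> m \<le> g \<rho> m)"
    by (intro ext) auto
  finally show ?thesis .
qed

lemma decidable_eq:
  assumes "computable f" "computable g"
  shows "decidable (\<lambda>\<rho> m. f \<rho> m = g \<rho> m)"
proof -
  have "decidable (\<lambda>\<rho> m. f \<rho> m \<le> g \<rho> m \<and> g \<rho> m \<le> f \<rho> m)"
    by (intro decidable_conj decidable_le assms)
  also have "(\<lambda>\<rho> m. f \<rho> m \<le> g \<rho> m \<and> g \<rho> m \<le> f \<rho> m) = (\<lambda>\<rho> m. f \<rho> m = g \<rho> m)"
    by (intro ext) auto
  finally show ?thesis .
qed

text \<open>The only loop among expressions; quantifiers, multiplication and division are all
  reduced to it. Register \<open>k\<close> accumulates, \<open>Suc k\<close> counts and is variable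
  0 of the summand, whose scratch space starts behind both.\<close>

lemma computable_sum:
  assumes f: "computable (\<lambda>\<rho> m. f (\<rho> 0) (\<lambda>i. \<rho> (Suc i)) m)" and a: "a \<in> bound_cells"
  shows "computable (\<lambda>\<rho> m. \<Sum>i\<in>{0..<m a}. f i \<rho> m)"
proof -
  let ?f = "\<lambda>\<rho> m. f (\<rho> 0) (\<lambda>i. \<rho> (Suc i)) m"
  obtain T where T: "poly_bounded T" "\<And>k loc. (\<And>i. loc i < k) \<Longrightarrow> \<exists>c. computes c k loc T ?f"
    using computableE[OF f] by blast
  let ?T = "\<lambda>M. 2 + (2 + (M * ((T M + (4 + 4 + 1) + 1) + 4 + 1) + 4 + 1) + 1) + 1"
  show ?thesis
  proof (rule computableI)
    show "poly_bounded ?T" by (intro poly_bounded_intros T)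
  next
    fix k and loc :: "nat \<Rightarrow> nat" assume loc: "\<And>i. loc i < k"
    have loc': "case_nat (Suc k) loc i < Suc (Suc k)" for i
      by (cases i) (auto intro: less_SucI loc)
    obtain c where c: "computes c (Suc (Suc k)) (case_nat (Suc k) loc) T ?f" using T(2)[of "case_nat (Suc k) loc" "Suc (Suc k)", OF loc'] by blast
    let ?b = "Less (Reg (reg (Suc k))) (Load (Const a))"
    let ?u = "Assign (reg k) (Add (Reg (reg k)) (Reg (reg (Suc (Suc k)))))"
    let ?v = "Assign (reg (Suc k)) (Add (Reg (reg (Suc k))) (Const 1))"
    let ?c = "Seq c (Seq ?u ?v)"
    let ?x = "Assign (reg k) (Const 0)" and ?y = "Assign (reg (Suc k)) (Const 0)"
    have "computes (Seq ?x (Seq ?y (While ?b ?c))) k loc ?T (\<lambda>\<rho> m. \<Sum>i\<in>{0..<m a}. f i \<rho> m)"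
      unfolding computes_def
    proof (intro allI impI)
      fix r :: "string \<Rightarrow> int" and m M assume M: "bounded M m"
      then have h: "nat (m a) \<le> M" using a unfolding bounded_def by auto
      define \<rho> :: "nat \<Rightarrow> int" where "\<rho> = (\<lambda>i. r (reg (loc i)))"
      define I where "I = (\<lambda>i s. snd s = m \<and> (\<forall>j<k. fst s (reg j) = r (reg j)) \<and>
        fst s (reg k) = (\<Sum>j\<in>{0..<int i}. f j \<rho> m) \<and> fst s (reg (Suc k)) = int i)"
      define r0 where "r0 = r(reg k := 0, reg (Suc k) := 0)"
      have "\<exists>s'. runs (While ?b ?c) (r0, m)
          (nat (m a) * ((T M + (4 + 4 + 1) + 1) + bcost ?b + 1) + bcost ?b + 1) s' \<and> I (nat (m a)) s'"
      proof (rule runs_While_count)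
        show "I 0 (r0, m)" unfolding I_def r0_def by simp
      next
        fix i s assume "i \<le> nat (m a)" "I i s"
        then show "bval ?b s \<longleftrightarrow> i < nat (m a)" unfolding I_def by auto
      next
        fix i s assume "i < nat (m a)" and I: "I i s"
        obtain r1 where s: "s = (r1, m)" using I unfolding I_def by (cases s) auto
        have I1: "\<And>j. j < k \<Longrightarrow> r1 (reg j) = r (reg j)" "r1 (reg k) = (\<Sum>j\<in>{0..<int i}. f j \<rho> m)"
          "r1 (reg (Suc k)) = int i"
          using I unfolding I_def s by auto
        from computesD[OF c M, of r1] obtain r2 where r2: "runs c (r1, m) (T M) (r2, m)"
          "\<And>i. i < Suc (Suc k) \<Longrightarrow> r2 (reg i) = r1 (reg i)"
          "r2 (reg (Suc (Suc k))) = ?f (\<lambda>i. r1 (reg (case_nat (Suc k) loc i))) m" by metis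
        have val: "r2 (reg (Suc (Suc k))) = f (int i) \<rho> m"
          using r2(3) I1(1,3) loc unfolding \<rho>_def by simp
        define r3 where "r3 = r2(reg k := r2 (reg k) + r2 (reg (Suc (Suc k))))"
        define r4 where "r4 = r3(reg (Suc k) := r3 (reg (Suc k)) + 1)"
        have "runs ?u (r2, m) 4 (r3, m)"
          using runs_Assign[of "reg k" "Add (Reg (reg k)) (Reg (reg (Suc (Suc k))))" "(r2, m)"]
          unfolding r3_def by (simp add: eval_nat_numeral)
        moreover have "runs ?v (r3, m) 4 (r4, m)"
          using runs_Assign[of "reg (Suc k)" "Add (Reg (reg (Suc k))) (Const 1)" "(r3, m)"]
          unfolding r4_def by (simp add: eval_nat_numeral)
        ultimately have "runs ?c s (T M + (4 + 4 + 1) + 1) (r4, m)"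
          unfolding s by (intro runs_Seq[OF r2(1)] runs_Seq)
        moreover have "{0..<1 + int i} = insert (int i) {0..<int i}" by auto
        then have "I (Suc i) (r4, m)"
          unfolding I_def r4_def r3_def using I1 r2(2) val by auto
        ultimately show "\<exists>s'. runs ?c s (T M + (4 + 4 + 1) + 1) s' \<and> I (Suc i) s'" by blast
      qed
      then obtain s' where s': "runs (While ?b ?c) (r0, m)
          (nat (m a) * ((T M + (4 + 4 + 1) + 1) + bcost ?b + 1) + bcost ?b + 1) s'" "I (nat (m a)) s'"
        by (elim exE conjE)
      define r' where "r' = fst s'"
      have "s' = (r', m)" using s'(2) unfolding I_def r'_def by (cases s') simp
      note r' = s'[unfolded this]
      have b4: "bcost ?b = 4" by simp
      have "nat (m a) * ((T M + (4 + 4 + 1) + 1) + bcost ?b + 1) + bcost ?b + 1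
          \<le> M * ((T M + (4 + 4 + 1) + 1) + 4 + 1) + 4 + 1"
        unfolding b4 using h by (intro add_le_mono mult_le_mono order_refl)
      from runs_mono[OF r'(1) this] have run: "runs (While ?b ?c) (r0, m)
          (M * ((T M + (4 + 4 + 1) + 1) + 4 + 1) + 4 + 1) (r', m)" .
      have xy: "runs ?x (r, m) 2 (r(reg k := 0), m)" "runs ?y (r(reg k := 0), m) 2 (r0, m)"
        using runs_Assign[of "reg k" "Const 0" "(r, m)"]
          runs_Assign[of "reg (Suc k)" "Const 0" "(r(reg k := 0), m)"]
        unfolding r0_def by (simp_all add: numeral_2_eq_2)
      have "runs (Seq ?x (Seq ?y (While ?b ?c))) (r, m) (?T M) (r', m)"
        by (rule runs_Seq[OF xy(1) runs_Seq[OF xy(2) run]])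
      moreover have "{0..<int (nat (m a))} = {0..<m a}" by auto
      ultimately show "\<exists>r'. runs (Seq ?x (Seq ?y (While ?b ?c))) (r, m) (?T M) (r', m) \<and>
          (\<forall>i<k. r' (reg i) = r (reg i)) \<and>
          r' (reg k) = (\<Sum>i\<in>{0..<m a}. f i (\<lambda>i. r (reg (loc i))) m)"
        using r'(2) unfolding I_def \<rho>_def by (intro exI[of _ r']) auto
    qed
    then show "\<exists>c. computes c k loc ?T (\<lambda>\<rho> m. \<Sum>i\<in>{0..<m a}. f i \<rho> m)" by blast
  qed
qed

lemma decidable_Bex:
  assumes P: "decidable (\<lambda>\<rho> m. P (\<rho> 0) (\<lambda>i. \<rho> (Suc i)) m)" and a: "a \<in> bound_cells"
  shows "decidable (\<lambda>\<rho> m. \<exists>i\<in>{0..<m a}. P i \<rho> m)"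
proof -
  have eq: "(\<lambda>\<rho> m. 0 < (\<Sum>i\<in>{0..<m a}. of_bool (P i \<rho> m) :: int)) =
      (\<lambda>\<rho> m. \<exists>i\<in>{0..<m a}. P i \<rho> m)"
  proof (intro ext)
    fix \<rho> m
    have "(\<Sum>i\<in>{0..<m a}. of_bool (P i \<rho> m) :: int) = 0 \<longleftrightarrow> (\<forall>i\<in>{0..<m a}. \<not> P i \<rho> m)"
      by (subst sum_nonneg_eq_0_iff) simp_all
    moreover have "(\<Sum>i\<in>{0..<m a}. of_bool (P i \<rho> m) :: int) \<ge> 0"
      by (rule sum_nonneg) simp
    ultimately show "0 < (\<Sum>i\<in>{0..<m a}. of_bool (P i \<rho> m) :: int) \<longleftrightarrow>
        (\<exists>i\<in>{0..<m a}. P i \<rho> m)" by (auto simp: less_le)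
  qed
  have "computable (\<lambda>\<rho> m. \<Sum>i\<in>{0..<m a}. of_bool (P i \<rho> m))"
    by (rule computable_sum[where f = "\<lambda>i \<rho> m. of_bool (P i \<rho> m)", OF P[unfolded decidable_def] a])
  from decidable_less[OF computable_const[of 0] this] show ?thesis unfolding eq .
qed

lemma decidable_Ball:
  assumes "decidable (\<lambda>\<rho> m. P (\<rho> 0) (\<lambda>i. \<rho> (Suc i)) m)" "a \<in> bound_cells"
  shows "decidable (\<lambda>\<rho> m. \<forall>i\<in>{0..<m a}. P i \<rho> m)"
proof -
  have "decidable (\<lambda>\<rho> m. \<not> (\<exists>i\<in>{0..<m a}. \<not> P i \<rho> m))"
    by (intro decidable_not decidable_Bex assms)
  then show ?thesis by simp
qed

lemma computable_of_bool: "decidable P \<Longrightarrow> computable (\<lambda>\<rho> m. of_bool (P \<rho> m))"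
  unfolding decidable_def .

section \<open>Programs that change the memory\<close>

definition performs ::
    "com \<Rightarrow> nat \<Rightarrow> (nat \<Rightarrow> nat) \<Rightarrow> (nat \<Rightarrow> nat) \<Rightarrow> ((nat \<Rightarrow> int) \<Rightarrow> (int \<Rightarrow> int) \<Rightarrow> int \<Rightarrow> int) \<Rightarrow> bool" where
  "performs c k loc T F \<longleftrightarrow> (\<forall>r m M. bounded M m \<longrightarrow>
     (\<exists>r'. runs c (r, m) (T M) (r', F (\<lambda>i. r (reg (loc i))) m) \<and> (\<forall>i<k. r' (reg i) = r (reg i))))"

definition implementable :: "((nat \<Rightarrow> int) \<Rightarrow> (int \<Rightarrow> int) \<Rightarrow> int \<Rightarrow> int) \<Rightarrow> bool" where
  "implementable F \<longleftrightarrow>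
     (\<exists>T. poly_bounded T \<and> (\<forall>k loc. (\<forall>i. loc i < k) \<longrightarrow> (\<exists>c. performs c k loc T F)))"

lemma implementableE:
  assumes "implementable F"
  obtains T where "poly_bounded T" "\<And>k loc. (\<And>i. loc i < k) \<Longrightarrow> \<exists>c. performs c k loc T F"
  using assms unfolding implementable_def by blast

lemma implementableI:
  assumes "poly_bounded T" "\<And>k loc. (\<And>i. loc i < k) \<Longrightarrow> \<exists>c. performs c k loc T F"
  shows "implementable F"
  using assms unfolding implementable_def by blast

lemma performsD:
  assumes "performs c k loc T F" "bounded M m"
  obtains r' where "runs c (r, m) (T M) (r', F (\<lambda>i. r (reg (loc i))) m)"
    "\<And>i. i < k \<Longrightarrow> r' (reg i) = r (reg i)"
  using assms unfolding performs_def by blast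

lemma implementable_id: "implementable (\<lambda>\<rho> m. m)"
proof (rule implementableI[OF poly_bounded_const[of 1]])
  fix k and loc :: "nat \<Rightarrow> nat"
  have "performs Skip k loc (\<lambda>M. 1) (\<lambda>\<rho> m. m)"
    unfolding performs_def runs_def using exec_Skip by blast
  then show "\<exists>c. performs c k loc (\<lambda>M. 1) (\<lambda>\<rho> m. m)" by blast
qed

lemma implementable_store:
  assumes f: "computable f" and g: "computable g"
  shows "implementable (\<lambda>\<rho> m. m(f \<rho> m := g \<rho> m))"
proof -
  obtain S where S: "poly_bounded S" "\<And>k loc. (\<And>i. loc i < k) \<Longrightarrow> \<exists>c. computes c k loc S f"
    using computableE[OF f] by blast
  obtain T where T: "poly_bounded T" "\<And>k loc. (\<And>i. loc i < k) \<Longrightarrow> \<exists>c. computes c k loc T g"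
    using computableE[OF g] by blast
  show ?thesis
  proof (rule implementableI)
    show "poly_bounded (\<lambda>M. S M + (T M + 3 + 1) + 1)" by (intro poly_bounded_intros S T)
  next
    fix k and loc :: "nat \<Rightarrow> nat" assume loc: "\<And>i. loc i < k"
    then have loc': "\<And>i. loc i < Suc k" using less_Suc_eq by blast
    obtain c where c: "computes c k loc S f" using S(2)[of loc k, OF loc] by blast
    obtain d where d: "computes d (Suc k) loc T g" using T(2)[of loc "Suc k", OF loc'] by blast
    let ?a = "Store (Reg (reg k)) (Reg (reg (Suc k)))"
    have "performs (Seq c (Seq d ?a)) k loc (\<lambda>M. S M + (T M + 3 + 1) + 1)
        (\<lambda>\<rho> m. m(f \<rho> m := g \<rho> m))"
      unfolding performs_def
    proof (intro allI impI)
      fix r m M assume M: "bounded M m"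
      from computesD[OF c M, of r] obtain r1 where r1: "runs c (r, m) (S M) (r1, m)"
        "\<And>i. i < k \<Longrightarrow> r1 (reg i) = r (reg i)" "r1 (reg k) = f (\<lambda>i. r (reg (loc i))) m" by metis
      from computesD[OF d M, of r1] obtain r2 where r2: "runs d (r1, m) (T M) (r2, m)"
        "\<And>i. i < Suc k \<Longrightarrow> r2 (reg i) = r1 (reg i)" "r2 (reg (Suc k)) = g (\<lambda>i. r1 (reg (loc i))) m"
        by metis
      have "runs ?a (r2, m) 3 (r2, m(r2 (reg k) := r2 (reg (Suc k))))"
        using runs_Store[of "Reg (reg k)" "Reg (reg (Suc k))" "(r2, m)"] by (simp add: eval_nat_numeral)
      note run = runs_Seq[OF r1(1) runs_Seq[OF r2(1) this]]
      show "\<exists>r'. runs (Seq c (Seq d ?a)) (r, m) (S M + (T M + 3 + 1) + 1)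
          (r', m(f (\<lambda>i. r (reg (loc i))) m := g (\<lambda>i. r (reg (loc i))) m)) \<and>
          (\<forall>i<k. r' (reg i) = r (reg i))"
        using run r1(2,3) r2(2,3) loc by (intro exI[of _ r2]) simp
    qed
    then show "\<exists>c. performs c k loc (\<lambda>M. S M + (T M + 3 + 1) + 1) (\<lambda>\<rho> m. m(f \<rho> m := g \<rho> m))"
      by blast
  qed
qed

lemma implementable_If:
  assumes P: "decidable P" and F: "implementable F" and G: "implementable G"
  shows "implementable (\<lambda>\<rho> m. if P \<rho> m then F \<rho> m else G \<rho> m)"
proof -
  obtain S where S: "poly_bounded S"
    "\<And>k loc. (\<And>i. loc i < k) \<Longrightarrow> \<exists>c. computes c k loc S (\<lambda>\<rho> m. of_bool (P \<rho> m))"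
    using computableE[OF P[unfolded decidable_def]] by blast
  obtain T where T: "poly_bounded T" "\<And>k loc. (\<And>i. loc i < k) \<Longrightarrow> \<exists>c. performs c k loc T F"
    using implementableE[OF F] by blast
  obtain U where U: "poly_bounded U" "\<And>k loc. (\<And>i. loc i < k) \<Longrightarrow> \<exists>c. performs c k loc U G"
    using implementableE[OF G] by blast
  show ?thesis
  proof (rule implementableI)
    show "poly_bounded (\<lambda>M. S M + (3 + (T M + U M) + 1) + 1)" by (intro poly_bounded_intros S T U)
  next
    fix k and loc :: "nat \<Rightarrow> nat" assume loc: "\<And>i. loc i < k"
    obtain b where b: "computes b k loc S (\<lambda>\<rho> m. of_bool (P \<rho> m))" using S(2)[of loc k, OF loc] by blast
    obtain c where c: "performs c k loc T F" using T(2)[of loc k, OF loc] by blast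
    obtain d where d: "performs d k loc U G" using U(2)[of loc k, OF loc] by blast
    have "performs (Seq b (If (Equal (Reg (reg k)) (Const 1)) c d)) k loc
        (\<lambda>M. S M + (3 + (T M + U M) + 1) + 1) (\<lambda>\<rho> m. if P \<rho> m then F \<rho> m else G \<rho> m)"
      unfolding performs_def
    proof (intro allI impI)
      fix r m M assume M: "bounded M m"
      from computesD[OF b M, of r] obtain r1 where r1: "runs b (r, m) (S M) (r1, m)"
        "\<And>i. i < k \<Longrightarrow> r1 (reg i) = r (reg i)"
        "r1 (reg k) = of_bool (P (\<lambda>i. r (reg (loc i))) m)" by metis
      have eq: "(\<lambda>i. r1 (reg (loc i))) = (\<lambda>i. r (reg (loc i)))" using r1(2) loc by auto
      let ?H = "if P (\<lambda>i. r (reg (loc i))) m then F else G"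
      let ?b = "Equal (Reg (reg k)) (Const 1)"
      obtain r2 where r2: "if bval ?b (r1, m)
           then runs c (r1, m) (T M + U M) (r2, ?H (\<lambda>i. r1 (reg (loc i))) m)
           else runs d (r1, m) (T M + U M) (r2, ?H (\<lambda>i. r1 (reg (loc i))) m)"
        "\<And>i. i < k \<Longrightarrow> r2 (reg i) = r1 (reg i)"
      proof (cases "P (\<lambda>i. r (reg (loc i))) m")
        case True
        from performsD[OF c M, of r1] obtain r2 where
          "runs c (r1, m) (T M) (r2, F (\<lambda>i. r1 (reg (loc i))) m)"
          "\<And>i. i < k \<Longrightarrow> r2 (reg i) = r1 (reg i)" by metis
        then show ?thesis using True that[of r2] r1(3)
            runs_mono[of c "(r1, m)" "T M" "(r2, F (\<lambda>i. r1 (reg (loc i))) m)"] by simp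
      next
        case False
        from performsD[OF d M, of r1] obtain r2 where
          "runs d (r1, m) (U M) (r2, G (\<lambda>i. r1 (reg (loc i))) m)"
          "\<And>i. i < k \<Longrightarrow> r2 (reg i) = r1 (reg i)" by metis
        then show ?thesis using False that[of r2] r1(3)
            runs_mono[of d "(r1, m)" "U M" "(r2, G (\<lambda>i. r1 (reg (loc i))) m)"] by simp
      qed
      have "runs (Seq b (If ?b c d)) (r, m) (S M + (3 + (T M + U M) + 1) + 1)
          (r2, ?H (\<lambda>i. r1 (reg (loc i))) m)"
        using runs_Seq[OF r1(1) runs_If[OF r2(1)]] by (simp add: eval_nat_numeral)
      then show "\<exists>r'. runs (Seq b (If ?b c d)) (r, m) (S M + (3 + (T M + U M) + 1) + 1)
          (r', if P (\<lambda>i. r (reg (loc i))) m then F (\<lambda>i. r (reg (loc i))) m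
            else G (\<lambda>i. r (reg (loc i))) m) \<and> (\<forall>i<k. r' (reg i) = r (reg i))"
        using r1(2) r2(2) unfolding eq by (intro exI[of _ r2]) (auto split: if_splits)
    qed
    then show "\<exists>c. performs c k loc (\<lambda>M. S M + (3 + (T M + U M) + 1) + 1)
        (\<lambda>\<rho> m. if P \<rho> m then F \<rho> m else G \<rho> m)" by blast
  qed
qed

lemma bounded_cong: "(\<And>a. a \<in> bound_cells \<Longrightarrow> m' a = m a) \<Longrightarrow> bounded M m' \<longleftrightarrow> bounded M m"
  unfolding bounded_def by simp

text \<open>The time of the second program is measured by the bound cells that the first one leaves,
  so these have to be preserved for \<open>M\<close> to remain valid.\<close>

lemma implementable_seq:
  assumes F: "implementable F" and G: "implementable G"
    and pres: "\<And>\<rho> m a. a \<in> bound_cells \<Longrightarrow> F \<rho> m a = m a"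
  shows "implementable (\<lambda>\<rho> m. G \<rho> (F \<rho> m))"
proof -
  obtain S where S: "poly_bounded S" "\<And>k loc. (\<And>i. loc i < k) \<Longrightarrow> \<exists>c. performs c k loc S F"
    using implementableE[OF F] by blast
  obtain T where T: "poly_bounded T" "\<And>k loc. (\<And>i. loc i < k) \<Longrightarrow> \<exists>c. performs c k loc T G"
    using implementableE[OF G] by blast
  show ?thesis
  proof (rule implementableI)
    show "poly_bounded (\<lambda>M. S M + T M + 1)" by (intro poly_bounded_intros S T)
  next
    fix k and loc :: "nat \<Rightarrow> nat" assume loc: "\<And>i. loc i < k"
    obtain c where c: "performs c k loc S F" using S(2)[of loc k, OF loc] by blast
    obtain d where d: "performs d k loc T G" using T(2)[of loc k, OF loc] by blast
    have "performs (Seq c d) k loc (\<lambda>M. S M + T M + 1) (\<lambda>\<rho> m. G \<rho> (F \<rho> m))"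
      unfolding performs_def
    proof (intro allI impI)
      fix r :: "string \<Rightarrow> int" and m M assume M: "bounded M m"
      define \<rho> where "\<rho> = (\<lambda>i. r (reg (loc i)))"
      have M': "bounded M (F \<rho> m)" using M bounded_cong[of "F \<rho> m" m, OF pres] by simp
      from performsD[OF c M, of r] obtain r1 where r1: "runs c (r, m) (S M) (r1, F \<rho> m)"
        "\<And>i. i < k \<Longrightarrow> r1 (reg i) = r (reg i)" unfolding \<rho>_def by metis
      have eq: "(\<lambda>i. r1 (reg (loc i))) = \<rho>" unfolding \<rho>_def using r1(2) loc by auto
      from performsD[OF d M', of r1] obtain r2 where r2: "runs d (r1, F \<rho> m) (T M) (r2, G \<rho> (F \<rho> m))"
        "\<And>i. i < k \<Longrightarrow> r2 (reg i) = r1 (reg i)" unfolding eq by metis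
      show "\<exists>r'. runs (Seq c d) (r, m) (S M + T M + 1)
          (r', G (\<lambda>i. r (reg (loc i))) (F (\<lambda>i. r (reg (loc i))) m)) \<and>
          (\<forall>i<k. r' (reg i) = r (reg i))"
        using runs_Seq[OF r1(1) r2(1)] r1(2) r2(2) unfolding \<rho>_def by (intro exI[of _ r2]) simp
    qed
    then show "\<exists>c. performs c k loc (\<lambda>M. S M + T M + 1) (\<lambda>\<rho> m. G \<rho> (F \<rho> m))" by blast
  qed
qed

text \<open>The program reads the bound from cell \<open>a\<close> at every test, whereas the fold
  reads it once at the start; preservation of the bound cells makes the two agree.\<close>

lemma implementable_for:
  assumes F: "implementable (\<lambda>\<rho> m. F (\<rho> 0) (\<lambda>i. \<rho> (Suc i)) m)"
    and pres: "\<And>i \<rho> m a. a \<in> bound_cells \<Longrightarrow> F i \<rho> m a = m a" and a: "a \<in> bound_cells"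
  shows "implementable (\<lambda>\<rho> m. fold (\<lambda>i. F (int i) \<rho>) [0..<nat (m a)] m)"
proof -
  let ?F = "\<lambda>\<rho> m. F (\<rho> 0) (\<lambda>i. \<rho> (Suc i)) m"
  obtain T where T: "poly_bounded T" "\<And>k loc. (\<And>i. loc i < k) \<Longrightarrow> \<exists>c. performs c k loc T ?F"
    using implementableE[OF F] by blast
  let ?T = "\<lambda>M. 2 + (M * ((T M + 4 + 1) + 4 + 1) + 4 + 1) + 1"
  show ?thesis
  proof (rule implementableI)
    show "poly_bounded ?T" by (intro poly_bounded_intros T)
  next
    fix k and loc :: "nat \<Rightarrow> nat" assume loc: "\<And>i. loc i < k"
    have loc': "case_nat k loc i < Suc k" for i
      using loc less_Suc_eq by (simp split: nat.split)
    obtain c where c: "performs c (Suc k) (case_nat k loc) T ?F"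
      using T(2)[of "case_nat k loc" "Suc k", OF loc'] by blast
    let ?b = "Less (Reg (reg k)) (Load (Const a))"
    let ?v = "Assign (reg k) (Add (Reg (reg k)) (Const 1))"
    let ?x = "Assign (reg k) (Const 0)"
    have "performs (Seq ?x (While ?b (Seq c ?v))) k loc ?T
        (\<lambda>\<rho> m. fold (\<lambda>i. F (int i) \<rho>) [0..<nat (m a)] m)"
      unfolding performs_def
    proof (intro allI impI)
      fix r :: "string \<Rightarrow> int" and m M assume M: "bounded M m"
      then have h: "nat (m a) \<le> M" using a unfolding bounded_def by auto
      define \<rho> :: "nat \<Rightarrow> int" where "\<rho> = (\<lambda>i. r (reg (loc i)))"
      define mem where "mem = (\<lambda>i. fold (\<lambda>i. F (int i) \<rho>) [0..<i] m)"
      have mem: "mem i a' = m a'" if "a' \<in> bound_cells" for i a'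
        unfolding mem_def by (induction i) (use pres[OF that] in auto)
      define I where "I = (\<lambda>i s. snd s = mem i \<and> (\<forall>j<k. fst s (reg j) = r (reg j)) \<and>
        fst s (reg k) = int i)"
      define r0 where "r0 = r(reg k := 0)"
      have "\<exists>s'. runs (While ?b (Seq c ?v)) (r0, m)
          (nat (m a) * ((T M + 4 + 1) + bcost ?b + 1) + bcost ?b + 1) s' \<and> I (nat (m a)) s'"
      proof (rule runs_While_count)
        show "I 0 (r0, m)" unfolding I_def r0_def mem_def by simp
      next
        fix i s assume "i \<le> nat (m a)" "I i s"
        then show "bval ?b s \<longleftrightarrow> i < nat (m a)" unfolding I_def using mem[OF a] by auto
      next
        fix i s assume "i < nat (m a)" and I: "I i s"
        obtain r1 where s: "s = (r1, mem i)" using I unfolding I_def by (cases s) auto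
        have I1: "\<And>j. j < k \<Longrightarrow> r1 (reg j) = r (reg j)" "r1 (reg k) = int i"
          using I unfolding I_def s by auto
        have "bounded M (mem i)" using M bounded_cong[of "mem i" m, OF mem] by simp
        from performsD[OF c this, of r1] obtain r2 where
          r2: "runs c (r1, mem i) (T M) (r2, ?F (\<lambda>i. r1 (reg (case_nat k loc i))) (mem i))"
          "\<And>i. i < Suc k \<Longrightarrow> r2 (reg i) = r1 (reg i)" by metis
        have val: "?F (\<lambda>i. r1 (reg (case_nat k loc i))) (mem i) = mem (Suc i)"
          using I1 loc unfolding \<rho>_def mem_def by simp
        define r3 where "r3 = r2(reg k := r2 (reg k) + 1)"
        have "runs ?v (r2, mem (Suc i)) 4 (r3, mem (Suc i))"
          using runs_Assign[of "reg k" "Add (Reg (reg k)) (Const 1)" "(r2, mem (Suc i))"]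
          unfolding r3_def by (simp add: eval_nat_numeral)
        from runs_Seq[OF r2(1)[unfolded val] this]
        have "runs (Seq c ?v) s (T M + 4 + 1) (r3, mem (Suc i))" unfolding s .
        moreover have "I (Suc i) (r3, mem (Suc i))"
          unfolding I_def r3_def using I1 r2(2) by auto
        ultimately show "\<exists>s'. runs (Seq c ?v) s (T M + 4 + 1) s' \<and> I (Suc i) s'" by blast
      qed
      then obtain s' where s': "runs (While ?b (Seq c ?v)) (r0, m)
          (nat (m a) * ((T M + 4 + 1) + bcost ?b + 1) + bcost ?b + 1) s'" "I (nat (m a)) s'"
        by (elim exE conjE)
      define r' where "r' = fst s'"
      have "s' = (r', mem (nat (m a)))" using s'(2) unfolding I_def r'_def by (cases s') simp
      note r' = s'[unfolded this]
      have b4: "bcost ?b = 4" by simp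
      have "nat (m a) * ((T M + 4 + 1) + bcost ?b + 1) + bcost ?b + 1
          \<le> M * ((T M + 4 + 1) + 4 + 1) + 4 + 1"
        unfolding b4 using h by (intro add_le_mono mult_le_mono order_refl)
      from runs_mono[OF r'(1) this] have run: "runs (While ?b (Seq c ?v)) (r0, m)
          (M * ((T M + 4 + 1) + 4 + 1) + 4 + 1) (r', mem (nat (m a)))" .
      have "runs ?x (r, m) 2 (r0, m)"
        using runs_Assign[of "reg k" "Const 0" "(r, m)"] unfolding r0_def by (simp add: numeral_2_eq_2)
      from runs_Seq[OF this run]
      have "runs (Seq ?x (While ?b (Seq c ?v))) (r, m) (?T M) (r', mem (nat (m a)))" .
      then show "\<exists>r'. runs (Seq ?x (While ?b (Seq c ?v))) (r, m) (?T M)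
          (r', fold (\<lambda>i. F (int i) (\<lambda>i. r (reg (loc i)))) [0..<nat (m a)] m) \<and>
          (\<forall>i<k. r' (reg i) = r (reg i))"
        using r'(2) unfolding I_def \<rho>_def mem_def by (intro exI[of _ r']) auto
    qed
    then show "\<exists>c. performs c k loc ?T (\<lambda>\<rho> m. fold (\<lambda>i. F (int i) \<rho>) [0..<nat (m a)] m)"
      by blast
  qed
qed

section \<open>Treewidth\<close>

definition connected_within :: "('a \<times> 'a) set \<Rightarrow> 'a set \<Rightarrow> bool" where
  "connected_within R C \<longleftrightarrow> (\<forall>u\<in>C. \<forall>v\<in>C. (u, v) \<in> (R \<inter> C \<times> C)\<^sup>*)"

definition boundary :: "('a \<times> 'a) set \<Rightarrow> 'a set \<Rightarrow> 'a set" where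
  "boundary R C = R `` C - C"

definition adj :: "'a graph \<Rightarrow> ('a \<times> 'a) set" where
  "adj G = {(x, y). {x, y} \<in> edges G}"

text \<open>A step is put in front of a distinct path; if its source already occurs there, the part
  before that occurrence is cut off.\<close>

lemma rtrancl_imp_distinct_path:
  assumes "(a, b) \<in> R\<^sup>*"
  shows "\<exists>p. p \<noteq> [] \<and> hd p = a \<and> last p = b \<and> successively (\<lambda>x y. (x, y) \<in> R) p \<and> distinct p"
  using assms
proof (induction rule: converse_rtrancl_induct)
  case base
  show ?case by (intro exI[of _ "[b]"]) simp
next
  case (step x y)
  then obtain p where p: "p \<noteq> []" "hd p = y" "last p = b" "successively (\<lambda>x y. (x, y) \<in> R) p"
    "distinct p" by blast
  show ?case
  proof (cases "x \<in> set p")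
    case True
    then obtain us vs where "p = us @ x # vs" by (meson split_list)
    then show ?thesis using p
      by (intro exI[of _ "x # vs"]) (auto simp: successively_append_iff)
  next
    case False
    then show ?thesis using p step(1)
      by (intro exI[of _ "x # p"]) (auto simp: successively_Cons)
  qed
qed

text \<open>Any other connection of the ends, cut down to a distinct path, would close up with the
  edge to a cycle. The cycle has at least three vertices because the edge itself is
  excluded.\<close>

lemma tree_edge_bridge:
  assumes "tree T" "{a, b} \<in> edges T"
  shows "(a, b) \<notin> {(x, y). {x, y} \<in> edges T \<and> {x, y} \<noteq> {a, b}}\<^sup>*"
proof
  assume "(a, b) \<in> {(x, y). {x, y} \<in> edges T \<and> {x, y} \<noteq> {a, b}}\<^sup>*"
  from rtrancl_imp_distinct_path[OF this] obtain p where p: "p \<noteq> []" "hd p = a" "last p = b"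
    "successively (\<lambda>x y. {x, y} \<in> edges T \<and> {x, y} \<noteq> {a, b}) p" "distinct p" by auto
  have "a \<noteq> b" using assms unfolding tree_def simple_graph_def by fastforce
  obtain q where q: "p = a # q" using p(1,2) by (cases p) auto
  then obtain x r where r: "q = x # r" using p(3) \<open>a \<noteq> b\<close> by (cases q) auto
  have "r \<noteq> []" using p(3,4) unfolding q r by (auto simp: successively_Cons)
  then have "3 \<le> length p" unfolding q r by (cases r) auto
  moreover have "successively (\<lambda>x y. {x, y} \<in> edges T) p"
    using p(4) by (rule successively_mono) auto
  moreover have "{last p, hd p} \<in> edges T" using assms(2) p(2,3) by (simp add: insert_commute)
  ultimately have "cycle_in T p" unfolding cycle_in_def using p(5) by blast
  then show False using assms(1) unfolding tree_def by blast
qed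

lemma successively_imp_rtrancl:
  assumes "successively (\<lambda>x y. (x, y) \<in> R) q" "q \<noteq> []" "\<And>x y. (x, y) \<in> R \<Longrightarrow> x \<in> set q \<Longrightarrow> y \<in> set q \<Longrightarrow> (x, y) \<in> S"
  shows "(hd q, last q) \<in> S\<^sup>*"
  using assms
proof (induction q)
  case (Cons x q)
  show ?case
  proof (cases "q = []")
    case False
    have "(hd q, last q) \<in> S\<^sup>*" using Cons False by (intro Cons.IH) (auto simp: successively_Cons)
    moreover have "(x, hd q) \<in> S" using Cons.prems False by (auto simp: successively_Cons)
    ultimately show ?thesis using False by (simp add: converse_rtrancl_into_rtrancl)
  qed simp
qed simp

lemma tree_decompositionD:
  assumes "tree_decomposition G T B"
  shows "tree T" "t \<in> verts T \<Longrightarrow> B t \<subseteq> verts G"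
    "v \<in> verts G \<Longrightarrow> \<exists>t\<in>verts T. v \<in> B t"
    "e \<in> edges G \<Longrightarrow> \<exists>t\<in>verts T. e \<subseteq> B t"
    "v \<in> verts G \<Longrightarrow> connected_graph (induced T {t \<in> verts T. v \<in> B t})"
  using assms unfolding tree_decomposition_def by auto

text \<open>The nodes whose bags meet a connected set form a subtree: along a path in
  \<open>C\<close>, consecutive vertices share a bag, and the bags of a single vertex are
  connected.\<close>

lemma bags_meeting_connected:
  assumes td: "tree_decomposition G T B" and C: "C \<subseteq> verts G" "connected_within (adj G) C"
    and s: "s \<in> verts T" "B s \<inter> C \<noteq> {}" and t: "t \<in> verts T" "B t \<inter> C \<noteq> {}"
  shows "(s, t) \<in> {(x, y). {x, y} \<in> edges T \<and> B x \<inter> C \<noteq> {} \<and> B y \<inter> C \<noteq> {}}\<^sup>*"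
proof -
  let ?R = "{(x, y). {x, y} \<in> edges T \<and> B x \<inter> C \<noteq> {} \<and> B y \<inter> C \<noteq> {}}"
  have bags: "(x, y) \<in> ?R\<^sup>*" if "v \<in> C" "x \<in> verts T" "y \<in> verts T" "v \<in> B x" "v \<in> B y" for v x y
  proof -
    have "connected_graph (induced T {t \<in> verts T. v \<in> B t})"
      using tree_decompositionD(5)[OF td] that(1) C(1) by auto
    then have "(x, y) \<in> {(x, y). {x, y} \<in> edges (induced T {t \<in> verts T. v \<in> B t})}\<^sup>*"
      using that unfolding connected_graph_def induced_def by auto
    moreover have "{(x, y). {x, y} \<in> edges (induced T {t \<in> verts T. v \<in> B t})} \<subseteq> ?R"
      using that(1) unfolding induced_def by auto
    ultimately show ?thesis using rtrancl_mono by blast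
  qed
  obtain u v where u: "u \<in> B s" "u \<in> C" and v: "v \<in> B t" "v \<in> C" using s t by blast
  have "(u, v) \<in> (adj G \<inter> C \<times> C)\<^sup>*" using C(2) u v unfolding connected_within_def by blast
  then show ?thesis using v t(1)
  proof (induction arbitrary: t rule: rtrancl_induct)
    case base
    show ?case by (rule bags[of u]) (use base u s in auto)
  next
    case (step v v')
    then have "{v, v'} \<in> edges G" "v \<in> C" unfolding adj_def by auto
    then obtain r where r: "r \<in> verts T" "{v, v'} \<subseteq> B r"
      using tree_decompositionD(4)[OF td] by meson
    have "(s, r) \<in> ?R\<^sup>*" by (rule step.IH) (use r \<open>v \<in> C\<close> in auto)
    moreover have "(r, t) \<in> ?R\<^sup>*" by (rule bags[of v']) (use r step.prems in auto)
    ultimately show ?case by (rule rtrancl_trans)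
  qed
qed

text \<open>Walk in the tree from a bag that covers the boundary towards one that meets
  \<open>C\<close>. As long as the current bag misses \<open>C\<close>, the next bag still covers
  the boundary.\<close>

lemma bag_covering_boundary:
  assumes td: "tree_decomposition G T B" and C: "C \<subseteq> verts G" "connected_within (adj G) C" "C \<noteq> {}"
    and t0: "t0 \<in> verts T" "boundary (adj G) C \<subseteq> B t0"
  shows "\<exists>t\<in>verts T. B t \<inter> C \<noteq> {} \<and> boundary (adj G) C \<subseteq> B t"
proof -
  have tree: "tree T" by (rule tree_decompositionD(1)[OF td])
  obtain v where "v \<in> C" using C(3) by blast
  then obtain s where s: "s \<in> verts T" "B s \<inter> C \<noteq> {}"
    using tree_decompositionD(3)[OF td, of v] C(1) by auto
  have "(t0, s) \<in> (adj T)\<^sup>*"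
    using tree t0(1) s(1) unfolding tree_def connected_graph_def adj_def by blast
  from rtrancl_imp_distinct_path[OF this] obtain p where p: "p \<noteq> []" "hd p = t0" "last p = s"
    "successively (\<lambda>x y. (x, y) \<in> adj T) p" "distinct p" by blast
  from p(1,4,5) p(2)[symmetric] p(3) t0 s show ?thesis
  proof (induction p arbitrary: t0)
    case (Cons t p)
    show ?case
    proof (cases "B t0 \<inter> C = {}")
      case True
      then obtain t1 q where q: "p = t1 # q" using Cons.prems by (cases p) auto
      have t: "t = t0" using Cons.prems by simp
      have edge: "{t0, t1} \<in> edges T"
        using Cons.prems(2) unfolding q t adj_def by (simp add: successively_Cons)
      then have t1: "t1 \<in> verts T" using tree unfolding tree_def simple_graph_def by auto
      let ?R = "{(x, y). {x, y} \<in> edges T \<and> {x, y} \<noteq> {t0, t1}}"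
      have sym: "sym (?R\<^sup>*)" by (intro sym_rtrancl symI) (auto simp: insert_commute)
      \<comment> \<open>A boundary vertex \<open>x\<close> lost at \<open>t1\<close> would give a
        detour around the edge from \<open>t0\<close> to \<open>t1\<close>: through bags containing
        \<open>x\<close> to a bag shared with a neighbour in \<open>C\<close>, then through bags
        meeting \<open>C\<close> to \<open>s\<close>, then back along the path to
        \<open>t1\<close>.\<close>
      have "boundary (adj G) C \<subseteq> B t1"
      proof (rule ccontr)
        assume "\<not> boundary (adj G) C \<subseteq> B t1"
        then obtain x where x: "x \<in> boundary (adj G) C" "x \<notin> B t1" by blast
        then obtain c where c: "c \<in> C" "{c, x} \<in> edges G" unfolding boundary_def adj_def by blast
        obtain r where r: "r \<in> verts T" "c \<in> B r" "x \<in> B r"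
          using tree_decompositionD(4)[OF td c(2)] by auto
        have xG: "x \<in> verts G" using tree_decompositionD(2)[OF td r(1)] r(3) by auto
        have "connected_graph (induced T {t \<in> verts T. x \<in> B t})"
          by (rule tree_decompositionD(5)[OF td xG])
        then have "(t0, r) \<in> {(y, z). {y, z} \<in> edges (induced T {t \<in> verts T. x \<in> B t})}\<^sup>*"
          using r x(1) Cons.prems(6,7) unfolding connected_graph_def induced_def by auto
        moreover have "{(y, z). {y, z} \<in> edges (induced T {t \<in> verts T. x \<in> B t})} \<subseteq> ?R"
          using x(2) unfolding induced_def by (auto simp: doubleton_eq_iff)
        ultimately have 1: "(t0, r) \<in> ?R\<^sup>*" using rtrancl_mono by blast
        have "(r, s) \<in> {(x, y). {x, y} \<in> edges T \<and> B x \<inter> C \<noteq> {} \<and> B y \<inter> C \<noteq> {}}\<^sup>*"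
          using bags_meeting_connected[OF td C(1,2), of r s] r c Cons.prems(8,9) by blast
        moreover have "{(x, y). {x, y} \<in> edges T \<and> B x \<inter> C \<noteq> {} \<and> B y \<inter> C \<noteq> {}} \<subseteq> ?R"
          using True by (auto simp: doubleton_eq_iff)
        ultimately have 2: "(r, s) \<in> ?R\<^sup>*" using rtrancl_mono by blast
        \<comment> \<open>The path is distinct, so its remainder avoids \<open>t0\<close> and hence
          the edge in question.\<close>
        have "(hd p, last p) \<in> ?R\<^sup>*"
          using Cons.prems(2,3) unfolding q t
          by (intro successively_imp_rtrancl[where R = "adj T"])
             (auto simp: adj_def doubleton_eq_iff)
        then have "(t1, s) \<in> ?R\<^sup>*" using Cons.prems(5) unfolding q by simp
        then have "(s, t1) \<in> ?R\<^sup>*" using sym unfolding sym_def by blast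
        then have "(t0, t1) \<in> ?R\<^sup>*" using 1 2 by (meson rtrancl_trans)
        then show False using tree_edge_bridge[OF tree edge] by blast
      qed
      then show ?thesis
        using Cons.IH[of t1] Cons.prems t1 unfolding q by (auto simp: successively_Cons)
    qed (use Cons.prems in blast)
  qed simp
qed

text \<open>Guarantees that the \<open>LEAST\<close> in \<open>treewidth\<close> ranges over a
  nonempty set.\<close>

lemma singleton_tree_decomposition:
  assumes "simple_graph G"
  shows "tree_decomposition G ({0 :: nat}, {}) (\<lambda>_. verts G)"
proof -
  have "\<not> cycle_in ({0 :: nat}, {}) p" for p
    unfolding cycle_in_def by simp
  then show ?thesis
    using assms unfolding tree_decomposition_def tree_def simple_graph_def connected_graph_def induced_def
    by auto
qed

lemma treewidth_decomposition:
  assumes "simple_graph G" "treewidth G \<le> w"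
  obtains T :: "nat graph" and B where "tree_decomposition G T B" "\<And>t. t \<in> verts T \<Longrightarrow> card (B t) \<le> w + 1"
proof -
  have "\<exists>k (T :: nat graph) B. tree_decomposition G T B \<and> decomposition_width T B = k"
    using singleton_tree_decomposition[OF assms(1)] by blast
  then have "\<exists>(T :: nat graph) B. tree_decomposition G T B \<and> decomposition_width T B = treewidth G"
    unfolding treewidth_def by (rule LeastI_ex)
  then obtain T :: "nat graph" and B where td: "tree_decomposition G T B"
    and wd: "decomposition_width T B = treewidth G" by blast
  have "finite (verts T)"
    using tree_decompositionD(1)[OF td] unfolding tree_def simple_graph_def by simp
  then have max: "card (B t) \<le> Max ((\<lambda>t. card (B t)) ` verts T)" if "t \<in> verts T" for t
    using that by (intro Max_ge) auto
  have "Max ((\<lambda>t. card (B t)) ` verts T) \<le> w + 1"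
    using wd assms(2) unfolding decomposition_width_def by linarith
  then have "card (B t) \<le> w + 1" if "t \<in> verts T" for t
    using max[OF that] by linarith
  with td that show ?thesis by blast
qed

text \<open>The winning strategy of the cops: the robber is confined to the connected set \<open>C\<close>, and a cop
  can be added next to those on the boundary of \<open>C\<close>.\<close>

lemma treewidth_strategy:
  assumes G: "simple_graph G" and w: "treewidth G \<le> w"
  obtains ok where "ok {}" "\<And>S S'. ok S \<Longrightarrow> S' \<subseteq> S \<Longrightarrow> ok S'"
    "\<And>S. ok S \<Longrightarrow> S \<subseteq> verts G \<and> card S \<le> w + 1"
    "\<And>C. C \<subseteq> verts G \<Longrightarrow> C \<noteq> {} \<Longrightarrow> connected_within (adj G) C \<Longrightarrow> ok (boundary (adj G) C) \<Longrightarrow>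
       \<exists>z\<in>C. ok (insert z (boundary (adj G) C))"
proof -
  obtain T :: "nat graph" and B where td: "tree_decomposition G T B"
    and B: "\<And>t. t \<in> verts T \<Longrightarrow> card (B t) \<le> w + 1"
    using treewidth_decomposition[OF G w] by blast
  have sub: "B t \<subseteq> verts G" if "t \<in> verts T" for t
    using tree_decompositionD(2)[OF td that] .
  have fin: "finite (B t)" if "t \<in> verts T" for t
    using sub[OF that] G unfolding simple_graph_def by (meson finite_subset)
  show ?thesis
  proof (rule that[of "\<lambda>S. \<exists>t\<in>verts T. S \<subseteq> B t"])
    show "\<exists>t\<in>verts T. {} \<subseteq> B t"
      using tree_decompositionD(1)[OF td] unfolding tree_def by auto
  next
    fix S assume "\<exists>t\<in>verts T. S \<subseteq> B t"
    then obtain t where t: "t \<in> verts T" "S \<subseteq> B t" by blast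
    then show "S \<subseteq> verts G \<and> card S \<le> w + 1"
      using sub[OF t(1)] B[OF t(1)] card_mono[OF fin[OF t(1)] t(2)] by auto
  next
    fix C assume "C \<subseteq> verts G" "C \<noteq> {}" "connected_within (adj G) C"
      "\<exists>t\<in>verts T. boundary (adj G) C \<subseteq> B t"
    then show "\<exists>z\<in>C. \<exists>t\<in>verts T. insert z (boundary (adj G) C) \<subseteq> B t"
      using bag_covering_boundary[OF td, of C] by blast
  qed blast
qed

section \<open>Dynamic programming over labellings\<close>

lemma digits_exist:
  fixes b :: int
  assumes "\<And>i. i < k \<Longrightarrow> 0 \<le> f i \<and> f i < b" "0 < b"
  shows "\<exists>e. 0 \<le> e \<and> e < b ^ k \<and> (\<forall>i<k. e div b ^ i mod b = f i)"
  using assms(1)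
proof (induction k)
  case 0
  show ?case by (intro exI[of _ 0]) simp
next
  case (Suc k)
  then obtain e where e: "0 \<le> e" "e < b ^ k" "\<forall>i<k. e div b ^ i mod b = f i" by auto
  have fk: "0 \<le> f k" "f k < b" using Suc.prems by auto
  have "e + f k * b ^ k < b ^ k + f k * b ^ k" using e by simp
  also have "\<dots> = (f k + 1) * b ^ k" by (simp add: algebra_simps)
  also have "\<dots> \<le> b * b ^ k" using fk \<open>0 < b\<close> by (intro mult_right_mono) auto
  finally have "e + f k * b ^ k < b ^ Suc k" by simp
  moreover have "(e + f k * b ^ k) div b ^ i mod b = f i" if "i < Suc k" for i
  proof (cases "i = k")
    case True
    have "(e + f k * b ^ k) div b ^ k = f k" using e(1,2) \<open>0 < b\<close> by (simp add: div_pos_pos_trivial)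
    then show ?thesis using True fk by simp
  next
    case False
    then have i: "i < k" using that by simp
    then obtain m where m: "k = Suc (i + m)" using less_imp_Suc_add by blast
    have "(e + f k * b ^ k) div b ^ i = (e + (f k * b ^ m * b) * b ^ i) div b ^ i"
      unfolding m by (simp add: power_add mult_ac)
    also have "\<dots> = f k * b ^ m * b + e div b ^ i"
      using \<open>0 < b\<close> by (intro div_mult_self1) auto
    finally show ?thesis using e(3) i by simp
  qed
  moreover have "0 \<le> e + f k * b ^ k" using e fk \<open>0 < b\<close> by simp
  ultimately show ?case by blast
qed

text \<open>No assumption on the treewidth is made here: this locale carries the whole soundness
  part. Vertices are integers from 1 on because they are stored in machine cells and 0 has to stay
  free for "no vertex".\<close>

locale labelling =
  fixes n K :: int and E :: "(int \<times> int) set" and \<tau> :: "int \<Rightarrow> int"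
  assumes n: "0 \<le> n" and K: "1 \<le> K"
    and sym: "(u, v) \<in> E \<Longrightarrow> (v, u) \<in> E"
    and dom: "(u, v) \<in> E \<Longrightarrow> u \<in> {1..n} \<and> v \<in> {1..n}"
    and irrefl: "(u, u) \<notin> E"
begin

section \<open>Components of the graph without a bag\<close>

abbreviation V :: "int set" where "V \<equiv> {1..n}"

text \<open>For \<open>u\<close> outside \<open>X\<close> this is the component of \<open>u\<close>
  in the graph without \<open>X\<close>. Only the targets of steps have to avoid \<open>X\<close>,
  which is why symmetry asks for the start to lie outside.\<close>

definition reach :: "int set \<Rightarrow> int \<Rightarrow> int set" where
  "reach X u = (E \<inter> UNIV \<times> (- X))\<^sup>* `` {u}"

lemma reach_refl: "u \<in> reach X u"
  unfolding reach_def by simp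

lemma reach_step: "v \<in> reach X u \<Longrightarrow> (v, w) \<in> E \<Longrightarrow> w \<notin> X \<Longrightarrow> w \<in> reach X u"
  unfolding reach_def by (auto intro: rtrancl_into_rtrancl)

lemma reach_induct [consumes 1, case_names base step]:
  assumes "v \<in> reach X u" "P u"
    "\<And>v w. v \<in> reach X u \<Longrightarrow> P v \<Longrightarrow> (v, w) \<in> E \<Longrightarrow> w \<notin> X \<Longrightarrow> P w"
  shows "P v"
proof -
  have "(u, v) \<in> (E \<inter> UNIV \<times> (- X))\<^sup>*" using assms(1) unfolding reach_def by simp
  then show ?thesis
    by (induction rule: rtrancl_induct) (use assms(2,3) in \<open>auto simp: reach_def\<close>)
qed

lemma reach_subset: "v \<in> reach X u \<Longrightarrow> u \<in> V \<Longrightarrow> u \<notin> X \<Longrightarrow> v \<in> V \<and> v \<notin> X"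
  by (induction rule: reach_induct) (use dom in auto)

lemma reach_inside: "u \<in> V \<Longrightarrow> u \<notin> X \<Longrightarrow> reach X u \<subseteq> V \<and> reach X u \<inter> X = {}"
  using reach_subset by blast

lemma reach_trans:
  assumes "v \<in> reach X u" "w \<in> reach X v"
  shows "w \<in> reach X u"
  using assms(2)
proof (induction rule: reach_induct)
  case (step v w)
  from step(4,2,3) show ?case by (rule reach_step)
qed (rule assms(1))

lemma reach_sym:
  assumes "v \<in> reach X u" "u \<notin> X"
  shows "u \<in> reach X v"
proof -
  have "u \<in> reach X v \<and> v \<notin> X"
    using assms(1)
  proof (induction rule: reach_induct)
    case base
    show ?case using reach_refl assms(2) by simp
  next
    case (step v w)
    have "v \<in> reach X w" by (rule reach_step[OF reach_refl]) (use step sym in auto)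
    then show ?case using step reach_trans by blast
  qed
  then show ?thesis ..
qed

lemma reach_eq: "v \<in> reach X u \<Longrightarrow> u \<notin> X \<Longrightarrow> reach X v = reach X u"
  using reach_trans reach_sym by blast

lemma reach_antimono: "Y \<subseteq> X \<Longrightarrow> reach X u \<subseteq> reach Y u"
  unfolding reach_def by (intro Image_mono rtrancl_mono) auto

lemma reach_connected:
  assumes "u \<notin> X"
  shows "connected_within E (reach X u)"
  unfolding connected_within_def
proof (intro ballI)
  fix v w assume v: "v \<in> reach X u" and w: "w \<in> reach X u"
  have eq: "reach X v = reach X u" by (rule reach_eq[OF v assms])
  have "w \<in> reach X v" using w eq by simp
  then show "(v, w) \<in> (E \<inter> reach X u \<times> reach X u)\<^sup>*"
  proof (induction rule: reach_induct)
    case (step y z)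
    then have "z \<in> reach X v" using reach_step by blast
    then show ?case using step eq by (auto intro: rtrancl_into_rtrancl)
  qed simp
qed

lemma boundary_reach: "u \<notin> X \<Longrightarrow> boundary E (reach X u) \<subseteq> X"
  unfolding boundary_def using reach_step by blast

text \<open>The union of those components of the graph without \<open>X\<close> that contain an
  eligible vertex above \<open>j\<close>, where eligible means adjacent to \<open>y\<close>, or
  anything if \<open>y = 0\<close>. Raising \<open>j\<close> by one can lose only a single
  component, so a region is consumed component by component.\<close>

definition region :: "int set \<Rightarrow> int \<Rightarrow> int \<Rightarrow> int set" where
  "region X y j = {v. \<exists>u\<in>V. j < u \<and> (y = 0 \<or> (y, u) \<in> E) \<and> u \<notin> X \<and> v \<in> reach X u}"

lemma region_subset: "region X y j \<subseteq> V - X"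
  unfolding region_def using reach_subset by blast

lemma finite_region: "finite (region X y j)"
  using region_subset by (rule finite_subset) simp

lemma region_closed: "v \<in> region X y j \<Longrightarrow> (v, w) \<in> E \<Longrightarrow> w \<in> region X y j \<union> X"
  unfolding region_def using reach_step by blast

lemma region_reach: "u \<in> region X y j \<Longrightarrow> reach X u \<subseteq> region X y j"
  unfolding region_def using reach_trans by blast

lemma region_Suc:
  assumes "0 \<le> j" "j < n"
  shows "region X y j = (if (y = 0 \<or> (y, j + 1) \<in> E) \<and> j + 1 \<notin> X
    then region X y (j + 1) \<union> reach X (j + 1) else region X y (j + 1))"
proof -
  define j' where "j' = j + 1"
  have "\<forall>u. j < u \<longleftrightarrow> u = j' \<or> j' < u" unfolding j'_def by auto
  moreover have "j' \<in> V" unfolding j'_def using assms by simp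
  ultimately have "region X y j = (if (y = 0 \<or> (y, j') \<in> E) \<and> j' \<notin> X
      then region X y j' \<union> reach X j' else region X y j')"
    unfolding region_def by (simp only: split: if_split) blast
  then show ?thesis unfolding j'_def .
qed

lemma region_disjoint:
  assumes "u \<notin> X" "u \<notin> region X y j"
  shows "region X y j \<inter> reach X u = {}"
  using assms reach_sym region_reach by blast

text \<open>Removing \<open>z\<close> splits its connected component into pieces each of which
  contains a neighbour of \<open>z\<close>. Hence it is enough to index the subproblems below
  \<open>z\<close> by the neighbours of \<open>z\<close>.\<close>

lemma reach_region:
  assumes "z \<in> V" "z \<notin> X"
  shows "reach X z = insert z (region (insert z X) z 0)"
proof (intro equalityI subsetI)
  fix v assume "v \<in> reach X z"
  then show "v \<in> insert z (region (insert z X) z 0)"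
  proof (induction rule: reach_induct)
    case (step v w)
    have w: "w \<in> V" "0 < w" using dom[OF step(2)] by auto
    show ?case
    proof (cases "w = z")
      case False
      then have "w \<notin> insert z X" using step by simp
      show ?thesis
      proof (cases "v = z")
        case True
        then have "(z, w) \<in> E" using step(2) by simp
        then have "w \<in> region (insert z X) z 0"
          unfolding region_def using w \<open>w \<notin> insert z X\<close> reach_refl[of w "insert z X"] by blast
        then show ?thesis by (rule insertI2)
      next
        case False
        then have "v \<in> region (insert z X) z 0" using step(4) by blast
        from region_closed[OF this step(2)] show ?thesis using \<open>w \<notin> insert z X\<close> by blast
      qed
    qed simp
  qed simp
next
  fix v assume v: "v \<in> insert z (region (insert z X) z 0)"
  show "v \<in> reach X z"
  proof (cases "v = z")
    case False
    then obtain u where u: "z = 0 \<or> (z, u) \<in> E" "u \<notin> insert z X" "v \<in> reach (insert z X) u"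
      using v unfolding region_def by blast
    then have "(z, u) \<in> E" using assms by auto
    then have "u \<in> reach X z" using u by (intro reach_step[OF reach_refl]) auto
    moreover have "v \<in> reach X u" using u(3) reach_antimono[of X "insert z X"] by blast
    ultimately show ?thesis by (rule reach_trans)
  qed (simp add: reach_refl)
qed

text \<open>Used to drop a vertex from the bag in order to reuse its slot: a vertex that is not
  reached does not block anything either.\<close>

lemma reach_insert:
  assumes "x \<notin> reach X z" "X \<subseteq> Y" "Y \<subseteq> insert x X"
  shows "reach Y z = reach X z"
proof
  show "reach Y z \<subseteq> reach X z" using assms(2) by (rule reach_antimono)
  show "reach X z \<subseteq> reach Y z"
  proof
    fix v assume "v \<in> reach X z"
    then show "v \<in> reach Y z"
    proof (induction rule: reach_induct)
      case (step v w)
      have "w \<in> reach X z" by (rule reach_step[OF step(1-3)])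
      then have "w \<notin> Y" using step(3) assms by auto
      with step(4,2) show ?case by (rule reach_step)
    qed (rule reach_refl)
  qed
qed

text \<open>The bound \<open>c\<close> is kept apart from \<open>p v\<close> because for a vertex of
  the bag it is a digit of the state.\<close>

definition earlier :: "(int \<Rightarrow> int) \<Rightarrow> int set \<Rightarrow> int \<Rightarrow> int \<Rightarrow> int" where
  "earlier p S v c = int (card {u \<in> S. (v, u) \<in> E \<and> p u < c})"

definition cost :: "(int \<Rightarrow> int) \<Rightarrow> int \<Rightarrow> int" where
  "cost p v = max 0 (\<tau> v - earlier p V v (p v))"

lemma earlier_nonneg: "0 \<le> earlier p S v c"
  unfolding earlier_def by simp

lemma earlier_union:
  assumes "finite S" "finite T" "S \<inter> T = {}"
  shows "earlier p (S \<union> T) v c = earlier p S v c + earlier p T v c"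
proof -
  have "{u \<in> S \<union> T. (v, u) \<in> E \<and> p u < c} =
      {u \<in> S. (v, u) \<in> E \<and> p u < c} \<union> {u \<in> T. (v, u) \<in> E \<and> p u < c}" by auto
  then show ?thesis unfolding earlier_def using assms by (simp add: card_Un_disjoint disjoint_iff)
qed

lemma earlier_insert:
  assumes "finite S" "z \<notin> S"
  shows "earlier p (insert z S) v c = of_bool ((v, z) \<in> E \<and> p z < c) + earlier p S v c"
proof -
  have "{u \<in> {z}. (v, u) \<in> E \<and> p u < c} = (if (v, z) \<in> E \<and> p z < c then {z} else {})" by auto
  then have "earlier p {z} v c = of_bool ((v, z) \<in> E \<and> p z < c)"
    unfolding earlier_def by simp
  then show ?thesis using earlier_union[of "{z}" S p v c] assms by simp
qed

lemma earlier_cong: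
  assumes "\<And>u. u \<in> S \<Longrightarrow> (v, u) \<in> E \<Longrightarrow> p u = p' u"
  shows "earlier p S v c = earlier p' S v c"
  unfolding earlier_def using assms by (intro arg_cong[of _ _ "\<lambda>A. int (card A)"]) auto

lemma earlier_mono:
  assumes "finite T" "\<And>u. u \<in> S \<Longrightarrow> (v, u) \<in> E \<Longrightarrow> p u < c \<Longrightarrow> u \<in> T"
  shows "earlier p S v c \<le> earlier p T v c"
  unfolding earlier_def using assms by (auto intro!: card_mono)

lemma earlier_le: "S \<subseteq> V \<Longrightarrow> earlier p S v c \<le> n"
proof -
  assume "S \<subseteq> V"
  then have "card {u \<in> S. (v, u) \<in> E \<and> p u < c} \<le> card V" by (intro card_mono) auto
  then show ?thesis using n unfolding earlier_def by simp
qed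

section \<open>States, tables and the relaxation rule\<close>

text \<open>A state is the number with the digits \<open>x\<close>, \<open>p\<close>, \<open>d\<close> (\<open>K\<close> digits each), \<open>y\<close> and \<open>j\<close> in base
  \<open>n + 1\<close>. It stands for the task to label the vertices of \<open>region X y j\<close>, given the labels \<open>p\<close> of
  the vertices \<open>x\<close>, in such a way that each vertex in \<open>x\<close> has at least \<open>d\<close> neighbours with a
  smaller label in the region. The digit 0 of \<open>x\<close> marks an unused slot.\<close>

definition digit :: "int \<Rightarrow> int \<Rightarrow> int" where
  "digit e i = e div (n + 1) ^ nat i mod (n + 1)"

definition states :: "int set" where "states = {0..<(n + 1) ^ nat (3 * K + 2)}"

abbreviation slots :: "int set" where "slots \<equiv> {0..<K}"

abbreviation label :: "int \<Rightarrow> int \<Rightarrow> int" where "label e l \<equiv> digit e (K + l)"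
abbreviation demand :: "int \<Rightarrow> int \<Rightarrow> int" where "demand e l \<equiv> digit e (2 * K + l)"
abbreviation centre :: "int \<Rightarrow> int" where "centre e \<equiv> digit e (3 * K)"
abbreviation passed :: "int \<Rightarrow> int" where "passed e \<equiv> digit e (3 * K + 1)"

definition bag :: "int \<Rightarrow> int set" where "bag e = digit e ` slots"

abbreviation area :: "int \<Rightarrow> int set" where "area e \<equiv> region (bag e) (centre e) (passed e)"

lemma digit_bounds: "0 \<le> digit e i" "digit e i \<le> n"
proof -
  have "0 < n + 1" using n by simp
  then show "0 \<le> digit e i" unfolding digit_def by (rule pos_mod_sign)
  have "digit e i < n + 1" unfolding digit_def using \<open>0 < n + 1\<close> by (rule pos_mod_bound)
  then show "digit e i \<le> n" by simp
qed

lemma state_exists: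
  assumes "\<And>l. l \<in> slots \<Longrightarrow> x l \<in> {0..n} \<and> p l \<in> {0..n} \<and> d l \<in> {0..n}" "y \<in> {0..n}" "j \<in> {0..n}"
  shows "\<exists>e\<in>states. (\<forall>l\<in>slots. digit e l = x l \<and> label e l = p l \<and> demand e l = d l) \<and>
    centre e = y \<and> passed e = j"
proof -
  define f where "f i = (if i < K then x i else if i < 2 * K then p (i - K)
    else if i < 3 * K then d (i - 2 * K) else if i = 3 * K then y else j)" for i
  have xpd: "x l \<in> {0..n}" "p l \<in> {0..n}" "d l \<in> {0..n}" if "0 \<le> l" "l < K" for l
  proof -
    have "l \<in> slots" using that by simp
    from assms(1)[OF this] show "x l \<in> {0..n}" "p l \<in> {0..n}" "d l \<in> {0..n}" by simp_all
  qed
  have "f i \<in> {0..n}" if "0 \<le> i" for i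
  proof -
    consider "i < K" | "\<not> i < K" "i < 2 * K" | "\<not> i < K" "\<not> i < 2 * K" "i < 3 * K"
      | "\<not> i < K" "\<not> i < 2 * K" "\<not> i < 3 * K" by metis
    then show ?thesis
    proof cases
      case 1
      then show ?thesis unfolding f_def using xpd(1)[of i] that by simp
    next
      case 2
      then show ?thesis unfolding f_def using xpd(2)[of "i - K"] by simp
    next
      case 3
      then show ?thesis unfolding f_def using xpd(3)[of "i - 2 * K"] by simp
    next
      case 4
      then show ?thesis unfolding f_def using assms(2,3) by simp
    qed
  qed
  then have bound: "0 \<le> f (int i) \<and> f (int i) < n + 1" for i
    by (metis atLeastAtMost_iff of_nat_0_le_iff zle_add1_eq_le)
  have "0 < n + 1" using n by simp
  from digits_exist[of "nat (3 * K + 2)" "\<lambda>i. f (int i)", OF bound this]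
  obtain e where e: "0 \<le> e" "e < (n + 1) ^ nat (3 * K + 2)"
    "\<forall>i<nat (3 * K + 2). e div (n + 1) ^ i mod (n + 1) = f (int i)" by blast
  have f: "digit e i = f i" if "0 \<le> i" "i < 3 * K + 2" for i
  proof -
    have "nat i < nat (3 * K + 2)" using that by simp
    with e(3) have "e div (n + 1) ^ nat i mod (n + 1) = f (int (nat i))" by blast
    then show ?thesis unfolding digit_def using that by simp
  qed
  show ?thesis
  proof (intro bexI[of _ e] conjI ballI)
    show "e \<in> states" unfolding states_def using e(1,2) by simp
    fix l assume that: "l \<in> slots"
    show "digit e l = x l" "label e l = p l" "demand e l = d l"
    proof -
      have "f l = x l" "f (K + l) = p l" "f (2 * K + l) = d l" using that by (simp_all add: f_def)
      then show "digit e l = x l" "label e l = p l" "demand e l = d l"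
        using that f[of l] f[of "K + l"] f[of "2 * K + l"] by simp_all
    qed
  next
    show "centre e = y" "passed e = j"
    proof -
      have "f (3 * K) = y" "f (3 * K + 1) = j" using K by (simp_all add: f_def)
      then show "centre e = y" "passed e = j" using K f[of "3 * K"] f[of "3 * K + 1"] by simp_all
    qed
  qed
qed

text \<open>A table \<open>t\<close> has a row for each state. The row of \<open>e\<close> contains a solution iff \<open>0 < t e 0\<close>. Then
  \<open>t e v\<close> is 1 plus the incentive of \<open>v\<close> for the vertices of the area, and 0 for the other vertices.\<close>

definition fresh :: "(int \<Rightarrow> int \<Rightarrow> int) \<Rightarrow> int \<Rightarrow> bool" where
  "fresh t a \<longleftrightarrow> (centre a = 0 \<or> (centre a, passed a) \<in> E) \<and>
     (\<forall>l\<in>slots. digit a l \<noteq> passed a) \<and> t a (passed a) = 0"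

text \<open>\<open>b\<close> arises from \<open>e\<close> by evicting the vertex in slot
  \<open>q\<close> in favour of the new centre. A demand of \<open>e\<close> may be met by the area
  of \<open>a\<close>, by the centre or by the area of \<open>b\<close>; the evicted vertex gets
  nothing from the latter. The last two conditions replace a computation of components: the evicted
  vertex is not in the area of \<open>b\<close>, so evicting it did not enlarge the component, and
  \<open>passed a\<close> lies in the component of the centre.\<close>

definition merges :: "(int \<Rightarrow> int \<Rightarrow> int) \<Rightarrow> int \<Rightarrow> int \<Rightarrow> int \<Rightarrow> int \<Rightarrow> bool" where
  "merges t e a b q \<longleftrightarrow> 0 < t b 0 \<and> passed b = 0 \<and> 1 \<le> centre b \<and>
     (\<forall>l\<in>slots. digit e l \<noteq> centre b \<and>
        (if l = q then digit b l = centre b else digit b l = digit e l \<and> label b l = label e l) \<and>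
        demand e l \<le> demand a l + of_bool ((digit e l, centre b) \<in> E \<and> label b q < label e l) +
          (if l = q then 0 else demand b l)) \<and>
     (digit e q = 0 \<or> t b (digit e q) = 0) \<and> (passed a = centre b \<or> 0 < t b (passed a))"

definition applies :: "(int \<Rightarrow> int \<Rightarrow> int) \<Rightarrow> int \<Rightarrow> int \<Rightarrow> int \<Rightarrow> int \<Rightarrow> bool" where
  "applies t e a b q \<longleftrightarrow> passed a = passed e + 1 \<and> centre a = centre e \<and>
     (\<forall>l\<in>slots. digit a l = digit e l \<and> label a l = label e l) \<and> 0 < t a 0 \<and>
     (if fresh t a then merges t e a b q else \<forall>l\<in>slots. demand e l \<le> demand a l)"

text \<open>The sum is over vertices and not over slots, because an arbitrary state may hold the
  same vertex in several slots; counting it twice would be unsound.\<close>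

definition placed_before :: "int \<Rightarrow> int \<Rightarrow> int \<Rightarrow> int" where
  "placed_before e b q = (\<Sum>u\<in>{0..<n + 1}. of_bool ((centre b, u) \<in> E \<and>
     (\<exists>l\<in>slots. l \<noteq> q \<and> digit e l = u \<and> label e l < label b q)))"

text \<open>At index 0 the flags are added, so the new row is flagged; \<open>1 <= centre b\<close>
  in \<open>merges\<close> keeps the extra term away from that index.\<close>

definition combined :: "(int \<Rightarrow> int \<Rightarrow> int) \<Rightarrow> int \<Rightarrow> int \<Rightarrow> int \<Rightarrow> int \<Rightarrow> int \<Rightarrow> int" where
  "combined t e a b q v = t a v + (if fresh t a then t b v + (if v = centre b
     then 1 + max 0 (\<tau> v - (demand b q + placed_before e b q)) else 0) else 0)"

text \<open>The flag at index 0 is left out. For sound rows of the same state the shifts by 1 add up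
  to the size of the area, so comparing scores means comparing total incentives.\<close>

definition score :: "(int \<Rightarrow> int) \<Rightarrow> int" where
  "score f = (\<Sum>v\<in>{0..<n + 1}. if v = 0 then 0 else f v)"

definition relax :: "(int \<Rightarrow> int \<Rightarrow> int) \<Rightarrow> int \<Rightarrow> int \<Rightarrow> int \<Rightarrow> int \<Rightarrow> int \<Rightarrow> int \<Rightarrow> int" where
  "relax t e a b q =
     (if applies t e a b q \<and> (t e 0 \<le> 0 \<or> score (combined t e a b q) < score (t e))
      then t(e := (\<lambda>v. if v \<in> {0..<n + 1} then combined t e a b q v else t e v)) else t)"

lemma score_eq: "score f = (\<Sum>v\<in>V. f v)"
proof -
  have "{0..<n + 1} = insert 0 V" using n by auto
  then show ?thesis unfolding score_def by simp
qed

lemma placed_before_eq: "placed_before e b q =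
    int (card {u \<in> V. (centre b, u) \<in> E \<and> (\<exists>l\<in>slots. l \<noteq> q \<and> digit e l = u \<and> label e l < label b q)})"
proof -
  let ?P = "\<lambda>u. (centre b, u) \<in> E \<and> (\<exists>l\<in>slots. l \<noteq> q \<and> digit e l = u \<and> label e l < label b q)"
  have "{u \<in> {0..<n + 1}. ?P u} = {u \<in> V. ?P u}" using dom by fastforce
  then have "int (card {u \<in> V. ?P u}) = (\<Sum>u\<in>{u \<in> {0..<n + 1}. ?P u}. 1)" by simp
  also have "\<dots> = (\<Sum>u\<in>{0..<n + 1}. if ?P u then 1 else 0)"
    by (rule sum.inter_filter) simp
  finally show ?thesis unfolding placed_before_def by (simp only: of_bool_def)
qed

section \<open>Soundness of the relaxation\<close>

definition agrees :: "(int \<Rightarrow> int) \<Rightarrow> int \<Rightarrow> bool" where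
  "agrees p e \<longleftrightarrow> (\<forall>l\<in>slots. digit e l \<noteq> 0 \<longrightarrow> p (digit e l) = label e l)"

text \<open>Quantifying over all labellings \<open>p0\<close> of the rest of the graph makes solutions for
  different regions easy to combine.\<close>

definition sound_entry :: "(int \<Rightarrow> int \<Rightarrow> int) \<Rightarrow> int \<Rightarrow> bool" where
  "sound_entry t e \<longleftrightarrow> (\<forall>v\<in>V. 0 \<le> t e v \<and> (0 < t e v \<longleftrightarrow> v \<in> area e)) \<and>
     (\<forall>p0. agrees p0 e \<longrightarrow> (\<exists>p. (\<forall>u. u \<notin> area e \<longrightarrow> p u = p0 u) \<and>
        (\<forall>l\<in>slots. demand e l \<le> earlier p (area e) (digit e l) (label e l)) \<and>
        (\<forall>v\<in>area e. 1 + cost p v \<le> t e v)))"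

definition sound :: "(int \<Rightarrow> int \<Rightarrow> int) \<Rightarrow> bool" where
  "sound t \<longleftrightarrow> (\<forall>e\<in>states. 0 < t e 0 \<longrightarrow> sound_entry t e)"

lemma sound_entryD:
  assumes "sound t" "e \<in> states" "0 < t e 0"
  shows "v \<in> V \<Longrightarrow> 0 \<le> t e v" "v \<in> V \<Longrightarrow> 0 < t e v \<longleftrightarrow> v \<in> area e"
    "v \<in> V \<Longrightarrow> t e v = 0 \<longleftrightarrow> v \<notin> area e"
    "agrees p0 e \<Longrightarrow> \<exists>p. (\<forall>u. u \<notin> area e \<longrightarrow> p u = p0 u) \<and>
        (\<forall>l\<in>slots. demand e l \<le> earlier p (area e) (digit e l) (label e l)) \<and>
        (\<forall>v\<in>area e. 1 + cost p v \<le> t e v)"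
proof -
  have se: "sound_entry t e" using assms unfolding sound_def by blast
  then show "v \<in> V \<Longrightarrow> 0 \<le> t e v" "v \<in> V \<Longrightarrow> 0 < t e v \<longleftrightarrow> v \<in> area e"
    unfolding sound_entry_def by blast+
  then show "v \<in> V \<Longrightarrow> t e v = 0 \<longleftrightarrow> v \<notin> area e" by linarith
  show "agrees p0 e \<Longrightarrow> \<exists>p. (\<forall>u. u \<notin> area e \<longrightarrow> p u = p0 u) \<and>
        (\<forall>l\<in>slots. demand e l \<le> earlier p (area e) (digit e l) (label e l)) \<and>
        (\<forall>v\<in>area e. 1 + cost p v \<le> t e v)"
    using se unfolding sound_entry_def by blast
qed

lemma bag_cong: "(\<And>l. l \<in> slots \<Longrightarrow> digit a l = digit e l) \<Longrightarrow> bag a = bag e"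
  unfolding bag_def by (rule image_cong) auto

lemma fresh_iff:
  assumes "sound t" "a \<in> states" "0 < t a 0" "passed a = passed e + 1"
  shows "fresh t a \<longleftrightarrow> (centre a = 0 \<or> (centre a, passed a) \<in> E) \<and> passed a \<notin> bag a \<and> passed a \<notin> area a"
proof -
  \<comment> \<open>\<open>passed a\<close> is at least 1, so it indexes a vertex and not the flag
    of the row.\<close>
  have "passed a \<in> V" using digit_bounds[of e "3 * K + 1"] digit_bounds[of a "3 * K + 1"] assms(4) by simp
  moreover have "(\<forall>l\<in>slots. digit a l \<noteq> passed a) \<longleftrightarrow> passed a \<notin> bag a" unfolding bag_def image_iff by metis
  ultimately show ?thesis using sound_entryD(3)[OF assms(1-3)] unfolding fresh_def by simp
qed

text \<open>Going back from \<open>a\<close> to \<open>e\<close> could only add the component of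
  \<open>passed a\<close>; either this vertex is not eligible or its component is already part of
  the area.\<close>

lemma applies_not_fresh:
  assumes t: "sound t" "a \<in> states" and app: "applies t e a b q" and fr: "\<not> fresh t a"
  shows "area e = area a"
proof -
  have a: "passed a = passed e + 1" "centre a = centre e" "bag a = bag e" "0 < t a 0"
    using app bag_cong[of a e] unfolding applies_def by auto
  have j: "0 \<le> passed e" "passed e < n"
    using digit_bounds[of e "3 * K + 1"] digit_bounds[of a "3 * K + 1"] a(1) by auto
  have "\<not> ((centre e = 0 \<or> (centre e, passed e + 1) \<in> E) \<and> passed e + 1 \<notin> bag e \<and>
      passed e + 1 \<notin> area a)"
    using fr fresh_iff[OF t a(4) a(1)] a by simp
  then show ?thesis
    using region_Suc[OF j, of "bag e" "centre e"] region_reach[of "passed e + 1" "bag e" "centre e" "passed e + 1"]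
    unfolding a by auto
qed

text \<open>The part of the area of \<open>e\<close> that is added to that of \<open>a\<close> is the component of \<open>passed a\<close>. It
  consists of the vertex \<open>centre b\<close>, which takes over slot \<open>q\<close>, and the area of \<open>b\<close>.\<close>

lemma applies_fresh:
  assumes t: "sound t" "a \<in> states" "b \<in> states" and q: "q \<in> slots"
    and app: "applies t e a b q" and fr: "fresh t a"
  shows "area e = area a \<union> insert (centre b) (area b)" "area a \<inter> insert (centre b) (area b) = {}"
    "centre b \<in> V" "centre b \<notin> area b" "insert (centre b) (area b) \<inter> bag e = {}" "bag a = bag e"
    "bag b \<subseteq> insert (centre b) (bag e)" "bag b = insert (centre b) (digit e ` (slots - {q}))"
proof -
  let ?z = "centre b" and ?u = "passed a" and ?X = "digit e ` (slots - {q})"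
  have a: "?u = passed e + 1" "centre a = centre e" "bag a = bag e" "0 < t a 0" and m: "merges t e a b q"
    using app fr bag_cong[of a e] unfolding applies_def by auto
  have j: "0 \<le> passed e" "passed e < n"
    using digit_bounds[of e "3 * K + 1"] digit_bounds[of a "3 * K + 1"] a(1) by auto
  have u: "?u \<in> V" "?u \<notin> bag e" "?u \<notin> area a" "centre e = 0 \<or> (centre e, ?u) \<in> E"
    using fr fresh_iff[OF t(1,2) a(4) a(1)] a j by auto
  have z: "?z \<in> V" "?z \<notin> bag e"
    using m digit_bounds[of b "3 * K"] unfolding merges_def bag_def by auto
  have bag_e: "bag e = insert (digit e q) ?X" unfolding bag_def using q by auto
  have "bag b = digit b ` insert q (slots - {q})" unfolding bag_def insert_Diff[OF q] ..
  also have "\<dots> = insert (digit b q) (digit b ` (slots - {q}))" by (rule image_insert)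
  also have "digit b ` (slots - {q}) = ?X" using m unfolding merges_def by (intro image_cong) auto
  also have "digit b q = ?z" using m q unfolding merges_def by auto
  finally show bag_b: "bag b = insert ?z ?X" .
  have X: "?X \<subseteq> bag e" using bag_e by auto
  then show "bag b \<subseteq> insert ?z (bag e)" using bag_b by auto
  show "bag a = bag e" by fact
  have jb: "passed b = 0" "0 < t b 0" using m unfolding merges_def by auto
  have comp: "reach ?X ?z = insert ?z (area b)"
    using reach_region[of ?z ?X] z X unfolding bag_b jb(1) by auto
  \<comment> \<open>The evicted digit is either no vertex or, according to the row of
    \<open>b\<close>, not in the component of the centre. Putting it back therefore leaves this
    component unchanged.\<close>
  have xq: "digit e q \<notin> reach ?X ?z"
  proof (cases "digit e q \<in> V")
    case True
    then have "t b (digit e q) = 0" using m unfolding merges_def by auto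
    then have "digit e q \<notin> area b" using sound_entryD(3)[OF t(1,3) jb(2) True] by simp
    moreover have "digit e q \<noteq> ?z" using z(2) q unfolding bag_def by (metis imageI)
    ultimately show ?thesis unfolding comp by simp
  next
    case False
    then show ?thesis using reach_subset[of _ ?X ?z] z X by auto
  qed
  have eq: "reach (bag e) ?z = insert ?z (area b)"
    using reach_insert[OF xq X] bag_e comp by simp
  \<comment> \<open>By the last condition of \<open>merges\<close>, the component of the centre is
    the one that \<open>region_Suc\<close> adds.\<close>
  have "?u \<in> insert ?z (area b)"
    using m sound_entryD(2)[OF t(1,3) jb(2) u(1)] unfolding merges_def by auto
  then have ru: "reach (bag e) ?u = insert ?z (area b)" using eq reach_eq[of ?u "bag e" ?z] z by auto
  show "area e = area a \<union> insert ?z (area b)"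
    using region_Suc[OF j, of "bag e" "centre e"] u ru unfolding a by simp
  show "area a \<inter> insert ?z (area b) = {}"
    using region_disjoint[OF u(2), of "centre a" "passed a"] u(3) ru unfolding a by simp
  show "?z \<in> V" by fact
  show "?z \<notin> area b" using region_subset[of "bag b" ?z 0] bag_b unfolding jb by auto
  show "insert ?z (area b) \<inter> bag e = {}"
    using reach_subset[of _ "bag e" ?u] u ru by auto
qed

lemma sound_entry_cong:
  assumes "\<And>v. v \<in> V \<Longrightarrow> t e v = t' e v"
  shows "sound_entry t e \<longleftrightarrow> sound_entry t' e"
proof -
  have "t e v = t' e v" if "v \<in> area e" for v
  proof (rule assms)
    from region_subset that have "v \<in> V - bag e" by (rule subsetD)
    then show "v \<in> V" by (rule DiffD1)
  qed
  then have "(\<forall>v\<in>area e. 1 + cost p v \<le> t e v) \<longleftrightarrow> (\<forall>v\<in>area e. 1 + cost p v \<le> t' e v)" for p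
    by simp
  moreover have "(\<forall>v\<in>V. 0 \<le> t e v \<and> (0 < t e v \<longleftrightarrow> v \<in> area e)) \<longleftrightarrow>
      (\<forall>v\<in>V. 0 \<le> t' e v \<and> (0 < t' e v \<longleftrightarrow> v \<in> area e))"
    by (rule ball_cong) (simp_all add: assms)
  ultimately show ?thesis unfolding sound_entry_def by simp
qed

text \<open>The labellings are chosen one after the other: the row of \<open>a\<close> extends
  \<open>p0\<close>, then the centre gets the label stored in slot \<open>q\<close>, then the row of
  \<open>b\<close> extends the result. The two areas have no edges between them, so the later
  choices do not change costs in the area of \<open>a\<close>.\<close>

lemma sound_entry_fresh:
  assumes t: "sound t" "e \<in> states" "a \<in> states" "b \<in> states" and q: "q \<in> slots"
    and app: "applies t e a b q" and fr: "fresh t a"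
  shows "sound_entry (\<lambda>_. combined t e a b q) e"
proof -
  let ?z = "centre b"
  note ar = applies_fresh[OF t(1,3,4) q app fr]
  have m: "merges t e a b q" and flags: "0 < t a 0" "0 < t b 0"
    and a: "\<And>l. l \<in> slots \<Longrightarrow> digit a l = digit e l \<and> label a l = label e l"
    using app fr unfolding applies_def merges_def by auto
  note A = sound_entryD[OF t(1,3) flags(1)] and B = sound_entryD[OF t(1,4) flags(2)]
  have bl: "digit b l = digit e l" "label b l = label e l" if "l \<in> slots" "l \<noteq> q" for l
    using m that unfolding merges_def by auto
  have bq: "digit b q = ?z" using m q unfolding merges_def by auto
  have fin: "finite (area a)" "finite (area b)" by (rule finite_region)+
  have subV: "area a \<subseteq> V - bag e" "area b \<subseteq> V - bag e"
    using region_subset[of "bag a" "centre a" "passed a"] region_subset[of "bag b" ?z "passed b"] ar(5,6)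
    by auto
  have combined: "combined t e a b q v = t a v + (t b v + (if v = ?z
     then 1 + max 0 (\<tau> v - (demand b q + placed_before e b q)) else 0))" for v
    unfolding combined_def using fr by simp
  have in_a: "combined t e a b q v = t a v" if "v \<in> area a" for v
  proof -
    have "v \<in> V" "v \<notin> area b" "v \<noteq> ?z" using that subV ar(2) by auto
    then show ?thesis using B(3)[of v] unfolding combined by simp
  qed
  have in_b: "combined t e a b q v = t b v" if "v \<in> area b" for v
  proof -
    have "v \<in> V" "v \<notin> area a" "v \<noteq> ?z" using that subV ar(2,4) by auto
    then show ?thesis using A(3)[of v] unfolding combined by simp
  qed
  have at_z: "combined t e a b q ?z = 1 + max 0 (\<tau> ?z - (demand b q + placed_before e b q))"
  proof -
    have "?z \<notin> area a" using ar(2) by blast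
    then show ?thesis using A(3)[OF ar(3)] B(3)[OF ar(3)] ar(4) unfolding combined by simp
  qed
  have outside: "combined t e a b q v = 0" if "v \<in> V" "v \<notin> area e" for v
    using that A(3)[of v] B(3)[of v] unfolding ar(1) combined by auto
  have pos: "0 < combined t e a b q v" if "v \<in> area e" for v
    using that in_a in_b at_z A(2)[of v] B(2)[of v] subV unfolding ar(1) by fastforce
  show ?thesis unfolding sound_entry_def
  proof (intro conjI ballI allI impI)
    fix v assume v: "v \<in> V"
    show "0 \<le> combined t e a b q v" using pos[of v] outside[OF v] by fastforce
    show "0 < combined t e a b q v \<longleftrightarrow> v \<in> area e" using pos[of v] outside[OF v] by fastforce
  next
    fix p0 assume p0: "agrees p0 e"
    then have "agrees p0 a" using a unfolding agrees_def by auto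
    from A(4)[OF this] obtain pa where pa: "\<And>u. u \<notin> area a \<Longrightarrow> pa u = p0 u"
      "\<And>l. l \<in> slots \<Longrightarrow> demand a l \<le> earlier pa (area a) (digit a l) (label a l)"
      "\<And>v. v \<in> area a \<Longrightarrow> 1 + cost pa v \<le> t a v" by blast
    \<comment> \<open>This labelling agrees with \<open>b\<close>: slot \<open>q\<close> now holds
      the centre, and the other slots hold vertices outside the area of \<open>a\<close>, where
      \<open>p0\<close> is unchanged.\<close>
    define pz where "pz = pa(?z := label b q)"
    have "agrees pz b" unfolding agrees_def
    proof (intro ballI impI)
      fix l assume l: "l \<in> slots" and "digit b l \<noteq> 0"
      show "pz (digit b l) = label b l"
      proof (cases "l = q")
        case True
        then show ?thesis unfolding pz_def using bq by simp
      next
        case False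
        have "digit e l \<in> bag e" unfolding bag_def using l by blast
        then have "digit e l \<noteq> ?z" "digit e l \<notin> area a" using ar(5) subV by auto
        then show ?thesis unfolding pz_def using bl[OF l False] pa(1) p0 l \<open>digit b l \<noteq> 0\<close>
          unfolding agrees_def by simp
      qed
    qed
    from B(4)[OF this] obtain p where p: "\<And>u. u \<notin> area b \<Longrightarrow> p u = pz u"
      "\<And>l. l \<in> slots \<Longrightarrow> demand b l \<le> earlier p (area b) (digit b l) (label b l)"
      "\<And>v. v \<in> area b \<Longrightarrow> 1 + cost p v \<le> t b v" by blast
    have p_z: "p ?z = label b q" using p(1)[OF ar(4)] unfolding pz_def by simp
    have p_a: "p u = pa u" if "u \<notin> area b" "u \<noteq> ?z" for u
      using p(1)[OF that(1)] that(2) unfolding pz_def by simp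
    have p_out: "p u = p0 u" if "u \<notin> area e" for u
      using that p_a[of u] pa(1)[of u] unfolding ar(1) by auto
    have p_bag: "p u = p0 u" if "u \<in> bag e" for u
      using that ar(5) subV unfolding ar(1) by (intro p_out) (auto simp: ar(1))
    have split: "earlier p (area e) v c =
        earlier p (area a) v c + (of_bool ((v, ?z) \<in> E \<and> p ?z < c) + earlier p (area b) v c)" for v c
      unfolding ar(1) using ar(2) fin earlier_insert[OF fin(2) ar(4)]
      by (subst earlier_union) auto
    have same_a: "earlier p (area a) v c = earlier pa (area a) v c" for v c
      by (rule earlier_cong, rule p_a) (use ar(2) in auto)
    show "\<exists>p. (\<forall>u. u \<notin> area e \<longrightarrow> p u = p0 u) \<and>
        (\<forall>l\<in>slots. demand e l \<le> earlier p (area e) (digit e l) (label e l)) \<and>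
        (\<forall>v\<in>area e. 1 + cost p v \<le> combined t e a b q v)"
    proof (intro exI[of _ p] conjI allI ballI impI)
      show "p u = p0 u" if "u \<notin> area e" for u by (rule p_out[OF that])
    next
      fix l assume l: "l \<in> slots"
      have "demand e l \<le> demand a l + of_bool ((digit e l, ?z) \<in> E \<and> label b q < label e l) +
          (if l = q then 0 else demand b l)" using m l unfolding merges_def by blast
      moreover have "demand a l \<le> earlier p (area a) (digit e l) (label e l)"
        using pa(2)[OF l] a[OF l] same_a by simp
      moreover have "(if l = q then 0 else demand b l) \<le> earlier p (area b) (digit e l) (label e l)"
      proof (cases "l = q")
        case False
        then show ?thesis using p(2)[OF l, unfolded bl[OF l False]] by simp
      qed (simp add: earlier_nonneg)
      ultimately show "demand e l \<le> earlier p (area e) (digit e l) (label e l)"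
        unfolding split p_z by linarith
    next
      fix v assume "v \<in> area e"
      then consider "v \<in> area a" | "v \<in> area b" | "v = ?z" unfolding ar(1) by blast
      then show "1 + cost p v \<le> combined t e a b q v"
      proof cases
        case 1
        \<comment> \<open>All neighbours of a vertex in the area of \<open>a\<close> lie in this
          area or in the bag, and both are disjoint from the component that is labelled
          later.\<close>
        have "earlier p V v c = earlier pa V v c" for c
        proof (rule earlier_cong, rule p_a)
          fix u assume "(v, u) \<in> E"
          from region_closed[OF 1 this] have "u \<in> area a \<union> bag e" unfolding ar(6) .
          then show "u \<notin> area b" "u \<noteq> ?z" using ar(2,5) by auto
        qed
        moreover have "p v = pa v" using 1 ar(2) by (intro p_a) auto
        ultimately have "cost p v = cost pa v" unfolding cost_def by simp
        then show ?thesis using pa(3)[OF 1] in_a[OF 1] by simp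
      next
        case 2
        then show ?thesis using p(3)[OF 2] in_b[OF 2] by simp
      next
        case 3
        \<comment> \<open>\<open>demand b q\<close> bounds the earlier neighbours of the centre
          inside the area of \<open>b\<close>, and \<open>?S\<close> collects those guaranteed by
          the bag. The two sets are disjoint, so their sum is a valid lower bound.\<close>
        let ?S = "{u \<in> V. (?z, u) \<in> E \<and> (\<exists>l\<in>slots. l \<noteq> q \<and> digit e l = u \<and> label e l < label b q)}"
        have S: "u \<in> bag e \<and> p u < label b q \<and> (?z, u) \<in> E \<and> u \<in> V" if "u \<in> ?S" for u
        proof -
          from that obtain l where l: "l \<in> slots" "digit e l = u" "label e l < label b q" by blast
          then have "u \<in> bag e" unfolding bag_def by blast
          moreover have "u \<noteq> 0" using that by auto
          then have "p0 u = label e l" using p0 l unfolding agrees_def by auto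
          ultimately show ?thesis using p_bag[of u] l(3) that by auto
        qed
        have "?S = {u \<in> ?S. (?z, u) \<in> E \<and> p u < label b q}" using S by blast
        then have "placed_before e b q = earlier p ?S ?z (label b q)"
          unfolding placed_before_eq earlier_def by (rule arg_cong)
        moreover have "earlier p (area b \<union> ?S) ?z (label b q) =
            earlier p (area b) ?z (label b q) + earlier p ?S ?z (label b q)"
          using S subV by (intro earlier_union) (auto intro: finite_region)
        moreover have "earlier p (area b \<union> ?S) ?z (label b q) \<le> earlier p V ?z (label b q)"
          using subV by (intro earlier_mono) auto
        moreover have "demand b q \<le> earlier p (area b) ?z (label b q)" using p(2)[OF q] bq by simp
        ultimately have "demand b q + placed_before e b q \<le> earlier p V ?z (label b q)" by linarith
        then show ?thesis unfolding 3 at_z cost_def p_z by simp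
      qed
    qed
  qed
qed

lemma sound_entry_not_fresh:
  assumes t: "sound t" "a \<in> states" and app: "applies t e a b q" and fr: "\<not> fresh t a"
  shows "sound_entry (\<lambda>_. combined t e a b q) e"
proof -
  have ar: "area e = area a" by (rule applies_not_fresh[OF assms])
  have flag: "0 < t a 0" and a: "\<And>l. l \<in> slots \<Longrightarrow> digit a l = digit e l \<and> label a l = label e l"
    and d: "\<And>l. l \<in> slots \<Longrightarrow> demand e l \<le> demand a l"
    using app fr unfolding applies_def by auto
  note A = sound_entryD[OF t flag]
  have combined: "combined t e a b q v = t a v" for v
    unfolding combined_def using fr by simp
  show ?thesis unfolding sound_entry_def combined ar
  proof (intro conjI ballI allI impI)
    fix p0 assume p0: "agrees p0 e"
    then have "agrees p0 a" using a unfolding agrees_def by auto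
    from A(4)[OF this] obtain p where p: "\<And>u. u \<notin> area a \<Longrightarrow> p u = p0 u"
      "\<And>l. l \<in> slots \<Longrightarrow> demand a l \<le> earlier p (area a) (digit a l) (label a l)"
      "\<And>v. v \<in> area a \<Longrightarrow> 1 + cost p v \<le> t a v" by blast
    have "demand e l \<le> earlier p (area a) (digit e l) (label e l)" if "l \<in> slots" for l
      using p(2)[OF that] d[OF that] a[OF that] by simp
    then show "\<exists>p. (\<forall>u. u \<notin> area a \<longrightarrow> p u = p0 u) \<and>
        (\<forall>l\<in>slots. demand e l \<le> earlier p (area a) (digit e l) (label e l)) \<and>
        (\<forall>v\<in>area a. 1 + cost p v \<le> t a v)"
      using p by blast
  qed (use A(1,2) in auto)
qed

lemma relax_sound:
  assumes t: "sound t" and s: "e \<in> states" "a \<in> states" "b \<in> states" "q \<in> slots"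
  shows "sound (relax t e a b q)"
proof (cases "applies t e a b q \<and> (t e 0 \<le> 0 \<or> score (combined t e a b q) < score (t e))")
  case True
  then have relax: "relax t e a b q =
      t(e := (\<lambda>v. if v \<in> {0..<n + 1} then combined t e a b q v else t e v))"
    unfolding relax_def by simp
  have "sound_entry (\<lambda>_. combined t e a b q) e"
    using sound_entry_fresh[OF t s] sound_entry_not_fresh[OF t s(2)] True by blast
  then have "sound_entry (relax t e a b q) e"
    unfolding relax by (subst sound_entry_cong[of _ e "\<lambda>_. combined t e a b q"]) auto
  moreover have "sound_entry (relax t e a b q) e'" if "e' \<noteq> e" "e' \<in> states" "0 < relax t e a b q e' 0" for e'
    using t that sound_entry_cong[of "relax t e a b q" e' t] unfolding sound_def relax by auto
  ultimately show ?thesis unfolding sound_def by metis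
next
  case False
  then have "relax t e a b q = t" unfolding relax_def by (rule if_not_P)
  then show ?thesis using t by simp
qed

text \<open>Only flags and scores are compared: a relaxation may exchange a row for a quite
  different solution with a lower score.\<close>

definition improves :: "(int \<Rightarrow> int \<Rightarrow> int) \<Rightarrow> (int \<Rightarrow> int \<Rightarrow> int) \<Rightarrow> bool" where
  "improves t t' \<longleftrightarrow> (\<forall>e\<in>states. 0 < t e 0 \<longrightarrow> 0 < t' e 0 \<and> score (t' e) \<le> score (t e))"

lemma improves_refl: "improves t t"
  unfolding improves_def by simp

lemma improves_trans: "improves t t' \<Longrightarrow> improves t' t'' \<Longrightarrow> improves t t''"
  unfolding improves_def by (meson order_trans)

lemma combined_flag:
  assumes "applies t e a b q"
  shows "0 < combined t e a b q 0"
  using assms unfolding combined_def applies_def merges_def by (auto split: if_splits)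

lemma score_cong: "(\<And>v. v \<in> V \<Longrightarrow> f v = g v) \<Longrightarrow> score f = score g"
  unfolding score_eq by (rule sum.cong) auto

lemma relax_entry:
  assumes "applies t e a b q" "t e 0 \<le> 0 \<or> score (combined t e a b q) < score (t e)"
  shows "0 < relax t e a b q e 0" "score (relax t e a b q e) = score (combined t e a b q)"
proof -
  have relax: "relax t e a b q e = (\<lambda>v. if v \<in> {0..<n + 1} then combined t e a b q v else t e v)"
    unfolding relax_def using assms by simp
  show "0 < relax t e a b q e 0" unfolding relax using combined_flag[OF assms(1)] n by simp
  show "score (relax t e a b q e) = score (combined t e a b q)"
    unfolding relax by (rule score_cong) auto
qed

lemma relax_improves: "improves t (relax t e a b q)"
  unfolding improves_def
proof (intro ballI impI)
  fix e' assume flag: "0 < t e' 0"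
  show "0 < relax t e a b q e' 0 \<and> score (relax t e a b q e') \<le> score (t e')"
  proof (cases "applies t e a b q \<and> (t e 0 \<le> 0 \<or> score (combined t e a b q) < score (t e))")
    case True
    show ?thesis
    proof (cases "e' = e")
      case True
      then show ?thesis using relax_entry[of t e a b q] flag
          \<open>applies t e a b q \<and> (t e 0 \<le> 0 \<or> score (combined t e a b q) < score (t e))\<close> by auto
    next
      case False
      then have "relax t e a b q e' = t e'" unfolding relax_def by simp
      then show ?thesis using flag by simp
    qed
  next
    case False
    then have "relax t e a b q = t" unfolding relax_def by (rule if_not_P)
    then show ?thesis using flag by simp
  qed
qed

lemma relax_applies:
  assumes "applies t e a b q" "score (combined t e a b q) \<le> s"
  shows "0 < relax t e a b q e 0 \<and> score (relax t e a b q e) \<le> s"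
proof (cases "t e 0 \<le> 0 \<or> score (combined t e a b q) < score (t e)")
  case True
  then show ?thesis using relax_entry[OF assms(1)] assms(2) by simp
next
  case False
  then have "relax t e a b q = t" unfolding relax_def by simp
  then show ?thesis using False assms(2) by simp
qed

definition target :: "(int \<Rightarrow> int) \<Rightarrow> int \<Rightarrow> int" where
  "target P e = (\<Sum>v\<in>area e. 1 + cost P v)"

definition solved :: "(int \<Rightarrow> int \<Rightarrow> int) \<Rightarrow> (int \<Rightarrow> int) \<Rightarrow> int \<Rightarrow> bool" where
  "solved t P e \<longleftrightarrow> 0 < t e 0 \<and> score (t e) \<le> target P e"

lemma solved_improves: "solved t P e \<Longrightarrow> improves t t' \<Longrightarrow> e \<in> states \<Longrightarrow> solved t' P e"
  unfolding solved_def improves_def by (meson order_trans)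

text \<open>The lexicographic order by the size of the area and the number of vertices still to be
  passed, coded as a number; the second component is at most \<open>n\<close>.\<close>

definition rank :: "int \<Rightarrow> int" where
  "rank e = int (card (area e)) * (n + 1) + (n - passed e)"

end

section \<open>Completeness along the strategy\<close>

text \<open>The predicate \<open>ok\<close> holds for the subsets of the bags of a tree decomposition.\<close>

locale labelling_strategy = labelling +
  fixes ok :: "int set \<Rightarrow> bool"
  assumes ok_empty: "ok {}"
    and ok_subset: "ok S \<Longrightarrow> S' \<subseteq> S \<Longrightarrow> ok S'"
    and ok_bound: "ok S \<Longrightarrow> S \<subseteq> V \<and> int (card S) < K"
    and ok_step: "C \<subseteq> V \<Longrightarrow> C \<noteq> {} \<Longrightarrow> connected_within E C \<Longrightarrow> ok (boundary E C) \<Longrightarrow>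
      \<exists>z\<in>C. ok (insert z (boundary E C))"
begin

text \<open>The subproblems that occur when the labelling \<open>P\<close> is dismantled along the
  strategy. The slots hold distinct vertices with their labels in \<open>P\<close>, the components
  that may be split off have boundaries on which the cops can stand, and the demands do not exceed
  what \<open>P\<close> itself provides.\<close>

definition good :: "(int \<Rightarrow> int) \<Rightarrow> int \<Rightarrow> bool" where
  "good P e \<longleftrightarrow>
     (\<forall>l\<in>slots. \<forall>l'\<in>slots. digit e l = digit e l' \<longrightarrow> digit e l \<noteq> 0 \<longrightarrow> l = l') \<and> agrees P e \<and>
     (\<forall>u\<in>V. (centre e = 0 \<or> (centre e, u) \<in> E) \<longrightarrow> u \<notin> bag e \<longrightarrow> ok (boundary E (reach (bag e) u))) \<and>
     (\<forall>l\<in>slots. demand e l \<le> earlier P (area e) (digit e l) (label e l))"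

lemma goodD:
  assumes "good P e"
  shows "l \<in> slots \<Longrightarrow> l' \<in> slots \<Longrightarrow> digit e l = digit e l' \<Longrightarrow> digit e l \<noteq> 0 \<Longrightarrow> l = l'"
    "l \<in> slots \<Longrightarrow> digit e l \<noteq> 0 \<Longrightarrow> P (digit e l) = label e l"
    "u \<in> V \<Longrightarrow> centre e = 0 \<or> (centre e, u) \<in> E \<Longrightarrow> u \<notin> bag e \<Longrightarrow> ok (boundary E (reach (bag e) u))"
    "l \<in> slots \<Longrightarrow> demand e l \<le> earlier P (area e) (digit e l) (label e l)"
  using assms unfolding good_def agrees_def by blast+

lemma good_previous:
  assumes e: "good P e" "passed e < n"
  defines "u \<equiv> passed e + 1"
  obtains a where "a \<in> states" "good P a" "rank a < rank e" "passed a = u" "centre a = centre e"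
    "\<And>l. l \<in> slots \<Longrightarrow> digit a l = digit e l \<and> label a l = label e l" "bag a = bag e"
    "\<And>l. l \<in> slots \<Longrightarrow> demand a l = min (demand e l) (earlier P (area a) (digit e l) (label e l))"
proof -
  let ?R = "region (bag e) (centre e) u"
  \<comment> \<open>Taking the minimum with the old demand keeps the new one within a digit, and
    \<open>P\<close> still meets it in the smaller region.\<close>
  let ?d = "\<lambda>l. min (demand e l) (earlier P ?R (digit e l) (label e l))"
  have u: "u \<in> {0..n}" "0 \<le> passed e" unfolding u_def using e(2) digit_bounds(1)[of e "3 * K + 1"] by auto
  have xpd: "digit e l \<in> {0..n} \<and> label e l \<in> {0..n} \<and> ?d l \<in> {0..n}" for l
    using digit_bounds[of e l] digit_bounds[of e "K + l"] digit_bounds[of e "2 * K + l"]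
      earlier_nonneg[of P ?R "digit e l" "label e l"] by simp
  have "centre e \<in> {0..n}" using digit_bounds by simp
  from state_exists[of "digit e" "label e" ?d, OF xpd this u(1)] obtain a where a: "a \<in> states"
    "\<And>l. l \<in> slots \<Longrightarrow> digit a l = digit e l \<and> label a l = label e l \<and> demand a l = ?d l"
    "centre a = centre e" "passed a = u"
    by blast
  have bag: "bag a = bag e" by (rule bag_cong) (use a(2) in blast)
  have area: "area a = ?R" unfolding bag a(3,4) ..
  have sub: "?R \<subseteq> area e" using region_Suc[OF u(2) e(2), of "bag e" "centre e"] unfolding u_def by auto
  have good: "good P a" unfolding good_def
  proof (intro conjI ballI impI)
    show "l = l'" if "l \<in> slots" "l' \<in> slots" "digit a l = digit a l'" "digit a l \<noteq> 0" for l l'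
      using goodD(1)[OF e(1) that(1,2)] a(2)[OF that(1)] a(2)[OF that(2)] that(3,4) by simp
    show "agrees P a" unfolding agrees_def using a(2) goodD(2)[OF e(1)] by simp
    show "ok (boundary E (reach (bag a) v))"
      if "v \<in> V" "centre a = 0 \<or> (centre a, v) \<in> E" "v \<notin> bag a" for v
      using goodD(3)[OF e(1), of v] that unfolding bag a(3) by blast
    show "demand a l \<le> earlier P (area a) (digit a l) (label a l)" if "l \<in> slots" for l
      using a(2)[OF that] unfolding area by simp
  qed
  have rank: "rank a < rank e"
  proof -
    have "card ?R \<le> card (area e)" using sub by (rule card_mono[OF finite_region])
    then have "int (card ?R) * (n + 1) \<le> int (card (area e)) * (n + 1)"
      using n by (intro mult_right_mono) auto
    then show ?thesis unfolding rank_def unfolding area unfolding a(4) u_def by simp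
  qed
  show ?thesis
  proof (rule that[of a])
    show "demand a l = min (demand e l) (earlier P (area a) (digit e l) (label e l))" if "l \<in> slots" for l
      using a(2)[OF that] unfolding area by simp
    show "digit a l = digit e l \<and> label a l = label e l" if "l \<in> slots" for l
      using a(2)[OF that] by simp
    show "a \<in> states" "passed a = u" "centre a = centre e" by (rule a)+
  qed (rule good rank bag)+
qed

text \<open>The strategy supplies the next cop \<open>z\<close> inside the component. It is placed
  in a slot \<open>q\<close> that holds no boundary vertex; the boundary stays guarded, so the
  component does not grow when slot \<open>q\<close> is overwritten.\<close>

lemma good_component:
  assumes e: "good P e" and u: "u \<in> V" "u \<notin> bag e" "centre e = 0 \<or> (centre e, u) \<in> E"
    and P: "\<And>v. v \<in> V \<Longrightarrow> P v \<in> {0..n}"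
  obtains b q where "b \<in> states" "q \<in> slots" "good P b" "passed b = 0" "centre b \<in> V"
    "reach (bag e) u = insert (centre b) (area b)" "centre b \<notin> area b"
    "bag b = insert (centre b) (digit e ` (slots - {q}))"
    "boundary E (reach (bag e) u) \<subseteq> digit e ` (slots - {q})" "digit e q \<notin> boundary E (reach (bag e) u)"
    "digit b q = centre b" "label b q = P (centre b)"
    "\<And>l. l \<in> slots \<Longrightarrow> l \<noteq> q \<Longrightarrow> digit b l = digit e l \<and> label b l = label e l"
    "\<And>l. l \<in> slots \<Longrightarrow> demand b l = earlier P (area b) (digit b l) (label b l)"
proof -
  let ?C = "reach (bag e) u"
  have C: "?C \<subseteq> V" "?C \<inter> bag e = {}" "u \<in> ?C"
    using reach_inside[OF u(1,2)] reach_refl by simp_all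
  have ok: "ok (boundary E ?C)" by (rule goodD(3)[OF e u(1,3,2)])
  obtain z where z: "z \<in> ?C" "ok (insert z (boundary E ?C))"
    using ok_step[OF C(1) _ reach_connected[OF u(2)] ok] C(3) by blast
  have bdV: "boundary E ?C \<subseteq> V" and bdK: "int (card (boundary E ?C)) < K" using ok_bound[OF ok] by auto
  \<comment> \<open>Pigeonhole: otherwise all slots would hold boundary vertices, hence nonzero and
    pairwise distinct ones, but the boundary has fewer than \<open>K\<close> vertices.\<close>
  have "\<exists>q\<in>slots. digit e q \<notin> boundary E ?C"
  proof (rule ccontr)
    assume "\<not> ?thesis"
    then have all: "digit e l \<in> boundary E ?C" if "l \<in> slots" for l using that by blast
    then have "digit e l \<noteq> 0" if "l \<in> slots" for l using bdV that by fastforce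
    then have "inj_on (digit e) slots" by (intro inj_onI) (use goodD(1)[OF e] in blast)
    then have "card slots = card (bag e)" unfolding bag_def by (simp add: card_image)
    also have "\<dots> \<le> card (boundary E ?C)"
      using all finite_subset[OF bdV] unfolding bag_def by (intro card_mono) auto
    finally show False using bdK K by simp
  qed
  then obtain q where q: "q \<in> slots" "digit e q \<notin> boundary E ?C" by blast
  let ?X = "digit e ` (slots - {q})"
  have X: "?X \<subseteq> bag e" unfolding bag_def by auto
  have bdX: "boundary E ?C \<subseteq> ?X"
  proof
    fix x assume x: "x \<in> boundary E ?C"
    then have "x \<in> bag e" using boundary_reach[OF u(2)] by blast
    then obtain l where l: "l \<in> slots" "x = digit e l" unfolding bag_def by blast
    then have "l \<noteq> q" using q(2) x by blast
    then show "x \<in> ?X" using l by blast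
  qed
  have zV: "z \<in> V" and zX: "z \<notin> bag e" using z(1) C by auto
  let ?R = "region (insert z ?X) z 0"
  \<comment> \<open>Leaving \<open>?C\<close> is only possible through its boundary, which is still
    contained in \<open>?X\<close>.\<close>
  have "reach ?X z = ?C"
  proof
    show "?C \<subseteq> reach ?X z" using reach_eq[OF z(1) u(2)] reach_antimono[OF X, of z] by simp
    show "reach ?X z \<subseteq> ?C"
    proof
      fix v assume "v \<in> reach ?X z"
      then show "v \<in> ?C"
      proof (induction rule: reach_induct)
        case (step v w)
        then show ?case using bdX unfolding boundary_def by blast
      qed (rule z(1))
    qed
  qed
  then have CR: "?C = insert z ?R" using reach_region[of z ?X] zV zX X by auto
  have Rz: "z \<notin> ?R" and RV: "?R \<subseteq> V" using region_subset[of "insert z ?X" z 0] by auto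
  let ?x = "\<lambda>l. if l = q then z else digit e l" and ?p = "\<lambda>l. if l = q then P z else label e l"
  let ?d = "\<lambda>l. earlier P ?R (?x l) (?p l)"
  have xpd: "?x l \<in> {0..n} \<and> ?p l \<in> {0..n} \<and> ?d l \<in> {0..n}" for l
    using digit_bounds[of e l] digit_bounds[of e "K + l"] earlier_nonneg earlier_le[OF RV] zV P[OF zV] by simp
  have z0: "z \<in> {0..n}" "0 \<in> {0..n}" using zV n by auto
  from state_exists[of ?x ?p ?d, OF xpd z0] obtain b where b: "b \<in> states"
    "\<And>l. l \<in> slots \<Longrightarrow> digit b l = ?x l \<and> label b l = ?p l \<and> demand b l = ?d l"
    "centre b = z" "passed b = 0"
    by blast
  have "bag b = ?x ` insert q (slots - {q})"
    unfolding bag_def insert_Diff[OF q(1)] by (rule image_cong) (use b(2) in auto)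
  also have "\<dots> = insert z (?x ` (slots - {q}))" by (simp only: image_insert simp_thms if_True)
  also have "?x ` (slots - {q}) = ?X" by (rule image_cong) auto
  finally have bag: "bag b = insert z ?X" .
  have area: "area b = ?R" unfolding bag b(3,4) ..
  have "good P b" unfolding good_def
  proof (intro conjI ballI impI)
    fix l l' assume l: "l \<in> slots" "l' \<in> slots" "digit b l = digit b l'" "digit b l \<noteq> 0"
    have "digit e k \<noteq> z" if "k \<in> slots" for k using zX that unfolding bag_def by blast
    then show "l = l'" using l b(2)[OF l(1)] b(2)[OF l(2)] goodD(1)[OF e l(1,2)]
      by (auto split: if_splits)
  next
    show "agrees P b" unfolding agrees_def using b(2) goodD(2)[OF e] by simp
  next
    fix v assume v: "v \<in> V" "centre b = 0 \<or> (centre b, v) \<in> E" "v \<notin> bag b"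
    have "(z, v) \<in> E" using v(2) zV unfolding b(3) by auto
    then have "reach (bag b) v \<subseteq> ?R" unfolding bag region_def using v(1,3) unfolding bag by auto
    then have sub: "reach (bag b) v \<subseteq> ?C" using CR by blast
    \<comment> \<open>A bag vertex next to a part of \<open>?C\<close> lies outside
      \<open>?C\<close>, hence on its boundary. So the new boundaries are guarded by the old
      boundary and \<open>z\<close>.\<close>
    have "boundary E (reach (bag b) v) \<subseteq> insert z (boundary E ?C)"
    proof
      fix w assume w: "w \<in> boundary E (reach (bag b) v)"
      then have "w \<in> insert z ?X" using boundary_reach[OF v(3)] unfolding bag by blast
      moreover have "w \<in> boundary E ?C" if "w \<in> ?X"
        using w sub that X C(2) unfolding boundary_def by blast
      ultimately show "w \<in> insert z (boundary E ?C)" by blast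
    qed
    with z(2) show "ok (boundary E (reach (bag b) v))" by (rule ok_subset)
  next
    show "demand b l \<le> earlier P (area b) (digit b l) (label b l)" if "l \<in> slots" for l
      using b(2)[OF that] unfolding area by simp
  qed
  note good = this
  show ?thesis
  proof (rule that[of b q])
    show "digit b q = centre b" "label b q = P (centre b)" using b(2)[OF q(1)] unfolding b(3) by simp_all
    show "digit b l = digit e l \<and> label b l = label e l" if "l \<in> slots" "l \<noteq> q" for l
      using b(2)[OF that(1)] that(2) by simp
    show "demand b l = earlier P (area b) (digit b l) (label b l)" if "l \<in> slots" for l
      using b(2)[OF that] unfolding area by simp
    show "centre b \<in> V" "reach (bag e) u = insert (centre b) (area b)" "centre b \<notin> area b"
      "bag b = insert (centre b) ?X" using zV CR Rz unfolding area unfolding bag b(3) by simp_all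
    show "b \<in> states" "passed b = 0" by (rule b)+
    show "q \<in> slots" "digit e q \<notin> boundary E ?C" by (rule q)+
  qed (rule good bdX)+
qed

text \<open>Resetting \<open>passed\<close> to 0 raises the second component by at most
  \<open>n\<close>, while losing \<open>z\<close> from the area lowers the first one, which weighs
  \<open>n + 1\<close>.\<close>

lemma rank_component:
  assumes "area e = A \<union> insert z (area b)" "A \<inter> insert z (area b) = {}" "z \<notin> area b" "passed b = 0" "passed e < n"
  shows "rank b < rank e"
proof -
  have "insert z (area b) \<subseteq> area e" using assms(1) by blast
  from card_mono[OF finite_region this] have "int (card (area b)) + 1 \<le> int (card (area e))"
    using assms(3) finite_region by simp
  then have "(int (card (area b)) + 1) * (n + 1) \<le> int (card (area e)) * (n + 1)"
    using n by (intro mult_right_mono) auto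
  then show ?thesis unfolding rank_def using assms(4,5) by (simp add: algebra_simps)
qed

text \<open>The states \<open>a\<close>, \<open>b\<close> and the slot \<open>q\<close> depend on
  \<open>P\<close> and \<open>e\<close> only; the conclusion then holds for every sound table in
  which \<open>a\<close> and \<open>b\<close> are solved. This lets the relaxation happen at any
  moment of a round.\<close>

lemma good_step:
  assumes e: "e \<in> states" "good P e" "passed e < n" and P: "\<And>v. v \<in> V \<Longrightarrow> P v \<in> {0..n}"
  obtains a b q where "a \<in> states" "b \<in> states" "q \<in> slots" "good P a" "good P b"
    "rank a < rank e" "rank b < rank e"
    "\<And>t. sound t \<Longrightarrow> solved t P a \<Longrightarrow> solved t P b \<Longrightarrow>
       applies t e a b q \<and> score (combined t e a b q) \<le> target P e"
proof -
  obtain a where a: "a \<in> states" "good P a" "rank a < rank e" "passed a = passed e + 1" "centre a = centre e"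
    "\<And>l. l \<in> slots \<Longrightarrow> digit a l = digit e l \<and> label a l = label e l" "bag a = bag e"
    "\<And>l. l \<in> slots \<Longrightarrow> demand a l = min (demand e l) (earlier P (area a) (digit e l) (label e l))"
    using good_previous[OF e(2,3)] by metis
  let ?u = "passed a"
  have j: "0 \<le> passed e" by (rule digit_bounds)
  have u: "?u \<in> V" using j e(3) a(4) by simp
  show ?thesis
  proof (cases "(centre e = 0 \<or> (centre e, ?u) \<in> E) \<and> ?u \<notin> bag e \<and> ?u \<notin> area a")
    case False
    have area: "area e = area a"
      using False region_Suc[OF j e(3), of "bag e" "centre e"] region_reach[of ?u "bag e" "centre e" ?u]
      unfolding a(4,5,7) by auto
    have "applies t e a a 0 \<and> score (combined t e a a 0) \<le> target P e" if t: "sound t" "solved t P a" for t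
    proof -
      have flag: "0 < t a 0" using t(2) unfolding solved_def by simp
      have fr: "\<not> fresh t a" using fresh_iff[OF t(1) a(1) flag a(4)] False a(5,7) by simp
      have "demand e l \<le> demand a l" if "l \<in> slots" for l
        using a(8)[OF that] goodD(4)[OF e(2) that] unfolding area by simp
      then have "applies t e a a 0" unfolding applies_def using a(4-6) flag fr by simp
      moreover have "combined t e a a 0 = t a" unfolding combined_def using fr by simp
      moreover have "target P e = target P a" unfolding target_def area ..
      ultimately show ?thesis using t(2) unfolding solved_def by simp
    qed
    \<comment> \<open>When no component is added, only the row of \<open>a\<close> is consulted;
      \<open>a\<close> and slot 0, which exists as \<open>1 <= K\<close>, fill the other two
      places.\<close>
    then show ?thesis using that[of a a 0] a(1-3) K by simp
  next
    case True
    then have u': "?u \<notin> bag e" "centre e = 0 \<or> (centre e, ?u) \<in> E" by auto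
    let ?C = "reach (bag e) ?u"
    show ?thesis
    proof (rule good_component[OF e(2) u u' P])
      fix b q assume b: "b \<in> states" "q \<in> slots" "good P b" "passed b = 0" "centre b \<in> V"
        "?C = insert (centre b) (area b)" "centre b \<notin> area b"
        "bag b = insert (centre b) (digit e ` (slots - {q}))"
        "boundary E ?C \<subseteq> digit e ` (slots - {q})" "digit e q \<notin> boundary E ?C"
        "digit b q = centre b" "label b q = P (centre b)"
        "\<And>l. l \<in> slots \<Longrightarrow> l \<noteq> q \<Longrightarrow> digit b l = digit e l \<and> label b l = label e l"
        "\<And>l. l \<in> slots \<Longrightarrow> demand b l = earlier P (area b) (digit b l) (label b l)"
      let ?z = "centre b"
      have C: "?C \<inter> bag e = {}" using reach_inside[OF u u'(1)] by simp
      have area: "area e = area a \<union> insert ?z (area b)"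
        using region_Suc[OF j e(3), of "bag e" "centre e"] True b(6) unfolding a(4,5,7) by simp
      have disj: "area a \<inter> insert ?z (area b) = {}"
        using region_disjoint[OF u'(1), of "centre e" "passed a"] True b(6) unfolding a(5,7) by simp
      have closed: "w \<in> ?C \<union> digit e ` (slots - {q})" if "v \<in> ?C" "(v, w) \<in> E" for v w
        using that b(9) unfolding boundary_def by blast
      \<comment> \<open>The evicted vertex is in the bag but not on the boundary, so it has no
        neighbours in the component. Its demand loses nothing when it disappears from the bag of
        \<open>b\<close>.\<close>
      have q_isolated: "(digit e q, v) \<notin> E" if "v \<in> ?C" for v
      proof
        assume "(digit e q, v) \<in> E"
        then have "(v, digit e q) \<in> E" by (rule sym)
        moreover have "digit e q \<in> bag e" using b(2) unfolding bag_def by blast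
        ultimately show False using that b(10) C unfolding boundary_def by blast
      qed
      have earlier_e: "earlier P (area e) v c = earlier P (area a) v c +
          (of_bool ((v, ?z) \<in> E \<and> P ?z < c) + earlier P (area b) v c)" for v c
        unfolding area using disj finite_region earlier_insert[OF finite_region b(7)]
        by (subst earlier_union) auto
      have demand: "demand e l \<le> demand a l + of_bool ((digit e l, ?z) \<in> E \<and> label b q < label e l) +
          (if l = q then 0 else demand b l)" if l: "l \<in> slots" for l
      proof -
        have "demand e l \<le> earlier P (area a) (digit e l) (label e l) +
            (of_bool ((digit e l, ?z) \<in> E \<and> P ?z < label e l) + earlier P (area b) (digit e l) (label e l))"
          using goodD(4)[OF e(2) l] unfolding earlier_e .
        moreover have "earlier P (area b) (digit e l) (label e l) = (if l = q then 0 else demand b l)"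
        proof (cases "l = q")
          case True
          have "{u \<in> area b. (digit e q, u) \<in> E \<and> P u < label e q} = {}"
            using q_isolated b(6) by blast
          then have "earlier P (area b) (digit e q) (label e q) = 0"
            by (simp only: earlier_def card.empty of_nat_0)
          then show ?thesis using True by simp
        next
          case False
          then show ?thesis using b(13)[OF l False] b(14)[OF l] by simp
        qed
        moreover have "0 \<le> (if l = q then 0 else demand b l)" using digit_bounds by simp
        moreover have "demand a l = demand e l \<or> demand a l = earlier P (area a) (digit e l) (label e l)"
          unfolding a(8)[OF l] by linarith
        moreover have "(0 :: int) \<le> of_bool ((digit e l, ?z) \<in> E \<and> P ?z < label e l)" by simp
        ultimately show ?thesis unfolding b(12) by linarith
      qed
      \<comment> \<open>The converse of the bound used for soundness: a neighbour of the centre lies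
        in the area of \<open>b\<close> or in a slot other than \<open>q\<close>, as the component
        is closed up to its boundary and the graph has no loops.\<close>
      have earlier_z: "earlier P V ?z (P ?z) \<le> demand b q + placed_before e b q"
      proof -
        let ?S = "{u \<in> V. (?z, u) \<in> E \<and> (\<exists>l\<in>slots. l \<noteq> q \<and> digit e l = u \<and> label e l < label b q)}"
        let ?T = "{u \<in> area b. (?z, u) \<in> E \<and> P u < P ?z}"
        have "{u \<in> V. (?z, u) \<in> E \<and> P u < P ?z} \<subseteq> ?T \<union> ?S"
        proof
          fix w assume w: "w \<in> {u \<in> V. (?z, u) \<in> E \<and> P u < P ?z}"
          then have "w \<in> ?C \<union> digit e ` (slots - {q})" using closed[of ?z w] b(6) by blast
          then consider "w \<in> ?C" | l where "l \<in> slots" "l \<noteq> q" "w = digit e l" by blast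
          then show "w \<in> ?T \<union> ?S"
          proof cases
            case 1
            moreover have "w \<noteq> ?z" using w irrefl[of ?z] by auto
            ultimately have "w \<in> area b" using b(6) by blast
            then show ?thesis using w by blast
          next
            case 2
            moreover have "label e l = P w" using goodD(2)[OF e(2) 2(1)] 2(3) w by simp
            ultimately show ?thesis using w unfolding b(12) by auto
          qed
        qed
        then have "card {u \<in> V. (?z, u) \<in> E \<and> P u < P ?z} \<le> card (?T \<union> ?S)"
          using finite_region by (intro card_mono) auto
        also have "\<dots> \<le> card ?T + card ?S" by (rule card_Un_le)
        finally show ?thesis
          unfolding earlier_def placed_before_eq b(14)[OF b(2)] b(11,12) by simp
      qed
      have "applies t e a b q \<and> score (combined t e a b q) \<le> target P e"
        if t: "sound t" "solved t P a" "solved t P b" for t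
      proof -
        have flag: "0 < t a 0" "0 < t b 0" using t(2,3) unfolding solved_def by auto
        have fr: "fresh t a" using fresh_iff[OF t(1) a(1) flag(1) a(4)] True a(5,7) by simp
        have slot: "digit e l \<in> bag e" if "l \<in> slots" for l unfolding bag_def using that by blast
        have "merges t e a b q" unfolding merges_def
        proof (intro conjI ballI)
          show "0 < t b 0" by fact
          show "passed b = 0" by fact
          show "1 \<le> centre b" using b(5) by simp
          show "digit e l \<noteq> centre b" if "l \<in> slots" for l using slot[OF that] C b(6) by auto
          show "if l = q then digit b l = centre b else digit b l = digit e l \<and> label b l = label e l"
            if "l \<in> slots" for l using b(11) b(13)[OF that] by simp
          show "demand e l \<le> demand a l + of_bool ((digit e l, ?z) \<in> E \<and> label b q < label e l) +
            (if l = q then 0 else demand b l)" if "l \<in> slots" for l by (rule demand[OF that])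
          have "digit e q \<notin> area b" using slot[OF b(2)] C b(6) by auto
          then show "digit e q = 0 \<or> t b (digit e q) = 0"
          proof (cases "digit e q \<in> V")
            case True
            then show ?thesis using sound_entryD(3)[OF t(1) b(1) flag(2)] \<open>digit e q \<notin> area b\<close> by blast
          next
            case False
            then show ?thesis using digit_bounds[of e q] by auto
          qed
          have "?u \<in> insert ?z (area b)" using reach_refl[of ?u "bag e"] b(6) by simp
          then show "?u = ?z \<or> 0 < t b ?u"
            using sound_entryD(2)[OF t(1) b(1) flag(2) u] by blast
        qed
        then have app: "applies t e a b q" unfolding applies_def using a(4-6) flag fr by simp
        let ?c = "1 + max 0 (\<tau> ?z - (demand b q + placed_before e b q))"
        have "score (combined t e a b q) = (\<Sum>v\<in>V. t a v + (t b v + (if v = ?z then ?c else 0)))"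
          unfolding score_eq combined_def using fr by (intro sum.cong) auto
        also have "\<dots> = score (t a) + (score (t b) + ?c)"
          unfolding score_eq sum.distrib using b(5) by simp
        also have "\<dots> \<le> target P a + (target P b + (1 + cost P ?z))"
          using t(2,3) earlier_z unfolding solved_def cost_def by (intro add_mono) auto
        also have "\<dots> = target P e"
          unfolding target_def area using disj finite_region b(7)
          by (subst sum.union_disjoint) auto
        finally show ?thesis using app by blast
      qed
      then show ?thesis
        using that[of a b q] a(1-3) b(1-3) rank_component[OF area disj b(7,4) e(3)] by blast
    qed
  qed
qed

text \<open>As in the Bellman-Ford algorithm, each round settles at least one more rank. The premise
  \<open>sweep\<close> reflects that a round updates the table in place: a relaxation is applied to
  some intermediate table that is at least as good as the one at the start of the round.\<close>

lemma solved_after_rounds: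
  assumes sound: "\<And>r. sound (T r)"
    and init: "\<And>e. e \<in> states \<Longrightarrow> passed e = n \<Longrightarrow> (\<And>l. l \<in> slots \<Longrightarrow> demand e l \<le> 0) \<Longrightarrow>
      0 < T 0 e 0 \<and> score (T 0 e) \<le> 0"
    and mono: "\<And>r. improves (T r) (T (Suc r))"
    and sweep: "\<And>r e a b q. e \<in> states \<Longrightarrow> a \<in> states \<Longrightarrow> b \<in> states \<Longrightarrow> q \<in> slots \<Longrightarrow>
      \<exists>t. sound t \<and> improves (T r) t \<and> improves (relax t e a b q) (T (Suc r))"
    and P: "\<And>v. v \<in> V \<Longrightarrow> P v \<in> {0..n}" and e: "e \<in> states" "good P e" "rank e < int r"
  shows "solved (T r) P e"
  using e
proof (induction r arbitrary: e)
  case 0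
  then show ?case unfolding rank_def using n digit_bounds(2)[of e "3 * K + 1"]
    by (smt (verit) mult_nonneg_nonneg of_nat_0 of_nat_0_le_iff)
next
  case (Suc r)
  show ?case
  proof (cases "passed e < n")
    case False
    then have pe: "passed e = n" using digit_bounds(2)[of e "3 * K + 1"] by simp
    then have area: "area e = {}" unfolding region_def by auto
    have "demand e l \<le> 0" if "l \<in> slots" for l
      using goodD(4)[OF Suc.prems(2) that] unfolding area earlier_def by simp
    then have "solved (T 0) P e"
      using init[OF Suc.prems(1) pe] unfolding solved_def target_def area by simp
    moreover have "improves (T 0) (T r)" for r
      by (induction r) (auto intro: improves_refl improves_trans mono)
    ultimately show ?thesis using solved_improves Suc.prems(1) by blast
  next
    case True
    obtain a b q where s: "a \<in> states" "b \<in> states" "q \<in> slots" "good P a" "good P b"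
      "rank a < rank e" "rank b < rank e"
      and step: "\<And>t. sound t \<Longrightarrow> solved t P a \<Longrightarrow> solved t P b \<Longrightarrow>
         applies t e a b q \<and> score (combined t e a b q) \<le> target P e"
      using good_step[OF Suc.prems(1,2) True P] by metis
    have "solved (T r) P a" "solved (T r) P b" using Suc.IH[OF s(1,4)] Suc.IH[OF s(2,5)] s(6,7) Suc.prems(3) by auto
    moreover obtain t where t: "sound t" "improves (T r) t" "improves (relax t e a b q) (T (Suc r))"
      using sweep[OF Suc.prems(1) s(1,2,3)] by blast
    ultimately have "solved t P a" "solved t P b" using solved_improves s(1,2) by blast+
    with step[OF t(1)] have "solved (relax t e a b q) P e"
      using relax_applies unfolding solved_def by blast
    then show ?thesis using t(3) Suc.prems(1) by (rule solved_improves)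
  qed
qed

text \<open>All digits of the number 0 vanish: no vertex is placed, every vertex is eligible, none
  is passed and nothing is demanded. Its bag is \<open>{0}\<close>, which contains no vertex, so the
  task is to label the whole graph.\<close>

lemma
  shows root_state: "0 \<in> states" and root_area: "area 0 = V" and root_good: "good P 0"
    and root_rank: "rank 0 = n * (n + 1) + n"
proof -
  have d: "digit 0 i = 0" for i unfolding digit_def by simp
  show "0 \<in> states" unfolding states_def using n by simp
  have "0 \<in> slots" using K by simp
  then have bag: "bag 0 = {0}" unfolding bag_def d by (rule image_constant)
  show area: "area 0 = V"
  proof
    show "area 0 \<subseteq> V" using region_subset by blast
    show "V \<subseteq> area 0" unfolding region_def bag d using reach_refl by fastforce
  qed
  show "rank 0 = n * (n + 1) + n" unfolding rank_def unfolding area unfolding d using n by simp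
  have "boundary E (reach {0} u) = {}" if "u \<in> V" for u
  proof -
    have "boundary E (reach {0} u) \<subseteq> {0}" by (rule boundary_reach) (use that in auto)
    moreover have "0 \<notin> boundary E (reach {0} u)" unfolding boundary_def using dom by fastforce
    ultimately show ?thesis by blast
  qed
  then show "good P 0" unfolding good_def bag agrees_def d using ok_empty earlier_nonneg by auto
qed

end

section \<open>The program\<close>

text \<open>Memory layout: the cells -1, -2, -3 and -4 hold the number of states, \<open>K\<close>, \<open>3 * K + 2\<close> and
  \<open>n + 1\<close>, and cell \<open>-5 - i\<close> holds \<open>(n + 1) ^ i\<close>. If the vertices are numbered from 1, then the input
  format provides the threshold of \<open>v\<close> in cell \<open>v\<close> and the adjacency of \<open>u\<close> and \<open>v\<close> in cell
  \<open>u * n + v\<close>. The table follows the input. The guard in \<open>put\<close> protects the loop bounds.\<close>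

definition put :: "int \<Rightarrow> int \<Rightarrow> (int \<Rightarrow> int) \<Rightarrow> int \<Rightarrow> int" where
  "put a x m = (if 0 < a \<or> a < -4 then m(a := x) else m)"

lemma put_bound_cells: "c \<in> bound_cells \<Longrightarrow> put a x m c = m c"
  unfolding put_def by auto

text \<open>The machine only adds, and loops are bounded by cells. So \<open>x\<close> is added in
  the first \<open>y\<close> of as many rounds as there are states; this is the product if
  \<open>y\<close> does not exceed that number.\<close>

definition mul_code :: "int \<Rightarrow> int \<Rightarrow> (int \<Rightarrow> int) \<Rightarrow> int" where
  "mul_code x y m = (\<Sum>i\<in>{0..<m (-1)}. if i < y then x else 0)"

definition div_code :: "int \<Rightarrow> int \<Rightarrow> (int \<Rightarrow> int) \<Rightarrow> int" where
  "div_code x y m = (\<Sum>i\<in>{0..<m (-1)}. of_bool (mul_code y (i + 1) m \<le> x))"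

definition digit_code :: "int \<Rightarrow> int \<Rightarrow> (int \<Rightarrow> int) \<Rightarrow> int" where
  "digit_code e i m = div_code e (m (-5 - i)) m -
     mul_code (m (-4)) (div_code (div_code e (m (-5 - i)) m) (m (-4)) m) m"

text \<open>The range tests are essential: with the digit 0 for \<open>u\<close> or
  \<open>v\<close>, the address would be that of a threshold or of another pair of vertices.\<close>

definition edge_code :: "int \<Rightarrow> int \<Rightarrow> (int \<Rightarrow> int) \<Rightarrow> bool" where
  "edge_code u v m \<longleftrightarrow> 1 \<le> u \<and> u \<le> m 0 \<and> 1 \<le> v \<and> v \<le> m 0 \<and> m (mul_code u (m 0) m + v) = 1"

definition address_code :: "int \<Rightarrow> int \<Rightarrow> (int \<Rightarrow> int) \<Rightarrow> int" where
  "address_code e v m = mul_code (m 0) (m 0) m + m 0 + 1 + mul_code (m (-4)) e m + v"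

definition table_code :: "int \<Rightarrow> int \<Rightarrow> (int \<Rightarrow> int) \<Rightarrow> int" where
  "table_code e v m = m (address_code e v m)"

abbreviation label_code :: "int \<Rightarrow> int \<Rightarrow> (int \<Rightarrow> int) \<Rightarrow> int" where
  "label_code e l m \<equiv> digit_code e (m (-2) + l) m"
abbreviation demand_code :: "int \<Rightarrow> int \<Rightarrow> (int \<Rightarrow> int) \<Rightarrow> int" where
  "demand_code e l m \<equiv> digit_code e (m (-2) + m (-2) + l) m"
abbreviation centre_code :: "int \<Rightarrow> (int \<Rightarrow> int) \<Rightarrow> int" where
  "centre_code e m \<equiv> digit_code e (m (-3) - 2) m"
abbreviation passed_code :: "int \<Rightarrow> (int \<Rightarrow> int) \<Rightarrow> int" where
  "passed_code e m \<equiv> digit_code e (m (-3) - 1) m"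

text \<open>From here on the code repeats the abstract definitions in the forms covered by
  \<open>entry_intros\<close>; for instance, a conditional between propositions becomes a pair of
  implications.\<close>

definition fresh_code :: "int \<Rightarrow> (int \<Rightarrow> int) \<Rightarrow> bool" where
  "fresh_code a m \<longleftrightarrow> (centre_code a m = 0 \<or> edge_code (centre_code a m) (passed_code a m) m) \<and>
     (\<forall>l\<in>{0..<m (-2)}. \<not> digit_code a l m = passed_code a m) \<and> table_code a (passed_code a m) m = 0"

definition merges_code :: "int \<Rightarrow> int \<Rightarrow> int \<Rightarrow> int \<Rightarrow> (int \<Rightarrow> int) \<Rightarrow> bool" where
  "merges_code e a b q m \<longleftrightarrow> 0 < table_code b 0 m \<and> passed_code b m = 0 \<and> 1 \<le> centre_code b m \<and>
     (\<forall>l\<in>{0..<m (-2)}. \<not> digit_code e l m = centre_code b m \<and>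
        (l = q \<longrightarrow> digit_code b l m = centre_code b m) \<and>
        (\<not> l = q \<longrightarrow> digit_code b l m = digit_code e l m \<and> label_code b l m = label_code e l m) \<and>
        demand_code e l m \<le> demand_code a l m +
          of_bool (edge_code (digit_code e l m) (centre_code b m) m \<and> label_code b q m < label_code e l m) +
          (if l = q then 0 else demand_code b l m)) \<and>
     (digit_code e q m = 0 \<or> table_code b (digit_code e q m) m = 0) \<and>
     (passed_code a m = centre_code b m \<or> 0 < table_code b (passed_code a m) m)"

definition applies_code :: "int \<Rightarrow> int \<Rightarrow> int \<Rightarrow> int \<Rightarrow> (int \<Rightarrow> int) \<Rightarrow> bool" where
  "applies_code e a b q m \<longleftrightarrow> passed_code a m = passed_code e m + 1 \<and> centre_code a m = centre_code e m \<and>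
     (\<forall>l\<in>{0..<m (-2)}. digit_code a l m = digit_code e l m \<and> label_code a l m = label_code e l m) \<and>
     0 < table_code a 0 m \<and> (fresh_code a m \<longrightarrow> merges_code e a b q m) \<and>
     (\<not> fresh_code a m \<longrightarrow> (\<forall>l\<in>{0..<m (-2)}. demand_code e l m \<le> demand_code a l m))"

definition placed_before_code :: "int \<Rightarrow> int \<Rightarrow> int \<Rightarrow> (int \<Rightarrow> int) \<Rightarrow> int" where
  "placed_before_code e b q m = (\<Sum>u\<in>{0..<m (-4)}. of_bool (edge_code (centre_code b m) u m \<and>
     (\<exists>l\<in>{0..<m (-2)}. \<not> l = q \<and> digit_code e l m = u \<and> label_code e l m < label_code b q m)))"

definition combined_code :: "int \<Rightarrow> int \<Rightarrow> int \<Rightarrow> int \<Rightarrow> int \<Rightarrow> (int \<Rightarrow> int) \<Rightarrow> int" where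
  "combined_code e a b q v m = table_code a v m + (if fresh_code a m then table_code b v m +
     (if v = centre_code b m then 1 + max 0 (m v - (demand_code b q m + placed_before_code e b q m)) else 0) else 0)"

definition better_code :: "int \<Rightarrow> int \<Rightarrow> int \<Rightarrow> int \<Rightarrow> (int \<Rightarrow> int) \<Rightarrow> bool" where
  "better_code e a b q m \<longleftrightarrow> applies_code e a b q m \<and> (table_code e 0 m \<le> 0 \<or>
     (\<Sum>v\<in>{0..<m (-4)}. if v = 0 then 0 else combined_code e a b q v m) <
     (\<Sum>v\<in>{0..<m (-4)}. if v = 0 then 0 else table_code e v m))"

definition write_code :: "int \<Rightarrow> int \<Rightarrow> int \<Rightarrow> int \<Rightarrow> int \<Rightarrow> (int \<Rightarrow> int) \<Rightarrow> int \<Rightarrow> int" where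
  "write_code e a b q v m = put (address_code e v m) (combined_code e a b q v m) m"

definition relax_code :: "int \<Rightarrow> int \<Rightarrow> int \<Rightarrow> int \<Rightarrow> (int \<Rightarrow> int) \<Rightarrow> int \<Rightarrow> int" where
  "relax_code e a b q m = (if better_code e a b q m
     then fold (\<lambda>v. write_code e a b q (int v)) [0..<nat (m (-4))] m else m)"

definition init_code :: "int \<Rightarrow> (int \<Rightarrow> int) \<Rightarrow> int \<Rightarrow> int" where
  "init_code e m = (if passed_code e m = m 0 \<and> (\<forall>l\<in>{0..<m (-2)}. demand_code e l m \<le> 0)
     then put (address_code e 0 m) 1 m else m)"

definition init_loop :: "(int \<Rightarrow> int) \<Rightarrow> int \<Rightarrow> int" where
  "init_loop m = fold (\<lambda>e. init_code (int e)) [0..<nat (m (-1))] m"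

definition loop_q :: "int \<Rightarrow> int \<Rightarrow> int \<Rightarrow> (int \<Rightarrow> int) \<Rightarrow> int \<Rightarrow> int" where
  "loop_q e a b m = fold (\<lambda>q. relax_code e a b (int q)) [0..<nat (m (-2))] m"
definition loop_b :: "int \<Rightarrow> int \<Rightarrow> (int \<Rightarrow> int) \<Rightarrow> int \<Rightarrow> int" where
  "loop_b e a m = fold (\<lambda>b. loop_q e a (int b)) [0..<nat (m (-1))] m"
definition loop_a :: "int \<Rightarrow> (int \<Rightarrow> int) \<Rightarrow> int \<Rightarrow> int" where
  "loop_a e m = fold (\<lambda>a. loop_b e (int a)) [0..<nat (m (-1))] m"
definition loop_e :: "(int \<Rightarrow> int) \<Rightarrow> int \<Rightarrow> int" where
  "loop_e m = fold (\<lambda>e. loop_a (int e)) [0..<nat (m (-1))] m"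
definition loop_r :: "(int \<Rightarrow> int) \<Rightarrow> int \<Rightarrow> int" where
  "loop_r m = fold (\<lambda>r. loop_e) [0..<nat (m (-1))] m"

definition output_loop :: "(int \<Rightarrow> int) \<Rightarrow> int \<Rightarrow> int" where
  "output_loop m = fold (\<lambda>v m. put (int v) (table_code 0 (int v) m - 1) m) [0..<nat (m (-4))] m"

definition power_loop :: "(int \<Rightarrow> int) \<Rightarrow> int \<Rightarrow> int" where
  "power_loop m = fold (\<lambda>i m. put (-6 - int i) (\<Sum>t\<in>{0..<m (-4)}. m (-5 - int i)) m) [0..<nat (m (-3))] m"

lemmas code_intros = computable_const computable_var computable_load computable_add computable_diff
  decidable_If computable_sum computable_of_bool decidable_conj decidable_disj decidable_not
  decidable_imp decidable_less decidable_le decidable_eq decidable_Bex decidable_Ball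

section \<open>The program consists of computable expressions and implementable loops\<close>

lemma computable_mul: "computable f \<Longrightarrow> computable g \<Longrightarrow> computable (\<lambda>\<rho> m. mul_code (f \<rho> m) (g \<rho> m) m)"
  by (rule computable_app2[of mul_code], unfold mul_code_def, intro code_intros) simp_all

lemma computable_div: "computable f \<Longrightarrow> computable g \<Longrightarrow> computable (\<lambda>\<rho> m. div_code (f \<rho> m) (g \<rho> m) m)"
  by (rule computable_app2[of div_code], unfold div_code_def, intro code_intros computable_mul) simp_all

lemma computable_digit: "computable f \<Longrightarrow> computable g \<Longrightarrow> computable (\<lambda>\<rho> m. digit_code (f \<rho> m) (g \<rho> m) m)"
  by (rule computable_app2[of digit_code], unfold digit_code_def,
      intro code_intros computable_mul computable_div)

lemma decidable_edge: "computable f \<Longrightarrow> computable g \<Longrightarrow> decidable (\<lambda>\<rho> m. edge_code (f \<rho> m) (g \<rho> m) m)"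
  unfolding edge_code_def by (intro code_intros computable_mul) assumption+

lemma computable_address: "computable f \<Longrightarrow> computable g \<Longrightarrow> computable (\<lambda>\<rho> m. address_code (f \<rho> m) (g \<rho> m) m)"
  unfolding address_code_def by (intro code_intros computable_mul) assumption+

lemma computable_table: "computable f \<Longrightarrow> computable g \<Longrightarrow> computable (\<lambda>\<rho> m. table_code (f \<rho> m) (g \<rho> m) m)"
  unfolding table_code_def by (intro code_intros computable_address) assumption+

lemmas entry_intros = code_intros computable_digit decidable_edge computable_table computable_address

lemma decidable_fresh: "decidable (\<lambda>\<rho> m. fresh_code (\<rho> i) m)"
  unfolding fresh_code_def by (intro entry_intros) simp_all

lemma decidable_merges: "decidable (\<lambda>\<rho> m. merges_code (\<rho> i) (\<rho> j) (\<rho> k) (\<rho> l) m)"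
  unfolding merges_code_def by (intro entry_intros) simp_all

lemma decidable_applies: "decidable (\<lambda>\<rho> m. applies_code (\<rho> i) (\<rho> j) (\<rho> k) (\<rho> l) m)"
  unfolding applies_code_def by (intro entry_intros decidable_fresh decidable_merges) simp_all

lemma computable_placed_before: "computable (\<lambda>\<rho> m. placed_before_code (\<rho> i) (\<rho> j) (\<rho> k) m)"
  unfolding placed_before_code_def by (intro entry_intros) simp_all

lemma computable_combined: "computable (\<lambda>\<rho> m. combined_code (\<rho> i) (\<rho> j) (\<rho> k) (\<rho> l) (\<rho> h) m)"
  unfolding combined_code_def max_def
  by (intro entry_intros decidable_fresh computable_placed_before)

lemma decidable_better: "decidable (\<lambda>\<rho> m. better_code (\<rho> i) (\<rho> j) (\<rho> k) (\<rho> l) m)"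
  unfolding better_code_def by (intro entry_intros decidable_applies computable_combined) simp_all

lemma implementable_put:
  assumes f: "computable f" and g: "computable g"
  shows "implementable (\<lambda>\<rho> m. put (f \<rho> m) (g \<rho> m) m)"
  unfolding put_def
  by (intro implementable_If implementable_store implementable_id code_intros assms)

lemma fold_bound_cells:
  assumes "\<And>i m. F i m c = m c"
  shows "fold F xs m c = (m c :: int)"
  by (induction xs arbitrary: m) (simp_all add: assms)

lemma bound_cells_preserved:
  assumes "c \<in> bound_cells"
  shows "write_code e a b q v m c = m c" "relax_code e a b q m c = m c" "init_code e m c = m c"
    "loop_q e a b m c = m c" "loop_b e a m c = m c" "loop_a e m c = m c" "loop_e m c = m c"
    "loop_r m c = m c" "init_loop m c = m c"
proof -
  show 1: "write_code e a b q v m c = m c" for e a b q v m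
    unfolding write_code_def by (rule put_bound_cells[OF assms])
  show 2: "relax_code e a b q m c = m c" for e a b q m
    unfolding relax_code_def using fold_bound_cells[of "\<lambda>v. write_code e a b q (int v)" c, OF 1] by simp
  show 3: "init_code e m c = m c" for e m
    unfolding init_code_def using put_bound_cells[OF assms] by simp
  show 4: "loop_q e a b m c = m c" for e a b m
    unfolding loop_q_def by (rule fold_bound_cells, rule 2)
  show 5: "loop_b e a m c = m c" for e a m
    unfolding loop_b_def by (rule fold_bound_cells, rule 4)
  show 6: "loop_a e m c = m c" for e m
    unfolding loop_a_def by (rule fold_bound_cells, rule 5)
  show 7: "loop_e m c = m c" for m
    unfolding loop_e_def by (rule fold_bound_cells, rule 6)
  show "loop_r m c = m c"
    unfolding loop_r_def by (rule fold_bound_cells, rule 7)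
  show "init_loop m c = m c"
    unfolding init_loop_def by (rule fold_bound_cells, rule 3)
qed

lemma implementable_relax: "implementable (\<lambda>\<rho> m. relax_code (\<rho> i) (\<rho> j) (\<rho> k) (\<rho> l) m)"
proof -
  have "implementable (\<lambda>\<rho> m. fold (\<lambda>v. write_code (\<rho> i) (\<rho> j) (\<rho> k) (\<rho> l) (int v)) [0..<nat (m (-4))] m)"
  proof (rule implementable_for[where F = "\<lambda>v \<rho>. write_code (\<rho> i) (\<rho> j) (\<rho> k) (\<rho> l) v"])
    show "implementable (\<lambda>\<rho> m. write_code (\<rho> (Suc i)) (\<rho> (Suc j)) (\<rho> (Suc k)) (\<rho> (Suc l)) (\<rho> 0) m)"
      unfolding write_code_def by (intro implementable_put computable_combined entry_intros)
  qed (simp_all only: bound_cells_preserved, simp)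
  then show ?thesis unfolding relax_code_def by (intro implementable_If decidable_better implementable_id)
qed

lemma implementable_loops: "implementable (\<lambda>\<rho>. loop_r)"
proof -
  have "implementable (\<lambda>\<rho>. loop_q (\<rho> i) (\<rho> j) (\<rho> k))" for i j k
    unfolding loop_q_def
    by (rule implementable_for[where F = "\<lambda>q \<rho>. relax_code (\<rho> i) (\<rho> j) (\<rho> k) q"])
       (rule implementable_relax, simp_all only: bound_cells_preserved, simp)
  then have "implementable (\<lambda>\<rho>. loop_b (\<rho> i) (\<rho> j))" for i j
    unfolding loop_b_def
    by (intro implementable_for[where F = "\<lambda>b \<rho>. loop_q (\<rho> i) (\<rho> j) b"])
       (simp_all only: bound_cells_preserved, simp)
  then have "implementable (\<lambda>\<rho>. loop_a (\<rho> i))" for i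
    unfolding loop_a_def
    by (intro implementable_for[where F = "\<lambda>a \<rho>. loop_b (\<rho> i) a"])
       (simp_all only: bound_cells_preserved, simp)
  then have "implementable (\<lambda>\<rho>. loop_e)"
    unfolding loop_e_def
    by (intro implementable_for[where F = "\<lambda>e \<rho>. loop_a e"])
       (simp_all only: bound_cells_preserved, simp)
  then show ?thesis
    unfolding loop_r_def
    by (intro implementable_for[where F = "\<lambda>r \<rho>. loop_e"])
       (simp_all only: bound_cells_preserved, simp)
qed

lemma implementable_init: "implementable (\<lambda>\<rho>. init_loop)"
  unfolding init_loop_def
proof (rule implementable_for[where F = "\<lambda>e \<rho>. init_code e"])
  show "implementable (\<lambda>\<rho> m. init_code (\<rho> 0) m)"
    unfolding init_code_def
    by (intro implementable_If implementable_put implementable_id entry_intros) simp_all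
qed (simp_all only: bound_cells_preserved, simp)

lemma implementable_output: "implementable (\<lambda>\<rho>. output_loop)"
  unfolding output_loop_def
proof (rule implementable_for[where F = "\<lambda>v \<rho> m. put v (table_code 0 v m - 1) m"])
  show "implementable (\<lambda>\<rho> m. put (\<rho> 0) (table_code 0 (\<rho> 0) m - 1) m)"
    by (intro implementable_put entry_intros)
qed (simp_all only: put_bound_cells, simp)

lemma implementable_power: "implementable (\<lambda>\<rho>. power_loop)"
  unfolding power_loop_def
proof (rule implementable_for[where F = "\<lambda>i \<rho> m. put (-6 - i) (\<Sum>t\<in>{0..<m (-4)}. m (-5 - i)) m"])
  show "implementable (\<lambda>\<rho> m. put (-6 - \<rho> 0) (\<Sum>t\<in>{0..<m (-4)}. m (-5 - \<rho> 0)) m)"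
    by (intro implementable_put code_intros) simp
qed (simp_all only: put_bound_cells, simp)

lemma implementable_main: "implementable (\<lambda>\<rho> m. output_loop (loop_r (init_loop m)))"
  by (rule implementable_seq[OF implementable_seq[OF implementable_init implementable_loops] implementable_output])
     (simp_all only: bound_cells_preserved)

section \<open>Agreement of the program with the abstract table\<close>

context labelling
begin

abbreviation num_states :: int where "num_states \<equiv> (n + 1) ^ nat (3 * K + 2)"

definition prepared :: "(int \<Rightarrow> int) \<Rightarrow> bool" where
  "prepared m \<longleftrightarrow> m 0 = n \<and> m (-1) = num_states \<and> m (-2) = K \<and> m (-3) = 3 * K + 2 \<and> m (-4) = n + 1 \<and>
     (\<forall>i\<in>{0..3 * K + 2}. m (-5 - i) = (n + 1) ^ nat i) \<and>
     (\<forall>u\<in>V. \<forall>v\<in>V. m (u * n + v) = 1 \<longleftrightarrow> (u, v) \<in> E) \<and> (\<forall>v\<in>V. m v = \<tau> v)"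

lemma preparedD:
  assumes "prepared m"
  shows "m 0 = n" "m (-1) = num_states" "m (-2) = K" "m (-3) = 3 * K + 2" "m (-4) = n + 1"
    "i \<in> {0..3 * K + 2} \<Longrightarrow> m (-5 - i) = (n + 1) ^ nat i"
    "u \<in> V \<Longrightarrow> v \<in> V \<Longrightarrow> m (u * n + v) = 1 \<longleftrightarrow> (u, v) \<in> E" "v \<in> V \<Longrightarrow> m v = \<tau> v"
  using assms unfolding prepared_def by blast+

lemma num_states_ge: "n + 1 \<le> num_states"
  using n K by (intro self_le_power) auto

lemma mul_code_eq:
  assumes "prepared m" "0 \<le> y" "y \<le> num_states"
  shows "mul_code x y m = x * y"
proof -
  have "{i \<in> {0..<num_states}. i < y} = {0..<y}" using assms(3) by auto
  moreover have "mul_code x y m = (\<Sum>i\<in>{i \<in> {0..<num_states}. i < y}. x)"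
    unfolding mul_code_def preparedD(2)[OF assms(1)] by (rule sum.inter_filter[symmetric]) simp
  ultimately have "mul_code x y m = (\<Sum>i\<in>{0..<y}. x)" by simp
  also have "\<dots> = x * y" using assms(2) by simp
  finally show ?thesis .
qed

text \<open>The quotient is the number of \<open>i >= 0\<close> with
  \<open>y * (i + 1) <= x\<close>, and all of these are below the number of states because
  \<open>x\<close> is.\<close>

lemma div_code_eq:
  assumes m: "prepared m" and x: "0 \<le> x" "x < num_states" and y: "0 < y"
  shows "div_code x y m = x div y"
proof -
  have iff: "y * (i + 1) \<le> x \<longleftrightarrow> i < x div y" for i
  proof
    assume "y * (i + 1) \<le> x"
    then have "y * (i + 1) div y \<le> x div y" using y by (rule zdiv_mono1)
    then show "i < x div y" using y by simp
  next
    assume "i < x div y"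
    then have "y * (i + 1) \<le> y * (x div y)" using y by (intro mult_left_mono) auto
    also have "\<dots> \<le> x" using y pos_mod_sign[of y x] mult_div_mod_eq[of y x] by linarith
    finally show "y * (i + 1) \<le> x" .
  qed
  define h where "h = x div y"
  have "h \<le> x" unfolding h_def using zdiv_mono2[of x 1 y] x(1) y by simp
  then have "h < num_states" using x(2) by linarith
  then have "{i \<in> {0..<num_states}. i < h} = {0..<h}" by auto
  then have "{i \<in> {0..<num_states}. y * (i + 1) \<le> x} = {0..<x div y}" unfolding iff h_def .
  moreover have "div_code x y m = (\<Sum>i\<in>{0..<num_states}. if y * (i + 1) \<le> x then 1 else 0)"
    unfolding div_code_def preparedD(2)[OF m] using mul_code_eq[OF m] by (intro sum.cong) auto
  moreover have "\<dots> = (\<Sum>i\<in>{i \<in> {0..<num_states}. y * (i + 1) \<le> x}. 1)"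
    by (rule sum.inter_filter[symmetric]) simp
  moreover have "0 \<le> x div y" using x y by (simp add: pos_imp_zdiv_nonneg_iff)
  ultimately show ?thesis by simp
qed

lemma digit_code_eq:
  assumes m: "prepared m" and e: "e \<in> states" and i: "0 \<le> i" "i < 3 * K + 2"
  shows "digit_code e i m = digit e i"
proof -
  have b: "0 < n + 1" and p: "0 < (n + 1) ^ nat i" using n by auto
  have e': "0 \<le> e" "e < num_states" using e unfolding states_def by auto
  let ?r = "e div (n + 1) ^ nat i"
  have mi: "m (-5 - i) = (n + 1) ^ nat i" by (rule preparedD(6)[OF m]) (use i in auto)
  have q: "0 \<le> x div y \<and> x div y \<le> x" if "0 \<le> x" "0 < y" for x y :: int
    using zdiv_mono2[of x 1 y] that by (simp add: pos_imp_zdiv_nonneg_iff)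
  have r: "0 \<le> ?r" "?r < num_states" using q[OF e'(1) p] e'(2) by auto
  have "div_code e (m (-5 - i)) m = ?r" unfolding mi by (rule div_code_eq[OF m e' p])
  moreover have "div_code ?r (n + 1) m = ?r div (n + 1)" by (rule div_code_eq[OF m r b])
  moreover have "mul_code (n + 1) (?r div (n + 1)) m = (n + 1) * (?r div (n + 1))"
    by (rule mul_code_eq[OF m]) (use q[OF r(1) b] r(2) in auto)
  ultimately show ?thesis
    unfolding digit_code_def preparedD(5)[OF m] digit_def by (simp only: minus_mult_div_eq_mod)
qed

lemma edge_code_eq:
  assumes m: "prepared m"
  shows "edge_code u v m \<longleftrightarrow> (u, v) \<in> E"
proof (cases "u \<in> V \<and> v \<in> V")
  case True
  have "mul_code u n m = u * n" by (rule mul_code_eq[OF m n]) (use num_states_ge in simp)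
  then show ?thesis unfolding edge_code_def preparedD(1)[OF m] using preparedD(7)[OF m] True by simp
next
  case False
  then show ?thesis unfolding edge_code_def preparedD(1)[OF m] using dom by auto
qed

definition address :: "int \<Rightarrow> int \<Rightarrow> int" where
  "address e v = n * n + n + 1 + (n + 1) * e + v"

lemma address_code_eq:
  assumes m: "prepared m" and e: "e \<in> states"
  shows "address_code e v m = address e v"
proof -
  have "mul_code n n m = n * n" by (rule mul_code_eq[OF m n]) (use num_states_ge in simp)
  moreover have "mul_code (n + 1) e m = (n + 1) * e"
    by (rule mul_code_eq[OF m]) (use e in \<open>auto simp: states_def\<close>)
  ultimately show ?thesis unfolding address_code_def address_def preparedD(1,5)[OF m] by simp
qed

lemma address_eq_iff:
  assumes "v \<in> {0..<n + 1}" "v' \<in> {0..<n + 1}"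
  shows "address e v = address e' v' \<longleftrightarrow> e = e' \<and> v = v'"
proof
  assume "address e v = address e' v'"
  then have eq: "v + (n + 1) * e = v' + (n + 1) * e'" unfolding address_def by simp
  have "(v + (n + 1) * e) div (n + 1) = e" "(v' + (n + 1) * e') div (n + 1) = e'"
    using assms n by (simp_all add: div_pos_pos_trivial)
  then have "e = e'" using eq by simp
  then show "e = e' \<and> v = v'" using eq by simp
qed simp

lemma address_gt: "e \<in> states \<Longrightarrow> 0 \<le> v \<Longrightarrow> n * n + n < address e v"
  unfolding address_def states_def using n by (simp add: add_strict_increasing)

text \<open>Filled up with 0 outside the stored range, so that writing a cell becomes an equation
  between functions.\<close>

definition table :: "(int \<Rightarrow> int) \<Rightarrow> int \<Rightarrow> int \<Rightarrow> int" where
  "table m e v = (if e \<in> states \<and> v \<in> {0..<n + 1} then m (address e v) else 0)"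

text \<open>The cells up to \<open>n * n + n\<close> are the input and all negative cells, hence
  everything that \<open>prepared\<close> speaks about; the table lies above them.\<close>

definition frame :: "(int \<Rightarrow> int) \<Rightarrow> (int \<Rightarrow> int) \<Rightarrow> bool" where
  "frame m m' \<longleftrightarrow> (\<forall>c\<le>n * n + n. m' c = m c)"

lemma frame_prepared:
  assumes m: "prepared m" and f: "frame m m'"
  shows "prepared m'"
proof -
  have f': "m' c = m c" if "c \<le> n * n + n" for c using f that unfolding frame_def by blast
  have nn: "0 \<le> n * n" using n by simp
  have neg: "m' c = m c" if "c \<le> n" for c using that nn n by (intro f') linarith
  have uv: "u * n + v \<le> n * n + n" if "u \<in> V" "v \<in> V" for u v
    using that n by (intro add_mono mult_right_mono) auto
  show ?thesis unfolding prepared_def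
  proof (intro conjI ballI)
    show "m' (u * n + v) = 1 \<longleftrightarrow> (u, v) \<in> E" if "u \<in> V" "v \<in> V" for u v
      using f'[OF uv[OF that]] preparedD(7)[OF m that] by simp
    show "m' v = \<tau> v" if "v \<in> V" for v using neg[of v] preparedD(8)[OF m that] that by simp
    show "m' (-5 - i) = (n + 1) ^ nat i" if "i \<in> {0..3 * K + 2}" for i
      using neg[of "-5 - i"] preparedD(6)[OF m that] that n by simp
  qed (use neg n preparedD(1-5)[OF m] in auto)
qed

lemma table_put:
  assumes e: "e \<in> states" and v: "v \<in> {0..<n + 1}"
  shows "table (put (address e v) x m) = (table m)(e := (table m e)(v := x))"
    "frame m (put (address e v) x m)"
proof -
  have pos: "n * n + n < address e v" by (rule address_gt) (use e v in auto)
  have nn: "0 \<le> n * n" using n by simp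
  have put: "put (address e v) x m = m(address e v := x)"
  proof -
    have "0 < address e v" using pos nn n by linarith
    then show ?thesis unfolding put_def by simp
  qed
  show "table (put (address e v) x m) = (table m)(e := (table m e)(v := x))"
    unfolding put table_def using e v address_eq_iff by (intro ext) auto
  show "frame m (put (address e v) x m)" unfolding put frame_def using pos by auto
qed

lemma frame_refl: "frame m m" unfolding frame_def by simp
lemma frame_trans: "frame m m' \<Longrightarrow> frame m' m'' \<Longrightarrow> frame m m''" unfolding frame_def by simp

lemma table_code_eq:
  assumes "prepared m" "e \<in> states" "v \<in> {0..<n + 1}"
  shows "table_code e v m = table m e v"
  unfolding table_code_def table_def address_code_eq[OF assms(1,2)] using assms(2,3) by simp

lemma digit_table_index: "digit e i \<in> {0..<n + 1}"
  using digit_bounds[of e i] by simp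

lemma field_code_eq:
  assumes m: "prepared m" and e: "e \<in> states"
  shows "l \<in> slots \<Longrightarrow> digit_code e l m = digit e l"
    "l \<in> slots \<Longrightarrow> digit_code e (K + l) m = label e l"
    "l \<in> slots \<Longrightarrow> digit_code e (K + K + l) m = demand e l"
    "digit_code e (3 * K + 2 - 2) m = centre e" "digit_code e (3 * K + 2 - 1) m = passed e"
proof -
  have eqs: "3 * K + 2 - 2 = 3 * K" "3 * K + 2 - 1 = 3 * K + 1" "K + K = 2 * K" by simp_all
  show "digit_code e (3 * K + 2 - 2) m = centre e" "digit_code e (3 * K + 2 - 1) m = passed e"
    unfolding eqs by (rule digit_code_eq[OF m e]; use K in simp)+
  show "digit_code e l m = digit e l" "digit_code e (K + l) m = label e l"
    "digit_code e (K + K + l) m = demand e l" if "l \<in> slots"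
    unfolding eqs by (rule digit_code_eq[OF m e]; use K that in simp)+
qed

lemma fresh_code_eq:
  assumes m: "prepared m" and a: "a \<in> states"
  shows "fresh_code a m \<longleftrightarrow> fresh (table m) a"
  unfolding fresh_code_def fresh_def field_code_eq(4,5)[OF m a] edge_code_eq[OF m] preparedD(3,4)[OF m]
    table_code_eq[OF m a digit_table_index]
  using field_code_eq(1)[OF m a] by simp

lemma merges_code_eq:
  assumes m: "prepared m" and e: "e \<in> states" and a: "a \<in> states" and b: "b \<in> states" and q: "q \<in> slots"
  shows "merges_code e a b q m \<longleftrightarrow> merges (table m) e a b q"
proof -
  have "0 \<in> {0..<n + 1}" using n by simp
  note table0 = table_code_eq[OF m b this]
  have "(\<forall>l\<in>slots. \<not> digit_code e l m = centre b \<and> (l = q \<longrightarrow> digit_code b l m = centre b) \<and>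
        (\<not> l = q \<longrightarrow> digit_code b l m = digit_code e l m \<and> label_code b l m = label_code e l m) \<and>
        demand_code e l m \<le> demand_code a l m +
          of_bool ((digit_code e l m, centre b) \<in> E \<and> label b q < label_code e l m) +
          (if l = q then 0 else demand_code b l m)) \<longleftrightarrow>
     (\<forall>l\<in>slots. digit e l \<noteq> centre b \<and>
        (if l = q then digit b l = centre b else digit b l = digit e l \<and> label b l = label e l) \<and>
        demand e l \<le> demand a l + of_bool ((digit e l, centre b) \<in> E \<and> label b q < label e l) +
          (if l = q then 0 else demand b l))"
  proof (rule ball_cong[OF refl])
    fix l assume l: "l \<in> slots"
    show "(\<not> digit_code e l m = centre b \<and> (l = q \<longrightarrow> digit_code b l m = centre b) \<and>
        (\<not> l = q \<longrightarrow> digit_code b l m = digit_code e l m \<and> label_code b l m = label_code e l m) \<and>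
        demand_code e l m \<le> demand_code a l m +
          of_bool ((digit_code e l m, centre b) \<in> E \<and> label b q < label_code e l m) +
          (if l = q then 0 else demand_code b l m)) \<longleftrightarrow>
      (digit e l \<noteq> centre b \<and>
        (if l = q then digit b l = centre b else digit b l = digit e l \<and> label b l = label e l) \<and>
        demand e l \<le> demand a l + of_bool ((digit e l, centre b) \<in> E \<and> label b q < label e l) +
          (if l = q then 0 else demand b l))"
      unfolding preparedD(3)[OF m] field_code_eq(1-3)[OF m e l] field_code_eq(1-3)[OF m a l] field_code_eq(1-3)[OF m b l]
      by (cases "l = q") simp_all
  qed
  then show ?thesis
    unfolding merges_code_def merges_def field_code_eq(4,5)[OF m a] field_code_eq(4,5)[OF m b]
      edge_code_eq[OF m] table0 field_code_eq(1)[OF m e q] field_code_eq(2)[OF m b q]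
      table_code_eq[OF m b digit_table_index] preparedD(3,4)[OF m] by (simp only:)
qed

lemma applies_code_eq:
  assumes m: "prepared m" and e: "e \<in> states" and a: "a \<in> states" and b: "b \<in> states" and q: "q \<in> slots"
  shows "applies_code e a b q m \<longleftrightarrow> applies (table m) e a b q"
proof -
  have "0 \<in> {0..<n + 1}" using n by simp
  note table0 = table_code_eq[OF m a this]
  have "(\<forall>l\<in>slots. digit_code a l m = digit_code e l m \<and> label_code a l m = label_code e l m) \<longleftrightarrow>
      (\<forall>l\<in>slots. digit a l = digit e l \<and> label a l = label e l)"
    "(\<forall>l\<in>slots. demand_code e l m \<le> demand_code a l m) \<longleftrightarrow> (\<forall>l\<in>slots. demand e l \<le> demand a l)"
    by (rule ball_cong, simp_all only: preparedD(3)[OF m] field_code_eq(1-3)[OF m e] field_code_eq(1-3)[OF m a])+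
  then show ?thesis
    unfolding applies_code_def applies_def field_code_eq(4,5)[OF m a] field_code_eq(4,5)[OF m e]
      table0 fresh_code_eq[OF m a] merges_code_eq[OF assms] preparedD(3,4)[OF m] by auto
qed

lemma placed_before_code_eq:
  assumes m: "prepared m" and e: "e \<in> states" and b: "b \<in> states" and q: "q \<in> slots"
  shows "placed_before_code e b q m = placed_before e b q"
proof -
  have "(\<exists>l\<in>slots. \<not> l = q \<and> digit_code e l m = u \<and> label_code e l m < label b q) \<longleftrightarrow>
      (\<exists>l\<in>slots. l \<noteq> q \<and> digit e l = u \<and> label e l < label b q)" for u
    by (rule bex_cong) (simp_all only: preparedD(3)[OF m] field_code_eq(1-3)[OF m e])
  then show ?thesis
    unfolding placed_before_code_def placed_before_def field_code_eq(4,5)[OF m b] edge_code_eq[OF m]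
      preparedD(3,4,5)[OF m] field_code_eq(2)[OF m b q] by (simp only:)
qed

text \<open>The code takes the threshold of \<open>v\<close> from cell \<open>v\<close>, but cell 0
  holds \<open>n\<close>. The side condition ensures that at index 0 the branch with the threshold
  is not entered.\<close>

lemma combined_code_eq:
  assumes m: "prepared m" and e: "e \<in> states" and a: "a \<in> states" and b: "b \<in> states" and q: "q \<in> slots"
    and v: "v \<in> {0..<n + 1}" "v \<noteq> 0 \<or> \<not> fresh (table m) a \<or> centre b \<noteq> 0"
  shows "combined_code e a b q v m = combined (table m) e a b q v"
proof -
  have "m v = \<tau> v" if "v \<noteq> 0" using preparedD(8)[OF m, of v] v that by simp
  then show ?thesis
    unfolding combined_code_def combined_def preparedD(3,4)[OF m] field_code_eq(4,5)[OF m b] field_code_eq(3)[OF m b q]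
      table_code_eq[OF m a v(1)] table_code_eq[OF m b v(1)] fresh_code_eq[OF m a]
      placed_before_code_eq[OF m e b q] using v(2) by auto
qed

lemma better_code_eq:
  assumes m: "prepared m" and e: "e \<in> states" and a: "a \<in> states" and b: "b \<in> states" and q: "q \<in> slots"
  shows "better_code e a b q m \<longleftrightarrow> applies (table m) e a b q \<and>
    (table m e 0 \<le> 0 \<or> score (combined (table m) e a b q) < score (table m e))"
proof -
  have "0 \<in> {0..<n + 1}" using n by simp
  note table0 = table_code_eq[OF m e this]
  have "(\<Sum>v\<in>{0..<n + 1}. if v = 0 then 0 else combined_code e a b q v m) = score (combined (table m) e a b q)"
    unfolding score_def by (rule sum.cong) (simp_all add: combined_code_eq[OF assms])
  moreover have "(\<Sum>v\<in>{0..<n + 1}. if v = 0 then 0 else table_code e v m) = score (table m e)"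
    unfolding score_def by (rule sum.cong) (simp_all add: table_code_eq[OF m e])
  ultimately show ?thesis
    unfolding better_code_def applies_code_eq[OF assms] table0 preparedD(5)[OF m] by simp
qed

text \<open>The rows that are read differ from the row that is written: \<open>passed\<close> tells
  \<open>a\<close> from \<open>e\<close>, and the digit in slot \<open>q\<close> tells
  \<open>b\<close> from \<open>e\<close>.\<close>

lemma applies_distinct:
  assumes "applies t e a b q" "q \<in> slots"
  shows "a \<noteq> e" "fresh t a \<Longrightarrow> b \<noteq> e \<and> centre b \<noteq> 0"
proof -
  have "passed a = passed e + 1" using assms(1) unfolding applies_def by blast
  then show "a \<noteq> e" by auto
  assume "fresh t a"
  then have m: "merges t e a b q" using assms(1) unfolding applies_def by simp
  then have "digit e q \<noteq> centre b" "digit b q = centre b" "1 \<le> centre b"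
    using assms(2) unfolding merges_def by simp_all
  then show "b \<noteq> e \<and> centre b \<noteq> 0" by auto
qed

text \<open>The row of \<open>e\<close> is overwritten cell by cell while the new values are still
  being computed from memory. This is harmless because they depend only on the rows of
  \<open>a\<close> and, if \<open>a\<close> is fresh, of \<open>b\<close>, which differ from
  \<open>e\<close>.\<close>

lemma relax_code_eq:
  assumes m: "prepared m" and e: "e \<in> states" and a: "a \<in> states" and b: "b \<in> states" and q: "q \<in> slots"
  shows "table (relax_code e a b q m) = relax (table m) e a b q" "frame m (relax_code e a b q m)"
proof -
  let ?t = "table m" and ?c = "combined (table m) e a b q"
  let ?m = "\<lambda>k. fold (\<lambda>v. write_code e a b q (int v)) [0..<k] m"
  have writes: "table (?m k) = ?t(e := (\<lambda>v. if v \<in> {0..<int k} then ?c v else ?t e v)) \<and> frame m (?m k)"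
    if app: "applies ?t e a b q" and "k \<le> nat (n + 1)" for k
    using that(2)
  proof (induction k)
    case 0
    then show ?case using frame_refl by auto
  next
    case (Suc k)
    then have IH: "table (?m k) = ?t(e := (\<lambda>v. if v \<in> {0..<int k} then ?c v else ?t e v))" "frame m (?m k)"
      by auto
    have k: "int k \<in> {0..<n + 1}" using Suc.prems n by auto
    have pk: "prepared (?m k)" by (rule frame_prepared[OF m IH(2)])
    have rows: "table (?m k) a = ?t a" "fresh ?t a \<Longrightarrow> table (?m k) b = ?t b"
      using applies_distinct[OF app q] unfolding IH(1) by auto
    then have fr: "fresh (table (?m k)) a \<longleftrightarrow> fresh ?t a" unfolding fresh_def by simp
    then have "combined (table (?m k)) e a b q = ?c"
      using rows unfolding combined_def by auto
    moreover have "int k \<noteq> 0 \<or> \<not> fresh (table (?m k)) a \<or> centre b \<noteq> 0"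
      using applies_distinct[OF app q] fr by blast
    ultimately have "?m (Suc k) = put (address e (int k)) (?c (int k)) (?m k)"
      using combined_code_eq[OF pk e a b q k] address_code_eq[OF pk e] by (simp add: write_code_def)
    moreover have "(?t(e := (\<lambda>v. if v \<in> {0..<int k} then ?c v else ?t e v)))
        (e := ((?t(e := (\<lambda>v. if v \<in> {0..<int k} then ?c v else ?t e v))) e)(int k := ?c (int k))) =
        ?t(e := (\<lambda>v. if v \<in> {0..<int (Suc k)} then ?c v else ?t e v))"
      by (intro ext) auto
    ultimately show ?case
      using table_put[OF e k, where x = "?c (int k)" and m = "?m k"] IH frame_trans[OF IH(2)] by simp
  qed
  have "table (relax_code e a b q m) = relax ?t e a b q \<and> frame m (relax_code e a b q m)"
  proof (cases "better_code e a b q m")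
    case True
    then have "applies ?t e a b q \<and> (?t e 0 \<le> 0 \<or> score ?c < score (?t e))"
      unfolding better_code_eq[OF assms] .
    moreover from this have "relax ?t e a b q = ?t(e := (\<lambda>v. if v \<in> {0..<n + 1} then ?c v else ?t e v))"
      unfolding relax_def by (rule if_P)
    moreover have "int (nat (n + 1)) = n + 1" using n by simp
    ultimately show ?thesis
      using writes[of "nat (n + 1)"] True unfolding relax_code_def preparedD(5)[OF m] by simp
  next
    case False
    moreover from this have "relax ?t e a b q = ?t"
      unfolding better_code_eq[OF assms] relax_def by (rule if_not_P)
    ultimately show ?thesis unfolding relax_code_def by (simp add: frame_refl)
  qed
  then show "table (relax_code e a b q m) = relax ?t e a b q" "frame m (relax_code e a b q m)" by auto
qed

section \<open>The nested loops as sequences of relaxations\<close>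

definition invariant :: "(int \<Rightarrow> int) \<Rightarrow> bool" where
  "invariant m \<longleftrightarrow> prepared m \<and> sound (table m)"

abbreviation better :: "(int \<Rightarrow> int) \<Rightarrow> (int \<Rightarrow> int) \<Rightarrow> bool" where
  "better m m' \<equiv> improves (table m) (table m')"

definition steady :: "((int \<Rightarrow> int) \<Rightarrow> int \<Rightarrow> int) \<Rightarrow> bool" where
  "steady F \<longleftrightarrow> (\<forall>m. invariant m \<longrightarrow> invariant (F m) \<and> better m (F m))"

text \<open>Expresses that \<open>G\<close> is executed somewhere within \<open>F\<close>, at a
  memory no worse than the initial one, and that its gain is not lost afterwards. This is the
  premise \<open>sweep\<close> of \<open>solved_after_rounds\<close> in terms of memories, and it
  composes along nested loops.\<close>

definition covers :: "((int \<Rightarrow> int) \<Rightarrow> int \<Rightarrow> int) \<Rightarrow> ((int \<Rightarrow> int) \<Rightarrow> int \<Rightarrow> int) \<Rightarrow> bool" where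
  "covers F G \<longleftrightarrow> (\<forall>m. invariant m \<longrightarrow> (\<exists>m'. invariant m' \<and> better m m' \<and> better (G m') (F m)))"

lemma steady_fold:
  assumes "\<And>i. i \<in> set xs \<Longrightarrow> steady (F i)"
  shows "steady (fold F xs)"
  using assms
proof (induction xs)
  case Nil
  then show ?case unfolding steady_def using improves_refl by simp
next
  case (Cons x xs)
  then show ?case unfolding steady_def by (auto intro: improves_trans)
qed

lemma covers_fold:
  assumes "\<And>i. i \<in> set xs \<Longrightarrow> steady (F i)" "x \<in> set xs"
  shows "covers (fold F xs) (F x)"
proof -
  obtain ys zs where xs: "xs = ys @ x # zs" using assms(2) by (meson split_list)
  have "steady (fold F ys)" "steady (F x)" "steady (fold F zs)"
    using assms unfolding xs by (auto intro: steady_fold)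
  note st = this[unfolded steady_def]
  show ?thesis unfolding covers_def
  proof (intro allI impI)
    fix m assume m: "invariant m"
    let ?m = "fold F ys m"
    have 1: "invariant ?m" "better m ?m" using st(1) m by simp_all
    then have "invariant (F x ?m)" using st(2) by simp
    then have "better (F x ?m) (fold F zs (F x ?m))" using st(3) by simp
    then show "\<exists>m'. invariant m' \<and> better m m' \<and> better (F x m') (fold F xs m)"
      using 1 unfolding xs by (intro exI[of _ ?m]) simp
  qed
qed

lemma covers_trans: "covers F G \<Longrightarrow> covers G H \<Longrightarrow> covers F H"
  unfolding covers_def by (blast intro: improves_trans)

lemma steady_loop:
  assumes steady: "\<And>i. 0 \<le> i \<Longrightarrow> i < h \<Longrightarrow> steady (F i)" and c: "\<And>m. invariant m \<Longrightarrow> m c = h"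
  shows "steady (\<lambda>m. fold (\<lambda>i. F (int i)) [0..<nat (m c)] m)"
    "0 \<le> i \<Longrightarrow> i < h \<Longrightarrow> covers (\<lambda>m. fold (\<lambda>i. F (int i)) [0..<nat (m c)] m) (F i)"
proof -
  let ?L = "fold (\<lambda>i. F (int i)) [0..<nat h]"
  have st: "steady (F (int k))" if "k \<in> set [0..<nat h]" for k using steady that by auto
  have "steady ?L" by (rule steady_fold) (rule st)
  then show "steady (\<lambda>m. fold (\<lambda>i. F (int i)) [0..<nat (m c)] m)"
    unfolding steady_def using c by simp
  assume i: "0 \<le> i" "i < h"
  have "covers ?L (F (int (nat i)))" by (rule covers_fold[OF st]) (use i in auto)
  then show "covers (\<lambda>m. fold (\<lambda>i. F (int i)) [0..<nat (m c)] m) (F i)"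
    unfolding covers_def using c i by simp
qed

lemma steady_relax:
  assumes "e \<in> states" "a \<in> states" "b \<in> states" "q \<in> slots"
  shows "steady (relax_code e a b q)"
  unfolding steady_def invariant_def
  using relax_code_eq[OF _ assms] frame_prepared relax_sound[OF _ assms] relax_improves by metis

lemma invariant_cells: "invariant m \<Longrightarrow> m (-1) = num_states" "invariant m \<Longrightarrow> m (-2) = K"
  unfolding invariant_def using preparedD by blast+

lemma steady_loops:
  shows "steady loop_e"
    and "e \<in> states \<Longrightarrow> a \<in> states \<Longrightarrow> b \<in> states \<Longrightarrow> q \<in> slots \<Longrightarrow> covers loop_e (relax_code e a b q)"
proof -
  have q: "steady (loop_q e a b)" "\<And>q. q \<in> slots \<Longrightarrow> covers (loop_q e a b) (relax_code e a b q)"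
    if "e \<in> states" "a \<in> states" "b \<in> states" for e a b
    unfolding loop_q_def using steady_loop[where c = "-2" and h = K and F = "relax_code e a b"]
      steady_relax[OF that] invariant_cells by auto
  have b: "steady (loop_b e a)" "\<And>b. b \<in> states \<Longrightarrow> covers (loop_b e a) (loop_q e a b)"
    if "e \<in> states" "a \<in> states" for e a
    unfolding loop_b_def using steady_loop[where c = "-1" and h = num_states and F = "loop_q e a"]
      q(1)[OF that] invariant_cells by (auto simp: states_def)
  have a: "steady (loop_a e)" "\<And>a. a \<in> states \<Longrightarrow> covers (loop_a e) (loop_b e a)"
    if "e \<in> states" for e
    unfolding loop_a_def using steady_loop[where c = "-1" and h = num_states and F = "loop_b e"]
      b(1)[OF that] invariant_cells by (auto simp: states_def)
  have e: "steady loop_e" "\<And>e. e \<in> states \<Longrightarrow> covers loop_e (loop_a e)"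
    unfolding loop_e_def using steady_loop[where c = "-1" and h = num_states and F = "loop_a"]
      a(1) invariant_cells by (auto simp: states_def)
  show "steady loop_e" by (rule e)
  show "covers loop_e (relax_code e a b q)"
    if "e \<in> states" "a \<in> states" "b \<in> states" "q \<in> slots"
    by (rule covers_trans[OF e(2) covers_trans[OF a(2) covers_trans[OF b(2) q(2)]]]) (rule that)+
qed

end

section \<open>Correctness of the loops\<close>

context labelling
begin

abbreviation initial_entry :: "int \<Rightarrow> bool" where
  "initial_entry e \<equiv> passed e = n \<and> (\<forall>l\<in>slots. demand e l \<le> 0)"

lemma init_loop_eq:
  assumes m: "prepared m" and t: "table m = (\<lambda>e v. 0)"
  shows "frame m (init_loop m)"
    "table (init_loop m) = (\<lambda>e v. of_bool (e \<in> states \<and> initial_entry e \<and> v = 0))"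
proof -
  let ?m = "\<lambda>k. fold (\<lambda>e. init_code (int e)) [0..<k] m"
  have init: "frame m (?m k) \<and>
      table (?m k) = (\<lambda>e v. of_bool (e \<in> states \<and> e < int k \<and> initial_entry e \<and> v = 0))"
    if "k \<le> nat num_states" for k
    using that
  proof (induction k)
    case 0
    have "\<not> (e \<in> states \<and> e < int 0)" for e unfolding states_def by simp
    then show ?case using t frame_refl by (auto simp: fun_eq_iff)
  next
    case (Suc k)
    then have IH: "frame m (?m k)"
      "table (?m k) = (\<lambda>e v. of_bool (e \<in> states \<and> e < int k \<and> initial_entry e \<and> v = 0))"
      by auto
    have k: "int k \<in> states" using Suc.prems unfolding states_def by auto
    have pk: "prepared (?m k)" by (rule frame_prepared[OF m IH(1)])
    have "(\<forall>l\<in>slots. demand_code (int k) l (?m k) \<le> 0) \<longleftrightarrow> (\<forall>l\<in>slots. demand (int k) l \<le> 0)"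
      by (rule ball_cong) (simp_all only: preparedD(3)[OF pk] field_code_eq(3)[OF pk k])
    then have step: "?m (Suc k) = (if initial_entry (int k) then put (address (int k) 0) 1 (?m k) else ?m k)"
      using preparedD(1-4)[OF pk] field_code_eq(4,5)[OF pk k] address_code_eq[OF pk k]
      by (simp add: init_code_def)
    have less: "e < int (Suc k) \<longleftrightarrow> e < int k \<or> e = int k" for e by auto
    have v0: "0 \<in> {0..<n + 1}" using n by simp
    show ?case
    proof (cases "initial_entry (int k)")
      case True
      have "(table (?m k))(int k := (table (?m k) (int k))(0 := 1)) =
          (\<lambda>e v. of_bool (e \<in> states \<and> e < int (Suc k) \<and> initial_entry e \<and> v = 0))"
        unfolding IH(2) less using True k by (intro ext) auto
      then show ?thesis
        using step True table_put[OF k v0, where x = 1 and m = "?m k"] frame_trans[OF IH(1)] by simp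
    next
      case False
      then have "?m (Suc k) = ?m k" unfolding step by (rule if_not_P)
      moreover have "(e \<in> states \<and> e < int (Suc k) \<and> initial_entry e \<and> v = 0) =
          (e \<in> states \<and> e < int k \<and> initial_entry e \<and> v = 0)" for e and v :: int
        unfolding less using False by blast
      ultimately show ?thesis using IH by (simp only: simp_thms)
    qed
  qed
  have "(e \<in> states \<and> e < int (nat num_states)) = (e \<in> states)" for e
    unfolding states_def using n by auto
  then have "(e \<in> states \<and> e < int (nat num_states) \<and> initial_entry e \<and> v = 0) =
      (e \<in> states \<and> initial_entry e \<and> v = 0)" for e and v :: int by blast
  with init[of "nat num_states"] show "frame m (init_loop m)"
    "table (init_loop m) = (\<lambda>e v. of_bool (e \<in> states \<and> initial_entry e \<and> v = 0))"
    unfolding init_loop_def preparedD(2)[OF m] by (simp_all only:)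
qed

text \<open>The flagged states have \<open>passed\<close> equal to \<open>n\<close>, so their area
  is empty, all entries besides the flag are rightly 0, and demands of at most 0 are met
  trivially.\<close>

lemma init_loop_invariant:
  assumes "prepared m" "table m = (\<lambda>e v. 0)"
  shows "invariant (init_loop m)"
proof -
  let ?t = "table (init_loop m)"
  note t = init_loop_eq[OF assms]
  have "sound_entry ?t e" if "0 < ?t e 0" for e
  proof -
    have e: "initial_entry e" using that unfolding t(2) by (auto split: if_splits)
    have area: "area e = {}" unfolding region_def using e by auto
    have "?t e v = 0" if "v \<in> V" for v using that unfolding t(2) by simp
    moreover have "demand e l \<le> earlier p {} (digit e l) (label e l)" if "l \<in> slots" for l p
      using e that earlier_nonneg[of p "{}" "digit e l" "label e l"] by force
    ultimately show ?thesis unfolding sound_entry_def area by auto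
  qed
  then show ?thesis unfolding invariant_def sound_def using frame_prepared[OF assms(1) t(1)] by blast
qed

text \<open>Overwriting the thresholds does no harm here, as addresses depend on nonpositive cells
  only and the table lies above the input. The guard in \<open>put\<close> skips the index 0 and so
  protects cell 0.\<close>

lemma output_loop_eq:
  assumes m: "prepared m" and v: "v \<in> V"
  shows "output_loop m v = table m 0 v - 1"
proof -
  let ?m = "\<lambda>k. fold (\<lambda>v m. put (int v) (table_code 0 (int v) m - 1) m) [0..<k] m"
  have zero: "0 \<in> states" unfolding states_def using n by simp
  have "?m k c = (if c \<in> {1..<int k} then table m 0 c - 1 else m c)" if "k \<le> nat (n + 1)" for k c
    using that
  proof (induction k arbitrary: c)
    case (Suc k)
    then have IH: "?m k c = (if c \<in> {1..<int k} then table m 0 c - 1 else m c)" for c by simp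
    have k: "int k \<in> {0..<n + 1}" using Suc.prems n by auto
    have "address_code 0 (int k) (?m k) = address_code 0 (int k) m"
      unfolding address_code_def mul_code_def IH by simp
    also have "\<dots> = address 0 (int k)" by (rule address_code_eq[OF m zero])
    finally have "table_code 0 (int k) (?m k) = ?m k (address 0 (int k))" unfolding table_code_def by simp
    also have "\<dots> = m (address 0 (int k))"
    proof -
      have "0 \<le> n * n" "int k \<le> n" using n k by simp_all
      then have "int k \<le> address 0 (int k)" using address_gt[OF zero of_nat_0_le_iff[of k]] by linarith
      then show ?thesis unfolding IH by simp
    qed
    also have "\<dots> = table m 0 (int k)" unfolding table_def using zero k by simp
    finally have step: "?m (Suc k) = put (int k) (table m 0 (int k) - 1) (?m k)" by simp
    have put: "put (int k) x f c = (if 0 < int k \<and> c = int k then x else f c)" for x f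
      unfolding put_def by simp
    show ?case unfolding step put IH by auto
  qed simp
  from this[of "nat (n + 1)" v] show ?thesis
    unfolding output_loop_def preparedD(5)[OF m] using v n by simp
qed

end

context labelling_strategy
begin

text \<open>The second conclusion is soundness of the root row, the third is completeness. The table
  does not depend on \<open>P\<close>, so one run beats all labellings at once.\<close>

lemma loop_r_optimal:
  assumes m: "prepared m" "table m = (\<lambda>e v. 0)"
  defines "m' \<equiv> loop_r (init_loop m)"
  shows "prepared m'" "\<exists>p. \<forall>v\<in>V. 1 + cost p v \<le> table m' 0 v"
    "(\<And>v. v \<in> V \<Longrightarrow> P v \<in> {0..n}) \<Longrightarrow> (\<Sum>v\<in>V. table m' 0 v) \<le> (\<Sum>v\<in>V. 1 + cost P v)"
proof -
  let ?m = "\<lambda>r. fold (\<lambda>r. loop_e) [0..<r] (init_loop m)"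
  have inv0: "invariant (init_loop m)" by (rule init_loop_invariant[OF m])
  have "steady (fold (\<lambda>r. loop_e) [0..<r])" for r by (rule steady_fold) (rule steady_loops(1))
  then have inv: "invariant (?m r)" for r using inv0 unfolding steady_def by blast
  have m': "m' = ?m (nat num_states)"
    unfolding m'_def loop_r_def using invariant_cells(1)[OF inv0] by simp
  have inv': "invariant m'" unfolding m' by (rule inv)
  then show "prepared m'" unfolding invariant_def by blast
  have solved: "solved (table m') P 0" if P: "\<And>v. v \<in> V \<Longrightarrow> P v \<in> {0..n}" for P
    unfolding m'
  proof (rule solved_after_rounds[where T = "\<lambda>r. table (?m r)"])
    show "sound (table (?m r))" for r using inv unfolding invariant_def by blast
  next
    fix e assume "e \<in> states" "passed e = n" "\<And>l. l \<in> slots \<Longrightarrow> demand e l \<le> 0"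
    then show "0 < table (?m 0) e 0 \<and> score (table (?m 0) e) \<le> 0"
      unfolding score_eq by (simp add: init_loop_eq[OF m])
  next
    show "improves (table (?m r)) (table (?m (Suc r)))" for r
      using steady_loops(1) inv[of r] unfolding steady_def by simp
  next
    fix r e a b q assume s: "e \<in> states" "a \<in> states" "b \<in> states" "q \<in> slots"
    obtain k where k: "invariant k" "improves (table (?m r)) (table k)"
      "improves (table (relax_code e a b q k)) (table (loop_e (?m r)))"
      using steady_loops(2)[OF s] inv[of r] unfolding covers_def by blast
    then show "\<exists>t. sound t \<and> improves (table (?m r)) t \<and>
        improves (relax t e a b q) (table (?m (Suc r)))"
      using relax_code_eq(1)[OF _ s, of k] unfolding invariant_def by auto
  next
    \<comment> \<open>The number of states also serves as the number of rounds: it is at least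
      \<open>(n + 1) ^ 2\<close>, and all ranks up to that of the root are below this
      square.\<close>
    have "n * (n + 1) + n < (n + 1) ^ 2" using n by (simp add: power2_eq_square algebra_simps)
    also have "\<dots> \<le> num_states" using n K by (intro power_increasing) auto
    finally show "rank 0 < int (nat num_states)" unfolding root_rank by simp
  qed (fact P root_state root_good)+
  \<comment> \<open>The constant labelling 0 is a competitor, so the root row has been
    filled.\<close>
  have flag: "0 < table m' 0 0" using solved[of "\<lambda>_. 0"] n unfolding solved_def by simp
  have "sound (table m')" using inv' unfolding invariant_def by blast
  note entry = sound_entryD[OF this root_state flag]
  have "agrees (\<lambda>_. 0) 0" unfolding agrees_def digit_def by simp
  from entry(4)[OF this] show "\<exists>p. \<forall>v\<in>V. 1 + cost p v \<le> table m' 0 v"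
    unfolding root_area by blast
  show "(\<Sum>v\<in>V. table m' 0 v) \<le> (\<Sum>v\<in>V. 1 + cost P v)" if "\<And>v. v \<in> V \<Longrightarrow> P v \<in> {0..n}"
    using solved[of P, OF that] unfolding solved_def score_eq target_def root_area by blast
qed

end

lemma power_loop_eq:
  assumes m: "m (-3) = L" "m (-4) = b" "m (-5) = 1" and b: "0 \<le> b"
  shows "power_loop m c = (if -5 - L \<le> c \<and> c \<le> -6 then b ^ nat (-5 - c) else m c)"
proof -
  let ?m = "\<lambda>k. fold (\<lambda>i m. put (-6 - int i) (\<Sum>t\<in>{0..<m (-4)}. m (-5 - int i)) m) [0..<k] m"
  have "?m k c = (if -5 - int k \<le> c \<and> c \<le> -6 then b ^ nat (-5 - c) else m c)" for k c
  proof (induction k arbitrary: c)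
    case (Suc k)
    have b4: "?m k (-4) = b" unfolding Suc.IH using m by simp
    have "?m k (-5 - int k) = b ^ k" unfolding Suc.IH using m(3) by (cases "k = 0") auto
    then have "(\<Sum>t\<in>{0..<?m k (-4)}. ?m k (-5 - int k)) = b ^ Suc k" unfolding b4 using b by simp
    then have step: "?m (Suc k) = (?m k)(-6 - int k := b ^ Suc k)" unfolding put_def by simp
    have "nat (-5 - (-6 - int k)) = Suc k" by simp
    then show ?case unfolding step fun_upd_apply Suc.IH by auto
  qed auto
  from this[of "nat L" c] show ?thesis unfolding power_loop_def m(1) by (cases "0 \<le> L") auto
qed

lemma implementable_run:
  assumes "implementable (\<lambda>\<rho>. F)"
  shows "\<exists>c T. poly_bounded T \<and> (\<forall>r m M. bounded M m \<longrightarrow> (\<exists>r'. runs c (r, m) (T M) (r', F m)))"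
proof -
  obtain T where T: "poly_bounded T" "\<And>k loc. (\<And>i. loc i < k) \<Longrightarrow> \<exists>c. performs c k loc T (\<lambda>\<rho>. F)"
    using implementableE[OF assms] by blast
  obtain c where "performs c 1 (\<lambda>_. 0) T (\<lambda>\<rho>. F)" using T(2)[of "\<lambda>_. 0" 1] by auto
  then show ?thesis using T(1) unfolding performs_def by blast
qed

text \<open>The only place where \<open>w\<close> occurs in the program. The number of slots is
  \<open>min (w + 2) (n + 1)\<close>, which exceeds the size of every bag; the cap by
  \<open>n + 1\<close> makes the cell with \<open>3 * K + 2\<close> linear in
  \<open>n\<close>.\<close>

definition start_code :: "nat \<Rightarrow> com" where
  "start_code w = Seq (Store (Const (-4)) (Add (Load (Const 0)) (Const 1)))
     (Seq (If (Less (Const (int w + 2)) (Load (Const (-4))))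
       (Store (Const (-2)) (Const (int w + 2))) (Store (Const (-2)) (Load (Const (-4)))))
     (Seq (Store (Const (-3)) (Add (Add (Load (Const (-2))) (Load (Const (-2)))) (Add (Load (Const (-2))) (Const 2))))
       (Store (Const (-5)) (Const 1))))"

lemma runs_start_code:
  assumes K_def: "K = min (int w + 2) (m 0 + 1)"
  shows "runs (start_code w) (r, m) 40 (r, m(-4 := m 0 + 1, -2 := K, -3 := 3 * K + 2, -5 := 1))"
proof -
  have K: "K = (if int w + 2 < m 0 + 1 then int w + 2 else m 0 + 1)" unfolding K_def by auto
  let ?m1 = "m(-4 := m 0 + 1)"
  let ?m2 = "?m1(-2 := K)"
  let ?m3 = "?m2(-3 := 3 * K + 2)"
  have 1: "runs (Store (Const (-4)) (Add (Load (Const 0)) (Const 1))) (r, m) 6 (r, ?m1)"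
    using runs_Store[of "Const (-4)" "Add (Load (Const 0)) (Const 1)" "(r, m)"] by (simp add: eval_nat_numeral)
  have 2: "runs (If (Less (Const (int w + 2)) (Load (Const (-4))))
       (Store (Const (-2)) (Const (int w + 2))) (Store (Const (-2)) (Load (Const (-4))))) (r, ?m1)
       (bcost (Less (Const (int w + 2)) (Load (Const (-4)))) + 4 + 1) (r, ?m2)"
    using runs_mono[OF runs_Store[of "Const (-2)" "Const (int w + 2)" "(r, ?m1)"], of 4]
      runs_Store[of "Const (-2)" "Load (Const (-4))" "(r, ?m1)"]
    by (intro runs_If) (simp add: eval_nat_numeral K)
  have 3: "runs (Store (Const (-3)) (Add (Add (Load (Const (-2))) (Load (Const (-2)))) (Add (Load (Const (-2))) (Const 2))))
      (r, ?m2) 12 (r, ?m3)"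
    using runs_Store[of "Const (-3)" "Add (Add (Load (Const (-2))) (Load (Const (-2)))) (Add (Load (Const (-2))) (Const 2))" "(r, ?m2)"]
    by (simp add: eval_nat_numeral algebra_simps)
  have 4: "runs (Store (Const (-5)) (Const 1)) (r, ?m3) 3 (r, ?m3(-5 := 1))"
    using runs_Store[of "Const (-5)" "Const 1" "(r, ?m3)"] by (simp add: eval_nat_numeral)
  from runs_Seq[OF 1 runs_Seq[OF 2 runs_Seq[OF 3 4]]]
  have "runs (start_code w) (r, m) (6 + (bcost (Less (Const (int w + 2)) (Load (Const (-4)))) + 4 + 1 +
      (12 + 3 + 1) + 1) + 1) (r, ?m3(-5 := 1))" unfolding start_code_def .
  then show ?thesis by (rule runs_mono) simp
qed

section \<open>Partial incentives and labellings\<close>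

text \<open>Vertices are activated one at a time and labelled by their position. A proper subset
  \<open>S\<close> cannot be closed, since otherwise the hull would be contained in it; so some
  further vertex has enough neighbours in \<open>S\<close>, all with smaller labels.\<close>

lemma partial_incentive_labelling:
  assumes G: "finite (verts G)" and inc: "partial_incentive G \<tau> \<sigma>"
  obtains p :: "'a \<Rightarrow> nat" where "\<And>v. v \<in> verts G \<Longrightarrow> p v \<le> card (verts G)"
    "\<And>v. v \<in> verts G \<Longrightarrow> \<tau> v - int (\<sigma> v) \<le> int (card {u \<in> neighbours G v. p u < p v})"
proof -
  have "\<exists>S p. S \<subseteq> verts G \<and> card S = k \<and> (\<forall>v\<in>S. p v < k \<and>
      \<tau> v - int (\<sigma> v) \<le> int (card {u \<in> S \<inter> neighbours G v. p u < p v}))" if "k \<le> card (verts G)" for k :: nat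
    using that
  proof (induction k)
    case 0
    show ?case by (intro exI[of _ "{}"]) simp
  next
    case (Suc k)
    then obtain S p where S: "S \<subseteq> verts G" "card S = k" and p: "\<And>v. v \<in> S \<Longrightarrow> p v < k"
      "\<And>v. v \<in> S \<Longrightarrow> \<tau> v - int (\<sigma> v) \<le> int (card {u \<in> S \<inter> neighbours G v. p u < p v})"
      by auto
    have fin: "finite S" using S(1) G by (rule finite_subset)
    have "S \<noteq> verts G" using S(2) Suc.prems by auto
    have "\<exists>u\<in>verts G. \<tau> u - int (\<sigma> u) \<le> int (card (S \<inter> neighbours G u)) \<and> u \<notin> S"
    proof (rule ccontr)
      assume no: "\<not> ?thesis"
      have "threshold_hull G (\<lambda>v. \<tau> v - int (\<sigma> v)) {} \<subseteq> S"
        unfolding threshold_hull_def by (rule Inter_lower) (use no S(1) in auto)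
      then show False using inc S(1) \<open>S \<noteq> verts G\<close> unfolding partial_incentive_def by blast
    qed
    then obtain u where u: "u \<in> verts G" "u \<notin> S"
      "\<tau> u - int (\<sigma> u) \<le> int (card (S \<inter> neighbours G u))" by blast
    let ?p = "p(u := k)"
    have old: "{x \<in> insert u S \<inter> neighbours G v. ?p x < ?p v} = {x \<in> S \<inter> neighbours G v. p x < p v}"
      if "v \<in> S" for v using p(1)[OF that] that u(2) by auto
    have new: "{x \<in> insert u S \<inter> neighbours G u. ?p x < ?p u} = S \<inter> neighbours G u"
      using p(1) u(2) by auto
    show ?case
    proof (intro exI[of _ "insert u S"] exI[of _ ?p] conjI ballI)
      show "insert u S \<subseteq> verts G" using u S by simp
      show "card (insert u S) = Suc k" using u S fin by simp
    next
      fix v assume v: "v \<in> insert u S"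
      show "?p v < Suc k" using v p(1) by (auto intro: less_SucI)
      show "\<tau> v - int (\<sigma> v) \<le> int (card {x \<in> insert u S \<inter> neighbours G v. ?p x < ?p v})"
      proof (cases "v = u")
        case True
        then show ?thesis using u(3) unfolding True new by simp
      next
        case False
        then have "v \<in> S" using v by simp
        then show ?thesis using p(2) unfolding old[OF \<open>v \<in> S\<close>] by simp
      qed
    qed
  qed
  from this[OF order_refl] obtain S p where S: "S \<subseteq> verts G" "card S = card (verts G)"
    and p: "\<And>v. v \<in> S \<Longrightarrow> p v < card (verts G) \<and>
      \<tau> v - int (\<sigma> v) \<le> int (card {u \<in> S \<inter> neighbours G v. p u < p v})" by blast
  have "S = verts G" using card_subset_eq[OF G S] .
  moreover have "verts G \<inter> neighbours G v = neighbours G v" for v unfolding neighbours_def by auto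
  ultimately show ?thesis using that[of p] p by (simp add: less_imp_le)
qed

text \<open>Every closed set absorbs the vertices in the order of their labels. As labels are
  integers, the induction is on the number of vertices with a smaller label.\<close>

lemma labelling_partial_incentive:
  fixes p :: "'a \<Rightarrow> int"
  assumes G: "finite (verts G)"
    and p: "\<And>v. v \<in> verts G \<Longrightarrow> \<tau> v - int (\<sigma> v) \<le> int (card {u \<in> neighbours G v. p u < p v})"
  shows "partial_incentive G \<tau> \<sigma>"
proof -
  have "verts G \<subseteq> H" if H: "\<forall>u\<in>verts G. int (card (H \<inter> neighbours G u)) \<ge> \<tau> u - int (\<sigma> u) \<longrightarrow> u \<in> H" for H
  proof
    fix v assume "v \<in> verts G"
    then show "v \<in> H"
    proof (induction "card {u \<in> verts G. p u < p v}" arbitrary: v rule: less_induct)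
      case less
      have "{u \<in> neighbours G v. p u < p v} \<subseteq> H \<inter> neighbours G v"
      proof
        fix u assume u: "u \<in> {u \<in> neighbours G v. p u < p v}"
        then have uG: "u \<in> verts G" unfolding neighbours_def by simp
        have "{x \<in> verts G. p x < p u} \<subset> {x \<in> verts G. p x < p v}" using u uG by force
        then have "card {x \<in> verts G. p x < p u} < card {x \<in> verts G. p x < p v}"
          using G by (intro psubset_card_mono) auto
        from less.hyps[OF this uG] show "u \<in> H \<inter> neighbours G v" using u by simp
      qed
      then have "card {u \<in> neighbours G v. p u < p v} \<le> card (H \<inter> neighbours G v)"
        using G unfolding neighbours_def by (intro card_mono) auto
      with p[OF less.prems] have "\<tau> v - int (\<sigma> v) \<le> int (card (H \<inter> neighbours G v))" by linarith
      then show ?case using H less.prems by blast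
    qed
  qed
  then have "verts G \<subseteq> threshold_hull G (\<lambda>v. \<tau> v - int (\<sigma> v)) {}"
    unfolding threshold_hull_def by auto
  moreover have "threshold_hull G (\<lambda>v. \<tau> v - int (\<sigma> v)) {} \<subseteq> verts G"
    unfolding threshold_hull_def by (rule Inter_lower) auto
  ultimately show ?thesis unfolding partial_incentive_def by blast
qed

text \<open>Transports the strategy from the input graph on \<open>0, ..., n - 1\<close> to the
  vertex numbers \<open>1, ..., n\<close>. The bound on the positions of the cops is the minimum of
  \<open>w + 1\<close> and \<open>n\<close>, both below \<open>K\<close>.\<close>

lemma input_strategy:
  fixes G :: "nat graph" and n w :: nat
  assumes G: "simple_graph G" "verts G = {..<n}" and w: "treewidth G \<le> w"
  defines "E \<equiv> {(u, v). u \<in> {1..int n} \<and> v \<in> {1..int n} \<and> {nat (u - 1), nat (v - 1)} \<in> edges G}"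
  obtains ok where "labelling_strategy (int n) (min (int w + 2) (int n + 1)) E ok"
proof -
  let ?V = "{1..int n}" and ?f = "\<lambda>u :: int. nat (u - 1)"
  have f: "?f u \<in> verts G" if "u \<in> ?V" for u
    unfolding G(2) lessThan_iff using that by (subst nat_less_iff) auto
  have inj: "inj_on ?f ?V"
  proof (rule inj_onI)
    fix u v assume "u \<in> ?V" "v \<in> ?V" "?f u = ?f v"
    then have "u - 1 = v - 1" by (subst (asm) nat_eq_iff2) auto
    then show "u = v" by simp
  qed
  show ?thesis
  proof (rule treewidth_strategy[OF G(1) w])
    fix ok assume ok: "ok {}" "\<And>S S'. ok S \<Longrightarrow> S' \<subseteq> S \<Longrightarrow> ok S'"
      "\<And>S. ok S \<Longrightarrow> S \<subseteq> verts G \<and> card S \<le> w + 1"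
      "\<And>C. C \<subseteq> verts G \<Longrightarrow> C \<noteq> {} \<Longrightarrow> connected_within (adj G) C \<Longrightarrow> ok (boundary (adj G) C) \<Longrightarrow>
         \<exists>z\<in>C. ok (insert z (boundary (adj G) C))"
    have E: "(u, v) \<in> E \<longleftrightarrow> (?f u, ?f v) \<in> adj G" if "u \<in> ?V" "v \<in> ?V" for u v
      using that unfolding E_def adj_def by simp
    have EV: "u \<in> ?V" "v \<in> ?V" if "(u, v) \<in> E" for u v using that unfolding E_def by auto
    have boundary: "boundary (adj G) (?f ` C) = ?f ` boundary E C" if C: "C \<subseteq> ?V" for C
    proof (intro equalityI subsetI)
      fix x assume "x \<in> boundary (adj G) (?f ` C)"
      then obtain c where c: "c \<in> C" "(?f c, x) \<in> adj G" "x \<notin> ?f ` C" unfolding boundary_def by auto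
      have "x \<in> verts G" using c(2) G(1) unfolding adj_def simple_graph_def by auto
      then have x: "int x + 1 \<in> ?V" "?f (int x + 1) = x" using G(2) by auto
      then have "(c, int x + 1) \<in> E" using E[of c "int x + 1"] c C by auto
      moreover have "int x + 1 \<notin> C" using c(3) x(2) by force
      ultimately have "int x + 1 \<in> boundary E C" using c(1) unfolding boundary_def by blast
      then show "x \<in> ?f ` boundary E C" using x(2) by force
    next
      fix x assume "x \<in> ?f ` boundary E C"
      then obtain v c where v: "x = ?f v" "c \<in> C" "(c, v) \<in> E" "v \<notin> C" unfolding boundary_def by auto
      have "(?f c, ?f v) \<in> adj G" using E EV[OF v(3)] v(3) by blast
      moreover have "?f v \<notin> ?f ` C" using inj_on_image_mem_iff[OF inj EV(2)[OF v(3)] C] v(4) by blast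
      ultimately show "x \<in> boundary (adj G) (?f ` C)" unfolding boundary_def v(1) using v(2) by blast
    qed
    have "labelling_strategy (int n) (min (int w + 2) (int n + 1)) E (\<lambda>S. S \<subseteq> ?V \<and> ok (?f ` S))"
    proof
      show "0 \<le> int n" "1 \<le> min (int w + 2) (int n + 1)" by auto
      show "(v, u) \<in> E" if "(u, v) \<in> E" for u v using that unfolding E_def by (auto simp: insert_commute)
      show "u \<in> ?V \<and> v \<in> ?V" if "(u, v) \<in> E" for u v using EV[OF that] by blast
      show "(u, u) \<notin> E" for u using G(1) unfolding E_def simple_graph_def by fastforce
      show "{} \<subseteq> ?V \<and> ok (?f ` {})" using ok(1) by simp
      show "S' \<subseteq> ?V \<and> ok (?f ` S')" if S: "S \<subseteq> ?V \<and> ok (?f ` S)" "S' \<subseteq> S" for S S'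
        using S ok(2)[of "?f ` S" "?f ` S'"] by blast
    next
      fix S assume S: "S \<subseteq> ?V \<and> ok (?f ` S)"
      then have "card (?f ` S) = card S" using inj by (intro card_image) (auto intro: inj_on_subset)
      then have "card S \<le> w + 1" using ok(3)[of "?f ` S"] S by simp
      moreover have "card S \<le> card ?V" using S by (intro card_mono) auto
      ultimately show "S \<subseteq> ?V \<and> int (card S) < min (int w + 2) (int n + 1)" using S by simp
    next
      fix C assume C: "C \<subseteq> ?V" "C \<noteq> {}" "connected_within E C"
        and bd: "boundary E C \<subseteq> ?V \<and> ok (?f ` boundary E C)"
      have "connected_within (adj G) (?f ` C)" unfolding connected_within_def
      proof (intro ballI)
        fix x y assume "x \<in> ?f ` C" "y \<in> ?f ` C"
        then obtain u v where uv: "u \<in> C" "v \<in> C" "x = ?f u" "y = ?f v" by blast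
        have "(u, v) \<in> (E \<inter> C \<times> C)\<^sup>*" using C(3) uv unfolding connected_within_def by blast
        then show "(x, y) \<in> (adj G \<inter> (?f ` C) \<times> (?f ` C))\<^sup>*" unfolding uv(3,4)
        proof (induction rule: rtrancl_induct)
          case (step y z)
          then have "(?f y, ?f z) \<in> adj G \<inter> (?f ` C) \<times> (?f ` C)" using E[of y z] C(1) by blast
          with step.IH show ?case by (rule rtrancl_into_rtrancl)
        qed simp
      qed
      moreover have "?f ` C \<subseteq> verts G" using f C(1) by blast
      ultimately obtain z where "z \<in> C" "ok (insert (?f z) (?f ` boundary E C))"
        using ok(4)[of "?f ` C"] C(2) bd unfolding boundary[OF C(1)] by blast
      then show "\<exists>z\<in>C. insert z (boundary E C) \<subseteq> ?V \<and> ok (?f ` insert z (boundary E C))"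
        using C(1) bd by (intro bexI[of _ z]) auto
    qed
    then show ?thesis by (rule that)
  qed
qed

section \<open>Running time and input format\<close>

text \<open>With \<open>x = max 2 n\<close> one has \<open>n + 1 <= x ^ 2\<close> and
  \<open>3 * K + 2 <= 3 * w + 8\<close>. The other cells contribute at most
  \<open>4 * n + 7\<close>, so the base is at most \<open>8 * (n + 1) ^ (3 * w + 8)\<close>, hence
  at most \<open>x ^ (3 + 2 * (3 * w + 8))\<close>. The factor \<open>C\<close> is absorbed by
  \<open>x ^ C\<close>.\<close>

lemma time_bound:
  fixes n w C D :: nat
  assumes "K \<le> int w + 2" "1 \<le> K" "K \<le> int n + 1"
  shows "C * (nat ((int n + 1) ^ nat (3 * K + 2) + (3 * K + 2) + (int n + 1)) + 1) ^ D
    \<le> max 2 n ^ (C + D * (6 * w + 19))"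
proof -
  let ?x = "max 2 n" and ?k = "nat (3 * K + 2)"
  have x: "2 \<le> ?x" "1 \<le> ?x" "n + 1 \<le> ?x ^ 2"
  proof -
    show "2 \<le> ?x" "1 \<le> ?x" by auto
    have "n + 1 \<le> 2 * ?x" by simp
    also have "\<dots> \<le> ?x ^ 2" unfolding power2_eq_square by (intro mult_right_mono) auto
    finally show "n + 1 \<le> ?x ^ 2" .
  qed
  let ?y = "(n + 1) ^ (3 * w + 8)"
  have "nat ((int n + 1) ^ ?k) = (n + 1) ^ ?k"
    by (metis nat_int of_nat_1 of_nat_add of_nat_power)
  also have "\<dots> \<le> ?y" using assms by (intro power_increasing) auto
  finally have 1: "nat ((int n + 1) ^ ?k) \<le> ?y" .
  have 2: "n + 1 \<le> ?y" by (rule self_le_power) auto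
  have "nat ((int n + 1) ^ ?k + (3 * K + 2) + (int n + 1)) + 1 \<le> nat ((int n + 1) ^ ?k) + 4 * n + 7"
    using assms zero_le_power[of "int n + 1" ?k] by linarith
  also have "\<dots> \<le> 8 * ?y" using 1 2 by linarith
  also have "\<dots> \<le> ?x ^ 3 * (?x ^ 2) ^ (3 * w + 8)"
    using power_mono[OF x(1), of 3] power_mono[OF x(3), of "3 * w + 8"] by (intro mult_mono) auto
  also have "\<dots> = ?x ^ (6 * w + 19)"
    by (simp flip: power_mult power_add add: algebra_simps)
  finally have "(nat ((int n + 1) ^ ?k + (3 * K + 2) + (int n + 1)) + 1) ^ D \<le> (?x ^ (6 * w + 19)) ^ D"
    by (rule power_mono) simp
  moreover have "C \<le> ?x ^ C"
  proof -
    have "C \<le> 2 ^ C" using less_exp[of C] by simp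
    also have "\<dots> \<le> ?x ^ C" by (rule power_mono) auto
    finally show ?thesis .
  qed
  ultimately show ?thesis
    by (simp add: mult_le_mono power_add power_mult mult.commute[of D])
qed

lemma input_edge_cell:
  assumes "u \<in> {1..int n}" "v \<in> {1..int n}"
  shows "snd (input_state n G \<tau>) (u * int n + v) = of_bool ({nat (u - 1), nat (v - 1)} \<in> edges G)"
proof -
  obtain i j where ij: "u = int i + 1" "v = int j + 1" "i < n" "j < n"
    using assms that[of "nat (u - 1)" "nat (v - 1)"] by auto
  have a: "u * int n + v = int (n + 1 + (i * n + j))" unfolding ij by (simp add: algebra_simps)
  have "i * n + j < (i + 1) * n" using ij(4) by simp
  also have "\<dots> \<le> n * n" using ij(3) by (intro mult_right_mono) auto
  finally have "n + 1 + (i * n + j) \<le> n + n * n" by simp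
  moreover have "(i * n + j) div n = i" "(i * n + j) mod n = j" using ij(4) by simp_all
  moreover have "n + 1 + (i * n + j) - n - 1 = i * n + j" by simp
  ultimately have "input_memory n G \<tau> (n + 1 + (i * n + j)) = of_bool ({i, j} \<in> edges G)"
    unfolding input_memory_def by (simp only:) simp
  then show ?thesis unfolding input_state_def a snd_conv nat_int using ij(1,2) by simp
qed

lemma input_threshold_cell:
  assumes "v \<in> {1..int n}"
  shows "snd (input_state n G \<tau>) v = \<tau> (nat (v - 1))"
  using assms unfolding input_state_def input_memory_def by (auto simp: nat_diff_distrib)

lemma input_empty_cell:
  assumes "int n * int n + int n < a"
  shows "snd (input_state n G \<tau>) a = 0"
proof -
  have a: "int (n * n + n) < a" using assms by simp
  then have "n * n + n < nat a" by linarith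
  then have "nat a \<noteq> 0" "\<not> nat a \<le> n" "\<not> nat a \<le> n + n * n" by linarith+
  then show ?thesis unfolding input_state_def input_memory_def by (simp only: snd_conv if_False if_cancel)
qed

theorem theorem5:
  "\<exists>g :: nat \<Rightarrow> nat. (\<lambda>w. real (g w)) \<in> O(\<lambda>w. real w) \<and>
     (\<forall>w. \<exists>c :: com. \<forall>(n :: nat) (G :: nat graph) (\<tau> :: nat \<Rightarrow> int).
        simple_graph G \<and> verts G = {..<n} \<and> treewidth G \<le> w \<longrightarrow>
        (\<exists>t s \<sigma>. exec c (input_state n G \<tau>) t s \<and> t \<le> max 2 n ^ g w \<and>
           output_is n s \<sigma> \<and> optimal_partial_incentive G \<tau> \<sigma>))"
proof -
  obtain c1 T1 where c1: "poly_bounded T1"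
    "\<forall>r m M. bounded M m \<longrightarrow> (\<exists>r'. runs c1 (r, m) (T1 M) (r', power_loop m))"
    using implementable_run[OF implementable_power] by (elim exE conjE) (rule that)
  obtain c2 T2 where c2: "poly_bounded T2"
    "\<forall>r m M. bounded M m \<longrightarrow> (\<exists>r'. runs c2 (r, m) (T2 M) (r', output_loop (loop_r (init_loop m))))"
    using implementable_run[OF implementable_main] by (elim exE conjE) (rule that)
  \<comment> \<open>Neither \<open>c1\<close> nor \<open>c2\<close> depends on \<open>w\<close>, so
    \<open>C\<close> and \<open>D\<close> are fixed before \<open>w\<close>; this makes the exponent
    linear in \<open>w\<close>.\<close>
  let ?T = "\<lambda>M. 40 + (T1 M + (7 + T2 M + 1) + 1) + 1"
  have "poly_bounded ?T" by (intro poly_bounded_intros c1 c2)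
  then obtain C D where CD: "\<And>M. ?T M \<le> C * (M + 1) ^ D" unfolding poly_bounded_def by blast
  \<comment> \<open>The last power written by \<open>power_loop\<close> is the number of states. It
    goes to a bound cell, which \<open>put\<close> refuses to write and sequential composition
    requires to be preserved; so a bare command separates the two programs.\<close>
  let ?s = "Store (Const (-1)) (Load (Sub (Const (-5)) (Load (Const (-3)))))"
  show ?thesis
  proof (intro exI[of _ "\<lambda>w. C + D * (6 * w + 19)"] conjI allI)
    \<comment> \<open>For \<open>w >= 1\<close> one has \<open>6 * w + 19 <= 25 * w\<close>; the
      constants matter only at \<open>w = 0\<close>, which the asymptotic bound ignores.\<close>
    have "real (C + D * (6 * w + 19)) \<le> real (C + 25 * D) * real w" if "1 \<le> w" for w
    proof -
      have "C * 1 \<le> C * w" "D * (6 * w + 19) \<le> D * (25 * w)"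
        using that by (intro mult_left_mono; simp)+
      moreover have "(C + 25 * D) * w = C * w + D * (25 * w)" by (simp add: algebra_simps)
      ultimately have "C + D * (6 * w + 19) \<le> (C + 25 * D) * w" by linarith
      then show ?thesis by (metis of_nat_le_iff of_nat_mult)
    qed
    then show "(\<lambda>w. real (C + D * (6 * w + 19))) \<in> O(\<lambda>w. real w)"
      by (intro bigoI[of _ "real (C + 25 * D)"] eventually_sequentiallyI[of 1]) simp
  next
    fix w
    show "\<exists>c. \<forall>n (G :: nat graph) \<tau>. simple_graph G \<and> verts G = {..<n} \<and> treewidth G \<le> w \<longrightarrow>
        (\<exists>t s \<sigma>. exec c (input_state n G \<tau>) t s \<and> t \<le> max 2 n ^ (C + D * (6 * w + 19)) \<and>
           output_is n s \<sigma> \<and> optimal_partial_incentive G \<tau> \<sigma>)"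
    proof (intro exI[of _ "Seq (start_code w) (Seq c1 (Seq ?s c2))"] allI impI)
      fix n and G :: "nat graph" and \<tau> :: "nat \<Rightarrow> int"
      assume "simple_graph G \<and> verts G = {..<n} \<and> treewidth G \<le> w"
      then have G: "simple_graph G" "verts G = {..<n}" "treewidth G \<le> w" by auto
      have finG: "finite (verts G)" unfolding G(2) by simp
      define E where "E = {(u, v). u \<in> {1..int n} \<and> v \<in> {1..int n} \<and> {nat (u - 1), nat (v - 1)} \<in> edges G}"
      define K where "K = min (int w + 2) (int n + 1)"
      obtain ok where "labelling_strategy (int n) K E ok"
        using input_strategy[OF G] unfolding E_def K_def by blast
      then interpret labelling_strategy "int n" K E "\<lambda>v. \<tau> (nat (v - 1))" ok .
      define m0 where "m0 = snd (input_state n G \<tau>)"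
      have m00: "m0 0 = int n" unfolding m0_def input_state_def input_memory_def by simp
      define m1 where "m1 = m0(-4 := m0 0 + 1, -2 := K, -3 := 3 * K + 2, -5 := 1)"
      define m2 where "m2 = power_loop m1"
      define m3 where "m3 = m2(-1 := m2 (-5 - m2 (-3)))"
      have K_le: "K \<le> int w + 2" "K \<le> int n + 1" unfolding K_def by auto
      have m1: "m1 (-3) = 3 * K + 2" "m1 (-4) = int n + 1" "m1 (-5) = 1" "m1 (-2) = K"
        unfolding m1_def m00 by simp_all
      have "m0 (-1) = 0" unfolding m0_def input_state_def by simp
      then have m1_1: "m1 (-1) = 0" unfolding m1_def by simp
      have m2: "m2 c = (if -5 - (3 * K + 2) \<le> c \<and> c \<le> -6 then (int n + 1) ^ nat (-5 - c) else m1 c)" for c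
        unfolding m2_def by (rule power_loop_eq[OF m1(1-3)]) simp
      have "m2 (-3) = 3 * K + 2" unfolding m2 using m1(1) by simp
      moreover have "m2 (-5 - (3 * K + 2)) = num_states"
      proof -
        have "-5 - (-5 - (3 * K + 2)) = 3 * K + 2" "-5 - (3 * K + 2) \<le> -6" using K by simp_all
        then show ?thesis unfolding m2 by (simp only: simp_thms order_refl if_True)
      qed
      ultimately have m3: "m3 = m2(-1 := num_states)" unfolding m3_def by simp
      have m3_input: "m3 c = m0 c" if "0 \<le> c" for c using that unfolding m3 m2 m1_def by simp
      have prepared: "prepared m3" unfolding prepared_def
      proof (intro conjI ballI)
        show "m3 0 = int n" using m3_input m00 by simp
        show "m3 (-1) = num_states" "m3 (-2) = K" "m3 (-3) = 3 * K + 2" "m3 (-4) = int n + 1"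
          unfolding m3 m2 using m1 by simp_all
        show "m3 (-5 - i) = (int n + 1) ^ nat i" if "i \<in> {0..3 * K + 2}" for i
          using that m1(3) unfolding m3 m2 by (cases "i = 0") auto
        show "m3 (u * int n + v) = 1 \<longleftrightarrow> (u, v) \<in> E" if "u \<in> V" "v \<in> V" for u v
        proof -
          have "0 \<le> u * int n + v" using that by simp
          then show ?thesis
            using m3_input input_edge_cell[OF that, of G \<tau>] that unfolding m0_def E_def by simp
        qed
        show "m3 v = \<tau> (nat (v - 1))" if "v \<in> V" for v
          using m3_input[of v] input_threshold_cell[OF that, of G \<tau>] that unfolding m0_def by simp
      qed
      have table: "table m3 = (\<lambda>e v. 0)"
      proof (intro ext)
        fix e v
        have "m3 (address e v) = 0" if "e \<in> states" "v \<in> {0..<int n + 1}"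
        proof -
          have gt: "int n * int n + int n < address e v" by (rule address_gt) (use that in auto)
          moreover have "0 \<le> int n * int n + int n" by simp
          ultimately have "0 \<le> address e v" by linarith
          then show ?thesis using m3_input[of "address e v"] input_empty_cell[OF gt]
            unfolding m0_def by simp
        qed
        then show "table m3 e v = 0" unfolding table_def by simp
      qed
      define m4 where "m4 = loop_r (init_loop m3)"
      note m4 = loop_r_optimal[OF prepared table, folded m4_def]
      \<comment> \<open>Above each of the four cells, both before and after the number of states is
        stored; cell -1 is 0 at first.\<close>
      define M where "M = nat ((int n + 1) ^ nat (3 * K + 2) + (3 * K + 2) + (int n + 1))"
      have pos: "0 < num_states" by simp
      have bounded: "bounded M m1" "bounded M m3"
        unfolding bounded_def M_def using m1 m1_1 preparedD(2-5)[OF prepared] pos K by auto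
      have "runs (start_code w) (\<lambda>x. 0, m0) 40 (\<lambda>x. 0, m1)"
        unfolding m1_def by (rule runs_start_code) (simp add: K_def m00)
      moreover obtain r1 where "runs c1 (\<lambda>x. 0, m1) (T1 M) (r1, m2)"
        using c1(2)[rule_format, OF bounded(1), of "\<lambda>x. 0", folded m2_def] by (elim exE) (rule that)
      moreover have "runs ?s (r1, m2) 7 (r1, m3)"
        using runs_Store[of "Const (-1)" "Load (Sub (Const (-5)) (Load (Const (-3))))" "(r1, m2)"]
        unfolding m3_def by (simp add: eval_nat_numeral)
      moreover obtain r2 where "runs c2 (r1, m3) (T2 M) (r2, output_loop m4)"
        using c2(2)[rule_format, OF bounded(2), of r1, folded m4_def] by (elim exE) (rule that)
      ultimately have "runs (Seq (start_code w) (Seq c1 (Seq ?s c2))) (\<lambda>x. 0, m0) (?T M) (r2, output_loop m4)"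
        by (rule runs_Seq[OF _ runs_Seq[OF _ runs_Seq]])
      moreover have "(\<lambda>x. 0, m0) = input_state n G \<tau>" unfolding m0_def input_state_def by simp
      moreover have "?T M \<le> max 2 n ^ (C + D * (6 * w + 19))"
        using CD[of M] time_bound[OF K_le(1) K K_le(2), of C D] unfolding M_def by (rule order_trans)
      ultimately have "runs (Seq (start_code w) (Seq c1 (Seq ?s c2))) (input_state n G \<tau>)
          (max 2 n ^ (C + D * (6 * w + 19))) (r2, output_loop m4)"
        by (simp only: runs_mono)
      then obtain t where t: "t \<le> max 2 n ^ (C + D * (6 * w + 19))"
        "exec (Seq (start_code w) (Seq c1 (Seq ?s c2))) (input_state n G \<tau>) t (r2, output_loop m4)"
        unfolding runs_def by (elim exE conjE) (rule that)

      \<comment> \<open>The shift by 1 of the table is undone; the root row is at least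
        \<open>1 + cost\<close>, so \<open>nat\<close> cuts nothing off.\<close>
      define \<sigma> where "\<sigma> v = nat (table m4 0 (int v + 1) - 1)" for v
      obtain p where p: "\<And>v. v \<in> V \<Longrightarrow> 1 + cost p v \<le> table m4 0 v" using m4(2) by blast
      have \<sigma>: "int (\<sigma> v) = table m4 0 (int v + 1) - 1" if "v < n" for v
      proof -
        have "0 \<le> cost p (int v + 1)" unfolding cost_def by simp
        then show ?thesis unfolding \<sigma>_def using p[of "int v + 1"] that by simp
      qed
      have sum_V: "(\<Sum>v\<in>V. f v) = (\<Sum>v<n. f (int v + 1))" for f :: "int \<Rightarrow> int"
        by (rule sum.reindex_bij_witness[of _ "\<lambda>i. int i + 1" "\<lambda>v. nat (v - 1)"]) auto
      have earlier: "earlier q V (int v + 1) c = int (card {u \<in> neighbours G v. q (int u + 1) < c})"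
        if "v < n" for q v c
      proof -
        have "{u \<in> V. (int v + 1, u) \<in> E \<and> q u < c} =
            (\<lambda>u. int u + 1) ` {u \<in> neighbours G v. q (int u + 1) < c}" (is "?A = ?h ` ?B")
        proof (intro equalityI subsetI)
          fix u assume u: "u \<in> ?A"
          then have "0 \<le> u - 1" by simp
          then obtain x where "u - 1 = int x" by (rule nonneg_int_cases)
          then have x: "u = ?h x" by simp
          have "x \<in> ?B" using u unfolding x E_def neighbours_def G(2) by simp
          then show "u \<in> ?h ` ?B" unfolding x by (rule imageI)
        next
          fix u assume "u \<in> ?h ` ?B"
          then obtain x where x: "u = ?h x" "x \<in> ?B" by (rule imageE)
          then show "u \<in> ?A" using that unfolding x(1) E_def neighbours_def G(2) by simp
        qed
        moreover have "card (?h ` ?B) = card ?B" by (rule card_image) (simp add: inj_on_def)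
        ultimately show ?thesis unfolding earlier_def by simp
      qed
      have cost: "cost q (int v + 1) =
          max 0 (\<tau> v - int (card {u \<in> neighbours G v. q (int u + 1) < q (int v + 1)}))" if "v < n" for q v
        unfolding cost_def earlier[OF that] by simp
      have "partial_incentive G \<tau> \<sigma>"
      proof (rule labelling_partial_incentive[OF finG, of _ _ "\<lambda>v. p (int v + 1)"])
        fix v assume "v \<in> verts G"
        then have v: "v < n" using G(2) by simp
        then show "\<tau> v - int (\<sigma> v) \<le> int (card {u \<in> neighbours G v. p (int u + 1) < p (int v + 1)})"
          using p[of "int v + 1"] unfolding cost[OF v] \<sigma>[OF v] by simp
      qed
      moreover have "weight G \<sigma> \<le> weight G \<sigma>'" if \<sigma>': "partial_incentive G \<tau> \<sigma>'" for \<sigma>'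
      proof (rule partial_incentive_labelling[OF finG \<sigma>'])
        fix q :: "nat \<Rightarrow> nat" assume q: "\<And>v. v \<in> verts G \<Longrightarrow> q v \<le> card (verts G)"
          "\<And>v. v \<in> verts G \<Longrightarrow> \<tau> v - int (\<sigma>' v) \<le> int (card {u \<in> neighbours G v. q u < q v})"
        \<comment> \<open>The activation times of the competing incentive, moved to vertex numbers
          from 1 on; they are at most \<open>n\<close> and therefore admissible labels.\<close>
        define P where "P v = int (q (nat (v - 1)))" for v
        have "P v \<in> {0..int n}" if "v \<in> V" for v
        proof -
          have "nat (v - 1) < n" using that by (subst nat_less_iff) auto
          then have "q (nat (v - 1)) \<le> card (verts G)" by (intro q(1)) (simp only: G(2) lessThan_iff)
          then show ?thesis unfolding P_def G(2) by simp
        qed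
        then have "(\<Sum>v\<in>V. table m4 0 v) \<le> (\<Sum>v\<in>V. 1 + cost P v)" by (rule m4(3))
        then have "(\<Sum>v<n. table m4 0 (int v + 1)) \<le> (\<Sum>v<n. 1 + cost P (int v + 1))" unfolding sum_V .
        moreover have "(\<Sum>v<n. table m4 0 (int v + 1)) = (\<Sum>v<n. int (\<sigma> v) + 1)"
          by (rule sum.cong) (simp_all add: \<sigma>)
        moreover have "(\<Sum>v<n. 1 + cost P (int v + 1)) \<le> (\<Sum>v<n. int (\<sigma>' v) + 1)"
        proof (rule sum_mono)
          fix v assume "v \<in> {..<n}"
          then have v: "v < n" "v \<in> verts G" using G(2) by auto
          show "1 + cost P (int v + 1) \<le> int (\<sigma>' v) + 1"
            unfolding cost[OF v(1)] P_def using q(2)[OF v(2)] by simp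
        qed
        ultimately have "(\<Sum>v<n. int (\<sigma> v) + 1) \<le> (\<Sum>v<n. int (\<sigma>' v) + 1)" by linarith
        then have "(\<Sum>v<n. int (\<sigma> v)) \<le> (\<Sum>v<n. int (\<sigma>' v))" by (simp add: sum.distrib)
        then have "int (\<Sum>v<n. \<sigma> v) \<le> int (\<Sum>v<n. \<sigma>' v)" by (simp only: of_nat_sum)
        then show ?thesis unfolding weight_def G(2) by (simp only: of_nat_le_iff)
      qed
      ultimately have "optimal_partial_incentive G \<tau> \<sigma>" unfolding optimal_partial_incentive_def by blast
      moreover have "output_is n (r2, output_loop m4) \<sigma>"
        unfolding output_is_def using output_loop_eq[OF m4(1)] \<sigma> by simp
      ultimately show "\<exists>t s \<sigma>. exec (Seq (start_code w) (Seq c1 (Seq ?s c2))) (input_state n G \<tau>) t s \<and>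
          t \<le> max 2 n ^ (C + D * (6 * w + 19)) \<and> output_is n s \<sigma> \<and> optimal_partial_incentive G \<tau> \<sigma>"
        using t by blast
    qed
  qed
qed

end
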